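(* Let $\phi\in\mathcal{H}_d^*$ and assume that every member of $\Omega(\phi)$ is a point of positive-homogeneous type for $\widehat{\phi}$. Write $\Omega(\phi)=\{\xi_1,\dots,\xi_K\}$ and, for $k=1,\dots,K$, let $\alpha_k\in\mathbb{R}^d$, $P_k$, $R_k=\operatorname{Re}P_k$ and $\mu_k$ be the drift, positive-homogeneous polynomial, its real part, and its homogeneous order associated to $\xi_k$. Then there exist a constant $L>0$ and positive constants $M_0,M_1,\dots,M_K,C_1,C_2,\dots,C_K$ for which $$|\phi^{(n)}(x)|\leq \mathcal{E}(n,x)\qquad\text{for all } n\in\mathbb{N}_+ \text{ and } x\in\mathbb{Z}^d,$$ where $$\mathcal{E}(n,x)=\begin{cases} e^{-M_0(n+|x|)} & |x|>Ln,\\[1ex] \displaystyle\sum_{k=1}^K\frac{C_k}{n^{\mu_k}}\exp\left(-nM_kR_k^{\#}\left(\frac{x-n\alpha_k}{n}\right)\right) & |x|\leq Ln.\end{cases}$$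
   Context: $\mathbb{N}_+$ denotes the positive integers, $|\cdot|$ the Euclidean norm, $\mathbb{T}^d=(-\pi,\pi]^d$. Convolution powers. For $\phi\in\ell^1(\mathbb{Z}^d)$ (complex-valued, absolutely summable), $(\phi*\lambda)(x)=\sum_{y\in\mathbb{Z}^d}\phi(x-y)\lambda(y)$, $\phi^{(1)}=\phi$ and $\phi^{(n)}=\phi^{(n-1)}*\phi$ for $n\ge 2$. The Fourier transform is $\widehat{\phi}(\xi)=\sum_{x\in\mathbb{Z}^d}\phi(x)e^{ix\cdot\xi}$. $\mathcal{H}_d$ is the set of $\phi\in\ell^1(\mathbb{Z}^d)$ for which $\widehat\phi$ is holomorphic on (i.e. extends holomorphically to) a neighborhood of $\mathbb{T}^d$ in $\mathbb{C}^d$. $\mathcal{H}_d^*$ is the set of $\phi\in\mathcal{H}_d$ with $\sup_{\xi\in\mathbb{T}^d}|\widehat\phi(\xi)|=1$. For $\phi\in\mathcal{H}_d^*$, $\Omega(\phi)=\{\xi\in\mathbb{T}^d:|\widehat\phi(\xi)|=1\}$. Positive-homogeneous polynomials. For a real $d\times d$ matrix $E$ and $t>0$, $t^E=\exp((\ln t)E)$. For $P:\mathbb{R}^d\to\mathbb{C}$, $\operatorname{Exp}(P)$ is the set of real $d\times d$ matrices $E$ with $tP(\xi)=P(t^E\xi)$ for all $t>0$, $\xi\in\mathbb{R}^d$. A complex polynomial $P$ in $d$ variables is a positive-homogeneous polynomial if $\operatorname{Exp}(P)\neq\varnothing$ and $R=\operatorname{Re}P$ (on $\mathbb{R}^d$)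 is positive-definite: $R(\xi)\geq 0$ and $R(\xi)=0$ only when $\xi=0$. Its homogeneous order is $\mu_P=\operatorname{tr}E$ for any $E\in\operatorname{Exp}(P)$ (a positive number independent of $E$). The Legendre-Fenchel transform of $R$ is $R^{\#}(x)=\sup_{\xi\in\mathbb{R}^d}\{x\cdot\xi-R(\xi)\}$, $x\in\mathbb{R}^d$. Type of points. For $\xi_0\in\Omega(\phi)$ set $\Gamma_{\xi_0}(\xi)=\operatorname{Log}\big(\widehat\phi(\xi+\xi_0)/\widehat\phi(\xi_0)\big)$ (principal branch), which is holomorphic on a neighborhood of $0$ in $\mathbb{C}^d$. The point $\xi_0$ is of positive-homogeneous type for $\widehat\phi$ if $\Gamma_{\xi_0}(\xi)=i\alpha_{\xi_0}\cdot\xi-P_{\xi_0}(\xi)+\Upsilon_{\xi_0}(\xi)$ where $\alpha_{\xi_0}\in\mathbb{R}^d$ (the drift), $P_{\xi_0}$ is a positive-homogeneous polynomial with $R_{\xi_0}=\operatorname{Re}P_{\xi_0}$, and $\Upsilon_{\xi_0}(\xi)=o(R_{\xi_0}(\xi))$ as $\xi\to0$ in $\mathbb{R}^d$. If every point of $\Omega(\phi)$ is of this type then $\Omega(\phi)$ is finite; one writes $\alpha_k=\alpha_{\xi_k}$, $P_k=P_{\xi_k}$, $R_k=R_{\xi_k}$, $\mu_k=\mu_{P_{\xi_k}}$. *)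

theory Defs
  imports "HOL-Analysis.Analysis" "HOL-Library.Landau_Symbols"
begin

section \<open>Convolution powers and Fourier transforms on the integer lattice\<close>

definition real_vec :: "int ^ 'd \<Rightarrow> real ^ 'd" where
  "real_vec x = (\<chi> i. real_of_int (x $ i))"

definition complex_vec :: "real ^ 'd \<Rightarrow> complex ^ 'd" where
  "complex_vec \<xi> = (\<chi> i. complex_of_real (\<xi> $ i))"

definition convolution ::
    "(int ^ 'd \<Rightarrow> complex) \<Rightarrow> (int ^ 'd \<Rightarrow> complex) \<Rightarrow> int ^ 'd \<Rightarrow> complex" where
  "convolution \<phi> \<psi> x = (\<Sum>\<^sub>\<infinity>y. \<phi> (x - y) * \<psi> y)"

text \<open>The first power is \<open>\<phi>\<close>, and each further power convolves the previous one with \<open>\<phi>\<close>. Only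
  exponents \<open>n \<ge> 1\<close> are meaningful.\<close>
definition conv_power :: "(int ^ 'd \<Rightarrow> complex) \<Rightarrow> nat \<Rightarrow> int ^ 'd \<Rightarrow> complex" where
  "conv_power \<phi> n = ((\<lambda>\<psi>. convolution \<psi> \<phi>) ^^ (n - 1)) \<phi>"

definition fourier :: "(int ^ 'd \<Rightarrow> complex) \<Rightarrow> real ^ 'd \<Rightarrow> complex" where
  "fourier \<phi> \<xi> = (\<Sum>\<^sub>\<infinity>x. \<phi> x * exp (\<i> * complex_of_real (real_vec x \<bullet> \<xi>)))"

definition torus :: "(real ^ 'd) set" where
  "torus = {\<xi>. \<forall>i. - pi < \<xi> $ i \<and> \<xi> $ i \<le> pi}"

text \<open>Holomorphy in several variables: a complex-linear Frechet derivative at every point.\<close>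
definition holomorphic_sev :: "(complex ^ 'd \<Rightarrow> complex) \<Rightarrow> (complex ^ 'd) set \<Rightarrow> bool" where
  "holomorphic_sev F U \<longleftrightarrow>
     open U \<and> (\<forall>z\<in>U. \<exists>F'. (F has_derivative F') (at z) \<and> Vector_Spaces.linear (*s) (*) F')"

text \<open>The extension has to agree with the Fourier transform at all real points of the neighborhood,
  not just on \<open>torus\<close>: the latter is half-open, and agreement there alone would not see
  a failure of smoothness of the periodic function \<open>fourier \<phi>\<close> across its boundary.\<close>
definition H_class :: "(int ^ 'd \<Rightarrow> complex) set" where
  "H_class = {\<phi>. (\<lambda>x. cmod (\<phi> x)) summable_on UNIV \<and>
     (\<exists>U F. complex_vec ` torus \<subseteq> U \<and> holomorphic_sev F U \<and>
        (\<forall>\<xi>. complex_vec \<xi> \<in> U \<longrightarrow> F (complex_vec \<xi>) = fourier \<phi> \<xi>))}"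

definition H_star :: "(int ^ 'd \<Rightarrow> complex) set" where
  "H_star = {\<phi> \<in> H_class. (SUP \<xi>\<in>torus. cmod (fourier \<phi> \<xi>)) = 1}"

definition Omega :: "(int ^ 'd \<Rightarrow> complex) \<Rightarrow> (real ^ 'd) set" where
  "Omega \<phi> = {\<xi> \<in> torus. cmod (fourier \<phi> \<xi>) = 1}"

section \<open>Positive-homogeneous polynomials\<close>

text \<open>The class multiplication on the type of vectors is componentwise, so the library's \<open>exp\<close> and
  powers are not those of matrices.\<close>
definition matrix_exp :: "real ^ 'd ^ 'd \<Rightarrow> real ^ 'd ^ 'd" where
  "matrix_exp A = (\<Sum>n. (1 / fact n) *\<^sub>R (((**) A ^^ n) (mat 1)))"

definition matrix_rpow :: "real \<Rightarrow> real ^ 'd ^ 'd \<Rightarrow> real ^ 'd ^ 'd" where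
  "matrix_rpow t E = matrix_exp (ln t *\<^sub>R E)"

definition Exp :: "(real ^ 'd \<Rightarrow> complex) \<Rightarrow> (real ^ 'd ^ 'd) set" where
  "Exp P = {E. \<forall>t>0. \<forall>\<xi>. complex_of_real t * P \<xi> = P (matrix_rpow t E *v \<xi>)}"

text \<open>Polynomials in \<open>d\<close> variables with complex coefficients, as functions on the real space.\<close>
definition complex_polynomial :: "(real ^ 'd \<Rightarrow> complex) \<Rightarrow> bool" where
  "complex_polynomial P \<longleftrightarrow>
     (\<exists>(B :: (nat ^ 'd) set) a. finite B \<and>
        (\<forall>\<xi>. P \<xi> = (\<Sum>\<beta>\<in>B. a \<beta> * (\<Prod>i\<in>UNIV. complex_of_real (\<xi> $ i) ^ (\<beta> $ i)))))"

definition pos_hom_polynomial :: "(real ^ 'd \<Rightarrow> complex) \<Rightarrow> bool" where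
  "pos_hom_polynomial P \<longleftrightarrow> complex_polynomial P \<and> Exp P \<noteq> {} \<and>
     (\<forall>\<xi>. Re (P \<xi>) \<ge> 0 \<and> (Re (P \<xi>) = 0 \<longrightarrow> \<xi> = 0))"

text \<open>For a positive-homogeneous \<open>P\<close> the trace does not depend on the chosen exponent.\<close>
definition hom_order :: "(real ^ 'd \<Rightarrow> complex) \<Rightarrow> real" where
  "hom_order P = trace (SOME E. E \<in> Exp P)"

text \<open>A real supremum; for the real part of a positive-homogeneous polynomial it is finite.\<close>
definition legendre :: "(real ^ 'd \<Rightarrow> real) \<Rightarrow> real ^ 'd \<Rightarrow> real" where
  "legendre R x = (SUP \<xi>. x \<bullet> \<xi> - R \<xi>)"

section \<open>Points of positive-homogeneous type\<close>

definition Gamma_at :: "(int ^ 'd \<Rightarrow> complex) \<Rightarrow> real ^ 'd \<Rightarrow> real ^ 'd \<Rightarrow> complex" where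
  "Gamma_at \<phi> \<xi>0 \<xi> = Ln (fourier \<phi> (\<xi> + \<xi>0) / fourier \<phi> \<xi>0)"

text \<open>\<open>\<xi>0\<close> is of positive-homogeneous type with drift \<open>\<alpha>\<close> and positive-homogeneous polynomial \<open>P\<close>.\<close>
definition pos_hom_expansion ::
    "(int ^ 'd \<Rightarrow> complex) \<Rightarrow> real ^ 'd \<Rightarrow> real ^ 'd \<Rightarrow> (real ^ 'd \<Rightarrow> complex) \<Rightarrow> bool" where
  "pos_hom_expansion \<phi> \<xi>0 \<alpha> P \<longleftrightarrow> pos_hom_polynomial P \<and>
     (\<exists>\<Upsilon>. (\<forall>\<^sub>F \<xi> in nhds 0. Gamma_at \<phi> \<xi>0 \<xi> = \<i> * complex_of_real (\<alpha> \<bullet> \<xi>) - P \<xi> + \<Upsilon> \<xi>) \<and>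
          \<Upsilon> \<in> o[at 0](\<lambda>\<xi>. complex_of_real (Re (P \<xi>))))"

definition pos_hom_type :: "(int ^ 'd \<Rightarrow> complex) \<Rightarrow> real ^ 'd \<Rightarrow> bool" where
  "pos_hom_type \<phi> \<xi>0 \<longleftrightarrow> (\<exists>\<alpha> P. pos_hom_expansion \<phi> \<xi>0 \<alpha> P)"

end

theory Submission
  imports Defs "HOL-Complex_Analysis.Conformal_Mappings" "HOL-Real_Asymp.Real_Asymp"
begin

text \<open>
  The proof shifts the contour in the Fourier inversion formula, and it does so on the side of the
  coefficients. A function \<open>\<phi>\<close> whose transform is holomorphic near the torus decays
  exponentially (\<open>H_class_weighted\<close>), so its transform extends to a tube as the series
  \<open>fourier_tube \<phi> \<xi> \<nu>\<close>, the value of the transform at \<open>\<xi> + \<i>\<nu>\<close> for \<open>norm \<nu> \<le> a\<close>, and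
  the \<open>n\<close>-th convolution power has the \<open>n\<close>-th power of this extension as its own. For every series
  on the tube and every tilt \<open>\<nu>\<close>, the coefficient at \<open>x\<close> is at most \<open>exp (x \<bullet> \<nu>)\<close> times the mean over
  the torus of the modulus at height \<open>\<nu>\<close> (\<open>coefficient_bound\<close>). The tilt may depend on \<open>x\<close> and \<open>n\<close>,
  and choosing it well gives all the bounds.

  For \<open>norm x > L n\<close> a tilt of maximal length directed against \<open>x\<close> suffices (\<open>far_field\<close>).

  For \<open>norm x \<le> L n\<close> the peaks compete: two points of \<open>Omega \<phi>\<close> can have the same drift but
  incomparable polynomials, and then no single tilt gives the bound. The power is therefore split
  into one piece for each peak, each with a tilt of its own, and a remainder. The splitting has to
  preserve holomorphy. Let \<open>G\<close> be a trigonometric polynomial with values in \<open>[0, 1]\<close> on the real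
  torus, equal to \<open>1\<close> at one peak and nearly \<open>0\<close> at the others. The piece of this peak is obtained by
  multiplying with \<open>majority n G\<close>, the probability of more than \<open>n / 2\<close> successes in \<open>n\<close> independent
  trials of success probability \<open>G\<close>. Near the chosen peak this polynomial in \<open>G\<close> differs from \<open>1\<close>,
  and near the others from \<open>0\<close>, by an exponentially small amount. Elsewhere its modulus is at most
  \<open>(\<bar>G\<bar> + \<bar>1 - G\<bar>) ^ n\<close>, whose base equals \<open>1\<close> on the real torus, so for small tilts the decay of
  the \<open>n\<close>-th power away from the peaks wins (\<open>pointwise_localized\<close>, \<open>pointwise_remainder\<close>).

  Near a peak \<open>\<theta>\<close> with drift \<open>\<alpha>\<close> and \<open>R = Re P\<close>, the modulus of the transform at
  \<open>\<theta> + \<xi> + \<i>\<nu>\<close> is at most \<open>exp (- \<alpha> \<bullet> \<nu> - R \<xi> / 4 + C * R \<nu>)\<close> (\<open>local_estimate\<close>). The hypothesis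
  concerns real arguments only. It is carried to complex ones by interpolation on complex lines: the
  value of a holomorphic function at \<open>\<i>\<close> is a fixed linear combination of its values at the nodes
  \<open>0, \<dots>, N\<close>, up to a Taylor remainder of order \<open>N + 1\<close>. Comparisons between the terms follow from
  compactness and the dilations \<open>t\<^sup>E\<close>, which are treated in the locale \<open>homogeneous_flow\<close>.

  Integrating the local estimate over \<open>\<xi>\<close> gives the factor \<open>n powr - trace E\<close> by the substitution
  \<open>\<xi> = n\<^sup>-\<^sup>E \<eta>\<close>, because \<open>det (t\<^sup>E) = t powr trace E\<close>. It remains to choose \<open>\<nu>\<close>. With
  \<open>w = x / n - \<alpha>\<close> the exponent is \<open>n (w \<bullet> \<nu> + C * R \<nu>)\<close>. Take \<open>\<nu> = - s \<zeta>\<close>, where \<open>\<zeta>\<close> nearly attains the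
  supremum that defines the Legendre transform of \<open>R\<close> at \<open>w\<close>. Since \<open>R (- s \<zeta>) \<le> K * s\<^sup>2 * R \<zeta>\<close>, for small
  fixed \<open>s\<close> the exponent is at most \<open>- n * s * (w \<bullet> \<zeta> - R \<zeta>)\<close>. All remaining errors are of size
  \<open>exp (- \<epsilon> n)\<close>, and the Legendre transform is bounded for \<open>norm w\<close> bounded, so they are absorbed by
  making the constants \<open>M\<^sub>k\<close> small (\<open>peak_contribution\<close>).
\<close>

section \<open>Integration on spaces of real vectors\<close>

lemma borel_measurable_vec_lambda:
  fixes f :: "'a \<Rightarrow> 'd::finite \<Rightarrow> real"
  assumes "\<And>i. (\<lambda>x. f x i) \<in> borel_measurable M"
  shows "(\<lambda>x. \<chi> i. f x i) \<in> borel_measurable M"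
proof -
  have eq: "(\<lambda>x. \<chi> i. f x i) = (\<lambda>x. \<Sum>i\<in>UNIV. f x i *\<^sub>R axis i 1)"
  proof
    fix x
    show "(\<chi> i. f x i) = (\<Sum>i\<in>UNIV. f x i *\<^sub>R axis i 1)"
      using basis_expansion[of "\<chi> i. f x i"] by (simp add: scalar_mult_eq_scaleR)
  qed
  show ?thesis unfolding eq
    by (intro borel_measurable_sum borel_measurable_scaleR assms borel_measurable_const)
qed

lemma prod_Basis_vec: "(\<Prod>b\<in>(Basis::(real^'d) set). g b) = (\<Prod>i\<in>UNIV. g (axis i 1))"
proof -
  have "(Basis::(real^'d) set) = (\<lambda>i. axis i 1) ` UNIV"
    by (auto simp: Basis_vec_def)
  moreover have "inj (\<lambda>i. axis i (1::real) :: real^'d)" by (simp add: inj_on_def axis_eq_axis)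
  ultimately show ?thesis by (metis (mono_tags, lifting) prod.cong prod.reindex_cong)
qed

text \<open>Lebesgue measure on vectors is the product of the one-dimensional ones over the index type.
  This form makes iterated integration in a single coordinate available.\<close>
lemma lborel_vec_eq:
  "(lborel :: (real ^ 'd) measure) = distr (\<Pi>\<^sub>M i\<in>UNIV. lborel) borel (\<lambda>f. \<chi> i. f i)"
proof (rule lborel_eqI)
  fix l u :: "real^'d"
  assume le: "\<And>b. b \<in> Basis \<Longrightarrow> l \<bullet> b \<le> u \<bullet> b"
  have le': "l $ i \<le> u $ i" for i
    using le[of "axis i 1"] by (auto simp: inner_axis axis_in_Basis_iff)
  interpret P: finite_product_sigma_finite "\<lambda>_. lborel" "UNIV :: 'd set"
    by standard auto
  have [measurable]: "(\<lambda>f. \<chi> i. f i) \<in> (\<Pi>\<^sub>M i\<in>(UNIV::'d set). (lborel::real measure)) \<rightarrow>\<^sub>M (borel :: (real^'d) measure)"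
    by (intro borel_measurable_vec_lambda) measurable
  have "emeasure (distr (\<Pi>\<^sub>M i\<in>UNIV. lborel) borel (\<lambda>f. \<chi> i. f i)) (box l u)
     = emeasure (\<Pi>\<^sub>M i\<in>(UNIV::'d set). (lborel::real measure)) (\<Pi>\<^sub>E i\<in>UNIV. {l$i<..<u$i})"
    by (subst emeasure_distr) (auto intro!: arg_cong2[where f=emeasure] simp: mem_box_cart space_PiM PiE_def extensional_def Pi_iff)
  also have "\<dots> = (\<Prod>i\<in>UNIV. ennreal (u$i - l$i))"
    by (subst P.emeasure_PiM) (auto simp: le')
  also have "\<dots> = ennreal (\<Prod>b\<in>Basis. (u - l) \<bullet> b)"
    by (simp add: prod_ennreal le' prod_Basis_vec inner_axis)
  finally show "emeasure (distr (\<Pi>\<^sub>M i\<in>UNIV. lborel) borel (\<lambda>f. \<chi> i. f i)) (box l u) = ennreal (\<Prod>b\<in>Basis. (u - l) \<bullet> b)" .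
qed simp

text \<open>Used for the orthogonality of characters on the torus and for the integrability of
  \<open>exp (- c * R \<xi>)\<close>, which is dominated by a product.\<close>
lemma integral_lborel_vec_prod:
  fixes f :: "'d::finite \<Rightarrow> real \<Rightarrow> 'b::{real_normed_field,banach,second_countable_topology}"
  assumes f: "\<And>i. integrable lborel (f i)"
  shows "integrable lborel (\<lambda>x::real^'d. \<Prod>i\<in>UNIV. f i (x $ i))"
    and "(\<integral>x. (\<Prod>i\<in>UNIV. f i ((x::real^'d) $ i)) \<partial>lborel) = (\<Prod>i\<in>UNIV. (\<integral>t. f i t \<partial>lborel))"
proof -
  interpret P: product_sigma_finite "\<lambda>_::'d. lborel :: real measure"
    by standard 
  have meas [measurable]: "(\<lambda>f. \<chi> i. f i) \<in> (\<Pi>\<^sub>M i\<in>(UNIV::'d set). (lborel::real measure)) \<rightarrow>\<^sub>M (borel :: (real^'d) measure)"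
    by (intro borel_measurable_vec_lambda) measurable
  have [measurable]: "f i \<in> borel_measurable borel" for i
    using borel_measurable_integrable[OF f] by simp
  have m2: "(\<lambda>x::real^'d. \<Prod>i\<in>UNIV. f i (x $ i)) \<in> borel_measurable borel"
  proof (rule borel_measurable_prod)
    fix i
    have "(\<lambda>x::real^'d. x $ i) \<in> borel_measurable borel"
      by (intro borel_measurable_continuous_onI continuous_intros)
    then show "(\<lambda>x::real^'d. f i (x $ i)) \<in> borel_measurable borel"
      by (rule measurable_compose) measurable
  qed
  have m1: "(\<lambda>f. \<chi> i. f i) \<in> (\<Pi>\<^sub>M i\<in>(UNIV::'d set). (lborel::real measure)) \<rightarrow>\<^sub>M (borel :: (real^'d) measure)"
    by (rule meas)
  have I: "integrable (\<Pi>\<^sub>M i\<in>UNIV. lborel) (\<lambda>x. \<Prod>i\<in>UNIV. f i (x i))"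
    by (rule P.product_integrable_prod) (auto intro: f)
  show "integrable lborel (\<lambda>x::real^'d. \<Prod>i\<in>UNIV. f i (x $ i))"
    unfolding lborel_vec_eq integrable_distr_eq[OF m1 m2] using I by simp
  have "(\<integral>x. (\<Prod>i\<in>UNIV. f i (x i)) \<partial>(\<Pi>\<^sub>M i\<in>UNIV. lborel)) = (\<Prod>i\<in>UNIV. (\<integral>t. f i t \<partial>lborel))"
    by (rule P.product_integral_prod) (auto intro: f)
  then show "(\<integral>x. (\<Prod>i\<in>UNIV. f i ((x::real^'d) $ i)) \<partial>lborel) = (\<Prod>i\<in>UNIV. (\<integral>t. f i t \<partial>lborel))"
    unfolding lborel_vec_eq integral_distr[OF m1 m2] by simp
qed

text \<open>The change of variables formula for one matrix. The class of matrices that satisfy it is closed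
  under products, which reduces the formula to elementary matrices.\<close>
definition scales_lborel :: "real^'d^'d \<Rightarrow> bool" where
  "scales_lborel A \<longleftrightarrow> (\<forall>f\<in>borel_measurable borel. (\<integral>\<^sup>+x. f x \<partial>lborel) = ennreal \<bar>det A\<bar> * (\<integral>\<^sup>+x. f (A *v x) \<partial>lborel))"

lemma measurable_matrix_vector_mult [measurable]: "(\<lambda>x. A *v x) \<in> borel_measurable (borel :: (real^'d) measure)"
  for A :: "real^'d^'e"
  by (intro borel_measurable_continuous_onI linear_continuous_on linear_linear matrix_vector_mul_bounded_linear)

text \<open>Integrating first over the coordinate that is changed, the shear is a translation.\<close>
lemma shear_scales_lborel:
  fixes m n :: "'d::finite"
  assumes "m \<noteq> n"
  shows "scales_lborel (\<chi> i j. if i = m \<and> j = n then c else of_bool (i = j))" (is "scales_lborel ?A")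
proof -
  have det: "det ?A = 1"
  proof -
    have "?A = (\<chi> k. if k = m then row m (mat 1) + c *s row n (mat 1) else row k (mat 1))"
      using assms by (auto simp: vec_eq_iff row_def mat_def)
    also have "det \<dots> = 1"
      using assms by (subst det_row_operation) auto
    finally show ?thesis .
  qed
  have Av: "?A *v x = (\<chi> i. if i = m then x $ m + c * x $ n else x $ i)" for x
  proof -
    have "(\<Sum>j\<in>UNIV. (if i = m \<and> j = n then c else of_bool (i = j)) * x $ j)
      = (if i = m then x $ m + c * x $ n else x $ i)" for i
    proof -
      have "(\<Sum>j\<in>UNIV. (if i = m \<and> j = n then c else of_bool (i = j)) * x $ j)
       = (\<Sum>j\<in>UNIV. (if j = n then (if i = m then c * x $ n else 0) else 0) + (if j = i then x $ i else 0))"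
        using assms by (intro sum.cong) auto
      then show ?thesis by (simp add: sum.distrib)
    qed
    then show ?thesis
      by (simp add: vec_eq_iff matrix_vector_mult_def)
  qed
  define A where "A = ?A"
  have Av': "A *v x = (\<chi> i. if i = m then x $ m + c * x $ n else x $ i)" for x
    unfolding A_def by (rule Av)
  have I: "(\<integral>\<^sup>+x. f x \<partial>lborel) = (\<integral>\<^sup>+x. f (A *v x) \<partial>lborel)"
    if f [measurable]: "f \<in> borel_measurable borel" for f :: "real^'d \<Rightarrow> ennreal"
  proof -
    interpret P: product_sigma_finite "\<lambda>_::'d. lborel :: real measure"
      by standard 
    have meas [measurable]: "(\<lambda>f. \<chi> i. f i) \<in> (\<Pi>\<^sub>M i\<in>(UNIV::'d set). (lborel::real measure)) \<rightarrow>\<^sub>M (borel :: (real^'d) measure)"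
      by (intro borel_measurable_vec_lambda) measurable
    \<comment> \<open>Fubini, with the coordinate \<open>m\<close> integrated first.\<close>
    have 1: "(\<integral>\<^sup>+x. g x \<partial>lborel) = (\<integral>\<^sup>+y. (\<integral>\<^sup>+t. g (\<chi> i. (y(m := t)) i) \<partial>lborel) \<partial>(\<Pi>\<^sub>M i\<in>UNIV - {m}. lborel))"
      if [measurable]: "g \<in> borel_measurable borel" for g :: "real^'d \<Rightarrow> ennreal"
    proof -
      have "(\<integral>\<^sup>+x. g x \<partial>lborel) = (\<integral>\<^sup>+y. g (\<chi> i. y i) \<partial>(\<Pi>\<^sub>M i\<in>insert m (UNIV - {m}). lborel))"
        unfolding lborel_vec_eq by (subst nn_integral_distr) (auto simp: insert_absorb)
      also have "\<dots> = (\<integral>\<^sup>+y. (\<integral>\<^sup>+t. g (\<chi> i. (y(m := t)) i) \<partial>lborel) \<partial>(\<Pi>\<^sub>M i\<in>UNIV - {m}. lborel))"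
        by (subst P.product_nn_integral_insert) (auto simp: insert_absorb)
      finally show ?thesis .
    qed
    show ?thesis
      apply (subst (1 2) 1)
        apply measurable
      apply (rule nn_integral_cong)
      subgoal for y
      proof -
        have meas: "(\<lambda>t. f (\<chi> i. (y(m := t)) i)) \<in> borel_measurable borel"
        proof (intro measurable_compose[OF _ f] borel_measurable_vec_lambda)
          show "(\<lambda>t. (y(m := t)) i) \<in> borel_measurable borel" for i
            by (cases "i = m") auto
        qed
        have "(\<integral>\<^sup>+t. f (\<chi> i. (y(m := t)) i) \<partial>lborel) = (\<integral>\<^sup>+t. f (\<chi> i. (y(m := c * y n + t)) i) \<partial>lborel)"
          using nn_integral_real_affine[OF meas, of 1 "c * y n"] by simp
        also have "\<dots> = (\<integral>\<^sup>+t. f (A *v (\<chi> i. (y(m := t)) i)) \<partial>lborel)"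
          using assms by (intro nn_integral_cong arg_cong[where f=f]) (simp only: Av', simp add: vec_eq_iff)
        finally show ?thesis .
      qed
      done
  qed
  have "\<bar>det A\<bar> = 1" using det by (simp only: A_def abs_one)
  then have "scales_lborel A" unfolding scales_lborel_def by (metis I ennreal_1 mult_1)
  then show ?thesis by (simp only: A_def)
qed

lemma diagonal_scales_lborel:
  fixes A :: "real^'d^'d"
  assumes diag: "\<And>i j. i \<noteq> j \<Longrightarrow> A$i$j = 0" and "det A \<noteq> 0"
  shows "scales_lborel A"
proof -
  have det: "det A = (\<Prod>i\<in>UNIV. A$i$i)"
    by (rule det_diagonal) (use diag in auto)
  then have nz: "A$i$i \<noteq> 0" for i
    using assms(2) by auto
  define c where "c b = (\<Sum>i\<in>UNIV. A$i$i * (b $ i))" for b :: "real^'d"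
  have c_axis: "c (axis i 1) = A$i$i" for i
    by (simp add: c_def axis_def if_distrib cong: if_cong)
  have Bas: "b \<in> Basis \<Longrightarrow> \<exists>i. b = axis i 1" for b :: "real^'d"
    by (auto simp: Basis_vec_def)
  have c0: "b \<in> Basis \<Longrightarrow> c b \<noteq> 0" for b :: "real^'d"
    using Bas[of b] nz by (auto simp: c_axis)
  have prodc: "(\<Prod>b\<in>Basis. \<bar>c b\<bar>) = \<bar>det A\<bar>"
    unfolding det abs_prod by (simp add: prod_Basis_vec c_axis)
  have Ax: "A *v x = (\<Sum>b\<in>Basis. (c b * (x \<bullet> b)) *\<^sub>R b)" for x
  proof (rule euclidean_eqI)
    fix b :: "real^'d" assume b: "b \<in> Basis"
    then obtain i where i: "b = axis i 1" using Bas by auto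
    have e: "A $ i $ j * x $ j = (if j = i then A$i$i * x$i else 0)" for j
      using diag[of i j] by auto
    have "(A *v x) \<bullet> b = (\<Sum>j\<in>UNIV. A $ i $ j * x $ j)"
      by (simp add: i inner_axis matrix_vector_mult_def del: sum.delta)
    also have "\<dots> = A$i$i * x$i"
      by (subst e) simp
    also have "\<dots> = c b * (x \<bullet> b)"
      unfolding i c_axis inner_axis by simp
    also have "\<dots> = (\<Sum>b\<in>Basis. (c b * (x \<bullet> b)) *\<^sub>R b) \<bullet> b"
      using b by (rule inner_sum_left_Basis[symmetric])
    finally show "(A *v x) \<bullet> b = (\<Sum>b\<in>Basis. (c b * (x \<bullet> b)) *\<^sub>R b) \<bullet> b" .
  qed
  have L: "lborel = density (distr lborel borel ((*v) A)) (\<lambda>_. ennreal \<bar>det A\<bar>)"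
    using lborel_affine_euclidean[of c 0] c0 by (simp add: Ax[abs_def] prodc)
  show ?thesis unfolding scales_lborel_def
  proof
    fix f :: "real^'d \<Rightarrow> ennreal" assume [measurable]: "f \<in> borel_measurable borel"
    show "(\<integral>\<^sup>+x. f x \<partial>lborel) = ennreal \<bar>det A\<bar> * (\<integral>\<^sup>+x. f (A *v x) \<partial>lborel)"
      using arg_cong[OF L, of "\<lambda>M. integral\<^sup>N M f"]
      by (simp add: nn_integral_density nn_integral_distr nn_integral_cmult)
  qed
qed

lemma swap_scales_lborel:
  fixes m n :: "'d::finite"
  assumes "m \<noteq> n"
  shows "scales_lborel (\<chi> i j. mat 1 $ i $ Transposition.transpose m n j)" (is "scales_lborel ?A")
proof -
  let ?t = "Transposition.transpose m n"
  have Av: "?A *v x = (\<chi> i. x $ ?t i)" for x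
  proof -
    have "(\<Sum>j\<in>UNIV. mat 1 $ i $ ?t j * x $ j) = x $ ?t i" for i
    proof -
      have "(\<Sum>j\<in>UNIV. mat 1 $ i $ ?t j * x $ j) = (\<Sum>j\<in>UNIV. if j = ?t i then x $ ?t i else 0)"
        by (intro sum.cong) (auto simp: mat_def)
      then show ?thesis by simp
    qed
    then show ?thesis by (simp add: matrix_vector_mult_def)
  qed
  have det: "\<bar>det ?A\<bar> = 1"
  proof -
    have p: "?t permutes UNIV" by (simp add: permutes_swap_id)
    have "det ?A = of_int (sign ?t) * det (mat 1 :: real^'d^'d)"
      by (rule det_permute_columns[OF p])
    then show ?thesis by (simp add: sign_swap_id assms)
  qed
  have L: "lborel = distr lborel borel ((*v) ?A)"
  proof (rule lborel_eqI)
    fix l u :: "real^'d"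
    assume le: "\<And>b. b \<in> Basis \<Longrightarrow> l \<bullet> b \<le> u \<bullet> b"
    have le': "l $ i \<le> u $ i" for i
      using le[of "axis i 1"] by (auto simp: inner_axis axis_in_Basis_iff)
    have B: "(\<Prod>b\<in>Basis. (u - l) \<bullet> b) = (\<Prod>i\<in>UNIV. u$i - l$i)" for u l :: "real^'d"
      by (simp add: prod_Basis_vec inner_axis)
    have inv: "((*v) ?A) -` box l u = box (\<chi> i. l $ ?t i) (\<chi> i. u $ ?t i)"
    proof (rule set_eqI)
      fix x
      have "(\<forall>i. l$i < x $ ?t i \<and> x $ ?t i < u$i) \<longleftrightarrow> (\<forall>i. l $ ?t i < x $ i \<and> x $ i < u $ ?t i)"
        by (metis transpose_involutory)
      then show "x \<in> ((*v) ?A) -` box l u \<longleftrightarrow> x \<in> box (\<chi> i. l $ ?t i) (\<chi> i. u $ ?t i)"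
        by (simp add: Av mem_box_cart)
    qed
    have le'': "\<And>b. b \<in> Basis \<Longrightarrow> (\<chi> i. l $ ?t i) \<bullet> b \<le> (\<chi> i. u $ ?t i) \<bullet> b"
      using le' by (auto simp: Basis_vec_def inner_axis)
    have "emeasure (distr lborel borel ((*v) ?A)) (box l u) = emeasure lborel (box (\<chi> i. l $ ?t i) (\<chi> i. u $ ?t i))"
      by (subst emeasure_distr) (simp_all only: inv space_lborel space_borel Int_UNIV_right sets_lborel borel_open[OF open_box] measurable_lborel2 measurable_matrix_vector_mult)
    also have "\<dots> = ennreal (\<Prod>b\<in>Basis. ((\<chi> i. u $ ?t i) - (\<chi> i. l $ ?t i)) \<bullet> b)"
      by (rule emeasure_lborel_box) (rule le'')
    also have "\<dots> = ennreal (\<Prod>i\<in>UNIV. u $ ?t i - l $ ?t i)"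
      by (simp only: B vec_lambda_beta)
    also have "(\<Prod>i\<in>UNIV. u $ ?t i - l $ ?t i) = (\<Prod>i\<in>UNIV. u $ i - l $ i)"
      by (rule prod.reindex_bij_betw[where g="\<lambda>i. u $ i - l $ i"]) simp
    finally show "emeasure (distr lborel borel ((*v) ?A)) (box l u) = ennreal (\<Prod>b\<in>Basis. (u - l) \<bullet> b)"
      by (simp add: B)
  qed simp
  show ?thesis unfolding scales_lborel_def det
  proof
    fix f :: "real^'d \<Rightarrow> ennreal" assume [measurable]: "f \<in> borel_measurable borel"
    show "(\<integral>\<^sup>+x. f x \<partial>lborel) = ennreal 1 * (\<integral>\<^sup>+x. f (?A *v x) \<partial>lborel)"
      using arg_cong[OF L, of "\<lambda>M. integral\<^sup>N M f"]
      unfolding ennreal_1 mult_1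
      by (subst (asm) nn_integral_distr) (simp_all only: measurable_distr_eq1 measurable_lborel2 measurable_matrix_vector_mult \<open>f \<in> borel_measurable borel\<close>)
  qed
qed

text \<open>Every matrix is a product of diagonal matrices, coordinate swaps, shears and matrices with a zero
  row; the last are singular and excluded by the determinant.\<close>
lemma nn_integral_lborel_linear:
  fixes A :: "real^'d^'d"
  assumes "det A \<noteq> 0" and "f \<in> borel_measurable borel"
  shows "(\<integral>\<^sup>+x. f x \<partial>lborel) = ennreal \<bar>det A\<bar> * (\<integral>\<^sup>+x. f (A *v x) \<partial>lborel)"
proof -
  have "det A \<noteq> 0 \<longrightarrow> scales_lborel A"
  proof (rule induct_matrix_elementary)
    fix A B :: "real^'d^'d"
    assume A: "det A \<noteq> 0 \<longrightarrow> scales_lborel A" and B: "det B \<noteq> 0 \<longrightarrow> scales_lborel B"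
    show "det (A ** B) \<noteq> 0 \<longrightarrow> scales_lborel (A ** B)"
    proof
      assume "det (A ** B) \<noteq> 0"
      then have sA: "scales_lborel A" and sB: "scales_lborel B"
        using A B by (auto simp: det_mul)
      show "scales_lborel (A ** B)" unfolding scales_lborel_def
      proof
        fix f :: "real^'d \<Rightarrow> ennreal" assume f [measurable]: "f \<in> borel_measurable borel"
        have fA: "(\<lambda>x. f (A *v x)) \<in> borel_measurable borel"
          by measurable
        have "(\<integral>\<^sup>+x. f x \<partial>lborel) = ennreal \<bar>det A\<bar> * (\<integral>\<^sup>+x. f (A *v x) \<partial>lborel)"
          by (rule sA[unfolded scales_lborel_def, rule_format, OF f])
        also have "(\<integral>\<^sup>+x. f (A *v x) \<partial>lborel) = ennreal \<bar>det B\<bar> * (\<integral>\<^sup>+x. f (A *v (B *v x)) \<partial>lborel)"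
          by (rule sB[unfolded scales_lborel_def, rule_format, OF fA])
        finally show "(\<integral>\<^sup>+x. f x \<partial>lborel) = ennreal \<bar>det (A ** B)\<bar> * (\<integral>\<^sup>+x. f ((A ** B) *v x) \<partial>lborel)"
          by (simp add: det_mul abs_mult ennreal_mult mult.assoc matrix_vector_mul_assoc)
      qed
    qed
  next
    fix A :: "real^'d^'d" and i assume "row i A = 0"
    then show "det A \<noteq> 0 \<longrightarrow> scales_lborel A" using det_zero_row(1)[of i A] by auto
  next
    fix A :: "real^'d^'d" assume "\<And>i j. i \<noteq> j \<Longrightarrow> A$i$j = 0"
    then show "det A \<noteq> 0 \<longrightarrow> scales_lborel A" by (blast intro: diagonal_scales_lborel)
  next
    fix m n :: 'd assume mn: "m \<noteq> n"
    show "det (\<chi> i j. mat 1 $ i $ Transposition.transpose m n j) \<noteq> (0::real) \<longrightarrow>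
      scales_lborel (\<chi> i j. mat 1 $ i $ Transposition.transpose m n j)"
      by (rule impI) (rule swap_scales_lborel[OF mn])
  next
    fix m n :: 'd and c :: real assume mn: "m \<noteq> n"
    show "det (\<chi> i j. if i = m \<and> j = n then c else of_bool (i = j)) \<noteq> 0 \<longrightarrow>
      scales_lborel (\<chi> i j. if i = m \<and> j = n then c else of_bool (i = j))"
      by (rule impI) (rule shear_scales_lborel[OF mn])
  qed
  then have "scales_lborel A" using assms(1) by (rule mp)
  then show ?thesis using assms(2) unfolding scales_lborel_def by (rule bspec)
qed

section \<open>The matrix exponential and its determinant\<close>

text \<open>The powers inside \<open>matrix_exp\<close>; the class power on vectors is componentwise.\<close>
definition matrix_pow :: "real^'d^'d \<Rightarrow> nat \<Rightarrow> real^'d^'d" where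
  "matrix_pow A n = ((**) A ^^ n) (mat 1)"

lemma matrix_pow_0: "matrix_pow A 0 = mat 1"
  and matrix_pow_Suc: "matrix_pow A (Suc n) = A ** matrix_pow A n"
  by (simp_all add: matrix_pow_def)

lemma matrix_pow_Suc2: "matrix_pow A (Suc n) = matrix_pow A n ** A"
proof (induction n)
  case (Suc n)
  then show ?case by (metis matrix_pow_Suc matrix_mul_assoc)
qed (simp add: matrix_pow_def)

lemma matrix_pow_scaleR: "matrix_pow (t *\<^sub>R A) n = t ^ n *\<^sub>R matrix_pow A n"
proof (induction n)
  case (Suc n)
  have "(t *\<^sub>R A) ** (c *\<^sub>R B) = (t * c) *\<^sub>R (A ** B)" for c and B :: "real^'a^'a"
    by (simp add: matrix_matrix_mult_def vec_eq_iff sum_distrib_left algebra_simps)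
  then show ?case using Suc by (simp add: matrix_pow_Suc)
qed (simp add: matrix_pow_0)

text \<open>The sum of the absolute values of the entries is a submultiplicative norm; by the bound every entry of the exponential is an everywhere convergent real power series.\<close>
lemma matrix_pow_bound:
  fixes A :: "real^'d^'d"
  shows "\<bar>matrix_pow A n $ i $ j\<bar> \<le> (\<Sum>i\<in>UNIV. \<Sum>j\<in>UNIV. \<bar>A $ i $ j\<bar>) ^ n"
proof (induction n arbitrary: i j)
  case 0
  then show ?case by (auto simp: matrix_pow_0 mat_def)
next
  case (Suc n)
  let ?K = "\<Sum>i\<in>UNIV. \<Sum>j\<in>UNIV. \<bar>A $ i $ j\<bar>"
  have K0: "0 \<le> ?K" by (intro sum_nonneg) auto
  have "\<bar>matrix_pow A (Suc n) $ i $ j\<bar> = \<bar>\<Sum>k\<in>UNIV. A $ i $ k * matrix_pow A n $ k $ j\<bar>"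
    by (simp add: matrix_pow_Suc matrix_matrix_mult_def)
  also have "\<dots> \<le> (\<Sum>k\<in>UNIV. \<bar>A $ i $ k\<bar> * ?K ^ n)"
    by (intro order_trans[OF sum_abs] sum_mono) (auto simp: abs_mult intro!: mult_mono Suc.IH)
  also have "\<dots> = (\<Sum>k\<in>UNIV. \<bar>A $ i $ k\<bar>) * ?K ^ n"
    by (simp add: sum_distrib_right)
  also have "\<dots> \<le> ?K * ?K ^ n"
    by (intro mult_right_mono member_le_sum[where f="\<lambda>i. \<Sum>j\<in>UNIV. \<bar>A $ i $ j\<bar>"] sum_nonneg zero_le_power K0) auto
  finally show ?case by simp
qed

lemma summable_matrix_pow: "summable (\<lambda>n. matrix_pow A n $ i $ j / fact n * x ^ n)"
proof (rule summable_comparison_test')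
  let ?K = "\<Sum>i\<in>UNIV. \<Sum>j\<in>UNIV. \<bar>A $ i $ j\<bar>"
  show "summable (\<lambda>n. (?K * \<bar>x\<bar>) ^ n /\<^sub>R fact n)"
    by (rule summable_exp_generic)
  show "norm (matrix_pow A n $ i $ j / fact n * x ^ n) \<le> (?K * \<bar>x\<bar>) ^ n /\<^sub>R fact n" if "n \<ge> 0" for n
    using mult_right_mono[OF matrix_pow_bound[of A n i j], of "\<bar>x\<bar>^n / fact n"]
    by (simp add: abs_mult power_abs power_mult_distrib field_simps)
qed

lemma matrix_exp_entry:
  "matrix_exp (t *\<^sub>R A) $ i $ j = (\<Sum>n. matrix_pow A n $ i $ j / fact n * t ^ n)"
proof -
  have "(\<lambda>n. (1 / fact n) *\<^sub>R matrix_pow (t *\<^sub>R A) n) sums (\<chi> i j. (\<Sum>n. matrix_pow A n $ i $ j / fact n * t ^ n))"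
    unfolding sums_def
  proof (intro vec_tendstoI)
    fix i j
    have "(\<lambda>N. \<Sum>n<N. matrix_pow A n $ i $ j / fact n * t ^ n) \<longlonglongrightarrow> (\<Sum>n. matrix_pow A n $ i $ j / fact n * t ^ n)"
      using summable_matrix_pow summable_LIMSEQ by blast
    then show "(\<lambda>N. (\<Sum>n<N. (1 / fact n) *\<^sub>R matrix_pow (t *\<^sub>R A) n) $ i $ j) \<longlonglongrightarrow>
      (\<chi> i j. (\<Sum>n. matrix_pow A n $ i $ j / fact n * t ^ n)) $ i $ j"
      by (simp add: matrix_pow_scaleR field_simps)
  qed
  then have "matrix_exp (t *\<^sub>R A) = (\<chi> i j. (\<Sum>n. matrix_pow A n $ i $ j / fact n * t ^ n))"
    unfolding matrix_exp_def matrix_pow_def by (rule sums_unique[symmetric])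
  then show ?thesis by simp
qed

lemma matrix_exp_deriv_aux:
  "((\<lambda>t. matrix_exp (t *\<^sub>R A) $ i $ j) has_real_derivative (\<Sum>n. matrix_pow A (Suc n) $ i $ j / fact n * t ^ n)) (at t)"
proof -
  have "diffs (\<lambda>n. matrix_pow A n $ i $ j / fact n) = (\<lambda>n. matrix_pow A (Suc n) $ i $ j / fact n)"
    by (auto simp: diffs_def fun_eq_iff field_simps simp del: of_nat_Suc)
  then show ?thesis
    unfolding matrix_exp_entry
    using termdiffs_strong_converges_everywhere[of "\<lambda>n. matrix_pow A n $ i $ j / fact n" t, OF summable_matrix_pow]
    by simp
qed

text \<open>The powers of \<open>A\<close> commute with \<open>A\<close>, so the derivative can be written with \<open>A\<close> on either side. Both
  forms enter the proof of the group law.\<close>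
lemma matrix_exp_deriv:
  fixes A :: "real^'d^'d"
  shows "((\<lambda>t. matrix_exp (t *\<^sub>R A) $ i $ j) has_real_derivative (A ** matrix_exp (t *\<^sub>R A)) $ i $ j) (at t)" (is ?A)
    and "((\<lambda>t. matrix_exp (t *\<^sub>R A) $ i $ j) has_real_derivative (matrix_exp (t *\<^sub>R A) ** A) $ i $ j) (at t)" (is ?B)
proof -
  have "(\<Sum>n. matrix_pow A (Suc n) $ i $ j / fact n * t ^ n) = (\<Sum>k\<in>UNIV. \<Sum>n. A$i$k * (matrix_pow A n $ k $ j / fact n * t ^ n))"
    by (subst suminf_sum[symmetric], rule summable_mult[OF summable_matrix_pow])
       (auto intro!: suminf_cong simp: matrix_pow_Suc matrix_matrix_mult_def sum_distrib_right sum_divide_distrib sum_distrib_left mult_ac)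
  also have "\<dots> = (A ** matrix_exp (t *\<^sub>R A)) $ i $ j"
    by (simp only: suminf_mult[OF summable_matrix_pow] matrix_exp_entry matrix_matrix_mult_def vec_lambda_beta)
  finally show ?A using matrix_exp_deriv_aux[of A i j t] by simp
  have "(\<Sum>n. matrix_pow A (Suc n) $ i $ j / fact n * t ^ n) = (\<Sum>k\<in>UNIV. \<Sum>n. (matrix_pow A n $ i $ k / fact n * t ^ n) * A$k$j)"
    by (subst suminf_sum[symmetric], rule summable_mult2[OF summable_matrix_pow])
       (auto intro!: suminf_cong simp: matrix_pow_Suc2 matrix_matrix_mult_def sum_distrib_right sum_divide_distrib sum_distrib_left mult_ac)
  also have "\<dots> = (matrix_exp (t *\<^sub>R A) ** A) $ i $ j"
    by (simp only: suminf_mult2[OF summable_matrix_pow, symmetric] matrix_exp_entry matrix_matrix_mult_def vec_lambda_beta)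
  finally show ?B using matrix_exp_deriv_aux[of A i j t] by simp
qed

lemma matrix_exp_0: "matrix_exp (0 *\<^sub>R A) = mat 1"
  by (simp only: vec_eq_iff matrix_exp_entry powser_zero) (simp add: matrix_pow_0)

text \<open>With \<open>X t = matrix_exp (t *\<^sub>R A)\<close>, the matrix \<open>X (u + t) ** X (- u)\<close> has derivative zero in \<open>u\<close>
  and is therefore equal to \<open>X t\<close>. The case \<open>t = 0\<close> identifies \<open>X (- u)\<close> as the inverse of \<open>X u\<close>.\<close>
lemma matrix_exp_add:
  fixes A :: "real^'d^'d"
  shows "matrix_exp ((s + t) *\<^sub>R A) = matrix_exp (s *\<^sub>R A) ** matrix_exp (t *\<^sub>R A)"
proof -
  define X where "X t = matrix_exp (t *\<^sub>R A)" for t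
  have X0: "X 0 = mat 1" using matrix_exp_0[of A] by (simp add: X_def)
  have const: "X (u + t) ** X (- u) = X t" for u t
  proof -
    have "(X (u + t) ** X (- u)) $ i $ j = X t $ i $ j" for i j
    proof -
      have "((\<lambda>u. (X (u + t) ** X (- u)) $ i $ j) has_real_derivative 0) (at u)" for u
      proof -
        have d1: "((\<lambda>u. X (u + t) $ i $ k) has_real_derivative (X (u + t) ** A) $ i $ k) (at u)" for k
          using DERIV_shift[of "\<lambda>t. X t $ i $ k" "(X (u + t) ** A) $ i $ k" u t] matrix_exp_deriv(2)[of A i k "u + t"]
          by (simp add: X_def)
        have d2: "((\<lambda>u. X (- u) $ k $ j) has_real_derivative - (A ** X (-u)) $ k $ j) (at u)" for k
          using DERIV_mirror[of "\<lambda>t. X t $ k $ j" "(A ** X (-u)) $ k $ j" u] matrix_exp_deriv(1)[of A k j "- u"]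
          by (simp add: X_def)
        have "((\<lambda>u. (X (u + t) ** X (- u)) $ i $ j) has_real_derivative
           (\<Sum>k\<in>UNIV. (X (u + t) ** A) $ i $ k * X (-u) $ k $ j + - (A ** X (-u)) $ k $ j * X (u + t) $ i $ k)) (at u)"
          unfolding matrix_matrix_mult_def[of "X _" "X _"] vec_lambda_beta
          by (intro DERIV_sum DERIV_mult d1 d2)
        also have "(\<Sum>k\<in>UNIV. (X (u + t) ** A) $ i $ k * X (-u) $ k $ j + - (A ** X (-u)) $ k $ j * X (u + t) $ i $ k)
          = ((X (u + t) ** A) ** X (-u)) $ i $ j - (X (u + t) ** (A ** X (-u))) $ i $ j"
          unfolding matrix_matrix_mult_def[of "X _ ** A" "X _"] matrix_matrix_mult_def[of "X _" "A ** _"]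
          by (simp add: sum_subtractf mult.commute)
        finally show ?thesis by (simp add: matrix_mul_assoc)
      qed
      then show ?thesis
        using DERIV_isconst_all[of "\<lambda>u. (X (u + t) ** X (- u)) $ i $ j" u 0] by (simp add: X0)
    qed
    then show ?thesis by (simp add: vec_eq_iff)
  qed
  have inv: "X (- t) ** X t = mat 1" for t
    using const[of "-t" 0] X0 by simp
  have "X (s + t) = X (t + s) ** (X (- t) ** X t)"
    by (simp add: inv add.commute)
  also have "\<dots> = X s ** X t"
    by (simp add: matrix_mul_assoc const)
  finally show ?thesis by (simp add: X_def)
qed

text \<open>In the Leibniz expansion at \<open>t = 0\<close> every permutation other than the identity moves at least two
  indices, so its product has two vanishing factors and derivative zero; the identity contributes the
  trace. The group law turns this into a differential equation for the determinant.\<close>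
lemma det_matrix_exp:
  fixes A :: "real^'d^'d"
  shows "det (matrix_exp (t *\<^sub>R A)) = exp (t * trace A)"
proof -
  define X where "X t = matrix_exp (t *\<^sub>R A)" for t
  have X0: "X 0 = mat 1" using matrix_exp_0[of A] by (simp add: X_def)
  have d0: "((\<lambda>t. det (X t)) has_real_derivative trace A) (at 0)"
  proof -
    have dX: "((\<lambda>t. X t $ i $ j) has_real_derivative A $ i $ j) (at 0)" for i j
      using matrix_exp_deriv(1)[of A i j 0] X0 by (simp add: X_def)
    have "((\<lambda>t. det (X t)) has_real_derivative
      (\<Sum>p | p permutes UNIV. of_int (sign p) * (\<Sum>i\<in>UNIV. A $ i $ p i * (\<Prod>j\<in>UNIV-{i}. X 0 $ j $ p j)))) (at 0)"
      unfolding det_def by (intro DERIV_sum DERIV_cmult has_field_derivative_prod dX)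
    also have "(\<Sum>p | p permutes UNIV. of_int (sign p) * (\<Sum>i\<in>UNIV. A $ i $ p i * (\<Prod>j\<in>UNIV-{i}. X 0 $ j $ p j)))
      = (\<Sum>p | p permutes (UNIV::'d set). if p = id then trace A else 0)"
    proof (rule sum.cong[OF refl])
      fix p :: "'d \<Rightarrow> 'd" assume "p \<in> {p. p permutes UNIV}"
      then have p: "p permutes UNIV" by simp
      show "of_int (sign p) * (\<Sum>i\<in>UNIV. A $ i $ p i * (\<Prod>j\<in>UNIV-{i}. X 0 $ j $ p j)) = (if p = id then trace A else 0)"
      proof (cases "p = id")
        case True
        then show ?thesis by (simp add: X0 mat_def trace_def sign_id)
      next
        case False
        then obtain a where a: "p a \<noteq> a" by (auto simp: fun_eq_iff)
        have "(\<Prod>j\<in>UNIV-{i}. X 0 $ j $ p j) = 0" for i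
        proof (cases "a = i")
          case True
          have "p (p a) \<noteq> p a" using a p by (metis permutes_inj injD)
          then have "p a \<in> UNIV - {i}" "X 0 $ p a $ p (p a) = 0"
            using True a by (auto simp: X0 mat_def)
          then show ?thesis by (meson finite_Diff finite prod_zero)
        next
          case False
          then have "a \<in> UNIV - {i}" "X 0 $ a $ p a = 0" using a by (auto simp: X0 mat_def)
          then show ?thesis by (meson finite_Diff finite prod_zero)
        qed
        then have "(\<Sum>i\<in>UNIV. A $ i $ p i * (\<Prod>j\<in>UNIV-{i}. X 0 $ j $ p j)) = 0"
          by (simp only: mult_zero_right sum.neutral_const)
        then show ?thesis using False by simp
      qed
    qed
    also have "\<dots> = trace A" by (simp add: permutes_id)
    finally show ?thesis .
  qed
  have mult: "det (X (s + t)) = det (X s) * det (X t)" for s t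
    by (simp add: X_def matrix_exp_add det_mul)
  have d: "((\<lambda>t. det (X t)) has_real_derivative det (X s) * trace A) (at s)" for s
  proof -
    have "((\<lambda>t. det (X s) * det (X (t - s))) has_real_derivative det (X s) * (trace A * 1)) (at s)"
      using d0 by (intro DERIV_cmult DERIV_chain2[where g="\<lambda>t. t - s"]) (auto intro!: derivative_eq_intros)
    moreover have "(\<lambda>t. det (X s) * det (X (t - s))) = (\<lambda>t. det (X t))"
      using mult[of s] by (metis add.commute diff_add_cancel)
    ultimately show ?thesis by simp
  qed
  have "((\<lambda>t. det (X t) * exp (- t * trace A)) has_real_derivative 0) (at s)" for s
    by (rule derivative_eq_intros d refl | simp)+
  then have "det (X t) * exp (- t * trace A) = det (X 0) * exp (- 0 * trace A)"
    using DERIV_isconst_all[of "\<lambda>t. det (X t) * exp (- t * trace A)" t 0] by blast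
  then have "det (X t) * exp (- t * trace A) = 1" by (simp add: X0)
  then show ?thesis by (simp add: X_def exp_minus field_simps)
qed

lemma matrix_rpow_1: "matrix_rpow 1 E = mat 1"
  using matrix_exp_0[of E] by (simp add: matrix_rpow_def)

lemma matrix_rpow_mult:
  "s > 0 \<Longrightarrow> t > 0 \<Longrightarrow> matrix_rpow (s * t) E = matrix_rpow s E ** matrix_rpow t E"
  by (simp add: matrix_rpow_def ln_mult matrix_exp_add)

lemma det_matrix_rpow: "t > 0 \<Longrightarrow> det (matrix_rpow t E) = t powr trace E"
  by (simp add: matrix_rpow_def det_matrix_exp powr_def mult.commute)

lemma continuous_on_matrix_rpow: "continuous_on {0<..} (\<lambda>t. matrix_rpow t E *v v)"
proof -
  have c: "continuous_on UNIV (\<lambda>t. matrix_exp (t *\<^sub>R E) $ i $ j)" for i j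
    by (rule DERIV_continuous_on) (rule matrix_exp_deriv)
  have "continuous_on {0<..} (\<lambda>t. matrix_exp (ln t *\<^sub>R E) $ i $ j)" for i j
    by (rule continuous_on_compose2[OF c]) (auto intro!: continuous_intros)
  then show ?thesis
    unfolding matrix_rpow_def matrix_vector_mult_def
    by (intro continuous_on_vec_lambda continuous_on_sum continuous_on_mult continuous_on_const)
qed

section \<open>Functions homogeneous under a group of dilations\<close>

text \<open>The situation of a positive-homogeneous polynomial, reduced to what the estimates use: \<open>D t\<close>
  stands for \<open>t\<^sup>E\<close>, \<open>R\<close> for the real part of the polynomial and \<open>\<mu>\<close> for the trace of \<open>E\<close>. Smoothness
  enters only as the quadratic bound \<open>R_quad\<close> near the origin; by homogeneity it forces \<open>R\<close> to grow at
  least quadratically at infinity (\<open>R_lower_quad\<close>).\<close>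
locale homogeneous_flow =
  fixes D :: "real \<Rightarrow> real^'d^'d" and R :: "real^'d \<Rightarrow> real" and \<mu> :: real
  assumes D_mult: "s > 0 \<Longrightarrow> t > 0 \<Longrightarrow> D (s * t) = D s ** D t"
    and D_one: "D 1 = mat 1"
    and D_cont: "continuous_on {0<..} (\<lambda>t. D t *v v)"
    and D_det: "t > 0 \<Longrightarrow> det (D t) = t powr \<mu>"
    and R_hom: "t > 0 \<Longrightarrow> R (D t *v \<xi>) = t * R \<xi>"
    and R_cont: "continuous_on UNIV R"
    and R_pos: "\<xi> \<noteq> 0 \<Longrightarrow> R \<xi> > 0"
    and R_quad: "\<exists>C. \<forall>\<xi>. norm \<xi> \<le> 1 \<longrightarrow> R \<xi> \<le> C * (norm \<xi>)\<^sup>2"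
begin

lemma D_D: "s > 0 \<Longrightarrow> t > 0 \<Longrightarrow> D s *v (D t *v v) = D (s * t) *v v"
  by (simp add: D_mult matrix_vector_mul_assoc)

lemma D_inv: "t > 0 \<Longrightarrow> D t *v (D (1 / t) *v v) = v" "t > 0 \<Longrightarrow> D (1 / t) *v (D t *v v) = v"
  by (simp_all add: D_D D_one)

lemma R_0: "R 0 = 0"
  using R_hom[of 2 0] by simp

lemma R_nonneg: "R \<xi> \<ge> 0"
  using R_pos[of \<xi>] R_0 by (cases "\<xi> = 0") (auto intro: less_imp_le)

lemma R_eq_0: "R \<xi> = 0 \<longleftrightarrow> \<xi> = 0"
  using R_pos[of \<xi>] R_0 by (cases "\<xi> = 0") auto

lemma R_min_compact:
  assumes "compact S" "0 \<notin> S"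
  shows "\<exists>b>0. \<forall>\<xi>\<in>S. b \<le> R \<xi>"
proof (cases "S = {}")
  case False
  then obtain z where "z \<in> S" "\<forall>\<xi>\<in>S. R z \<le> R \<xi>"
    using continuous_attains_inf[OF assms(1) False continuous_on_subset[OF R_cont]] by auto
  then show ?thesis using R_pos[of z] assms(2) by (metis)
qed (auto intro: exI[of _ 1])

text \<open>Any positive lower bound of \<open>R\<close> on the unit sphere would do.\<close>
definition sphere_bound :: real where "sphere_bound = (SOME b. b > 0 \<and> (\<forall>\<xi>\<in>sphere 0 1. b \<le> R \<xi>))"

lemma sphere_bound: "sphere_bound > 0" "norm \<xi> = 1 \<Longrightarrow> sphere_bound \<le> R \<xi>"
proof -
  have "\<exists>b>0. \<forall>\<xi>\<in>sphere 0 1. b \<le> R \<xi>" by (rule R_min_compact) auto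
  then have "sphere_bound > 0 \<and> (\<forall>\<xi>\<in>sphere 0 1. sphere_bound \<le> R \<xi>)"
    unfolding sphere_bound_def by (rule someI_ex)
  then show "sphere_bound > 0" "norm \<xi> = 1 \<Longrightarrow> sphere_bound \<le> R \<xi>" by auto
qed

text \<open>Along a contracting orbit \<open>R\<close> decreases. An orbit that starts with \<open>R\<close> below its values on the
  unit sphere can therefore never cross that sphere.\<close>
lemma small_stays_in_ball:
  "\<exists>\<rho>. 0 < \<rho> \<and> \<rho> < 1 \<and> (\<forall>v s. norm v \<le> \<rho> \<longrightarrow> 0 < s \<longrightarrow> s \<le> 1 \<longrightarrow> R v < sphere_bound \<and> norm (D s *v v) < 1)"
proof -
  have "isCont R 0" using R_cont by (simp add: continuous_on_eq_continuous_at)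
  then obtain d where d: "d > 0" "\<And>v. dist v 0 < d \<Longrightarrow> dist (R v) (R 0) < sphere_bound"
    using sphere_bound(1) unfolding continuous_at_eps_delta by (metis dist_norm norm_minus_cancel)
  define \<rho> where "\<rho> = min (d / 2) (1 / 2)"
  have \<rho>: "0 < \<rho>" "\<rho> < 1" "\<rho> < d" using d by (auto simp: \<rho>_def)
  have Rm: "R v < sphere_bound" if "norm v \<le> \<rho>" for v
    using d(2)[of v] that \<rho> R_0 R_nonneg[of v] by (simp add: dist_norm)
  have "norm (D s *v v) < 1" if v: "norm v \<le> \<rho>" and s: "0 < s" "s \<le> 1" for v s
  proof (rule ccontr)
    assume "\<not> norm (D s *v v) < 1"
    then have "\<exists>u\<ge>s. u \<le> 1 \<and> norm (D u *v v) = 1"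
      using v \<rho> s by (intro IVT2') (auto simp: D_one intro!: continuous_on_norm continuous_on_subset[OF D_cont])
    then obtain u where u: "u \<ge> s" "u \<le> 1" "norm (D u *v v) = 1" by auto
    then have "sphere_bound \<le> u * R v" using sphere_bound(2)[of "D u *v v"] R_hom[of u v] s by auto
    also have "\<dots> \<le> R v" using u R_nonneg[of v] by (simp add: mult_left_le_one_le s(1) order_trans[OF less_imp_le[OF s(1)]])
    finally show False using Rm[OF v] by simp
  qed
  then show ?thesis using \<rho> Rm by blast
qed

lemma norm_D_scale: "norm (D s *v (c *\<^sub>R v)) = \<bar>c\<bar> * norm (D s *v v)"
  by (simp add: matrix_vector_mult_scaleR)

lemma D_bounded: "\<exists>B>0. \<forall>s v. 0 < s \<longrightarrow> s \<le> 1 \<longrightarrow> norm (D s *v v) \<le> B * norm v"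
proof -
  obtain \<rho> where \<rho>: "0 < \<rho>" "\<rho> < 1" "\<And>v s. norm v \<le> \<rho> \<Longrightarrow> 0 < s \<Longrightarrow> s \<le> 1 \<Longrightarrow> norm (D s *v v) < 1"
    using small_stays_in_ball by blast
  have "norm (D s *v v) \<le> (1 / \<rho>) * norm v" if "0 < s" "s \<le> 1" for s v
  proof (cases "v = 0")
    case False
    have "norm (D s *v ((\<rho> / norm v) *\<^sub>R v)) < 1"
      by (rule \<rho>(3)) (use that \<rho> False in auto)
    then show ?thesis using False \<rho>(1) by (simp add: norm_D_scale field_simps)
  qed simp
  then show ?thesis using \<rho>(1) by (intro exI[of _ "1 / \<rho>"]) auto
qed

text \<open>An orbit confined to the unit ball on which \<open>R\<close> tends to zero must approach the origin, uniformly
  by compactness.\<close>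
lemma D_half: "\<exists>s0. 0 < s0 \<and> s0 < 1 \<and> (\<forall>v. norm (D s0 *v v) \<le> norm v / 2)"
proof -
  obtain \<rho> where \<rho>: "0 < \<rho>" "\<rho> < 1" "\<And>v s. norm v \<le> \<rho> \<Longrightarrow> 0 < s \<Longrightarrow> s \<le> 1 \<Longrightarrow> R v < sphere_bound \<and> norm (D s *v v) < 1"
    using small_stays_in_ball by blast
  have "compact (cball 0 1 - ball (0::real^'d) (\<rho> / 2))"
    by (intro compact_diff) auto
  then obtain b where b: "b > 0" "\<And>\<xi>. \<xi> \<in> cball 0 1 - ball 0 (\<rho> / 2) \<Longrightarrow> b \<le> R \<xi>"
    using R_min_compact[of "cball 0 1 - ball 0 (\<rho> / 2)"] \<rho>(1) by auto
  \<comment> \<open>Chosen so that \<open>R\<close> drops below its lower bound \<open>b\<close> on the shell between radius \<open>\<rho> / 2\<close> and \<open>1\<close>.\<close>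
  define s0 where "s0 = min (1 / 2) (b / (2 * sphere_bound))"
  have s0: "0 < s0" "s0 < 1" "s0 * sphere_bound < b"
    using b sphere_bound(1) by (auto simp: s0_def min_def field_simps)
  have "norm (D s0 *v v) \<le> norm v / 2" for v
  proof (cases "v = 0")
    case False
    define w where "w = (\<rho> / norm v) *\<^sub>R v"
    have nw: "norm w = \<rho>" using False \<rho> by (simp add: w_def)
    have w: "R w < sphere_bound" "norm (D s0 *v w) < 1"
      using \<rho>(3)[of w s0] nw s0 by auto
    have "R (D s0 *v w) < b"
    proof -
      have "R (D s0 *v w) = s0 * R w" using R_hom s0 by simp
      also have "\<dots> \<le> s0 * sphere_bound" using w s0 by simp
      finally show ?thesis using s0 by simp
    qed
    then have "norm (D s0 *v w) < \<rho> / 2"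
      using b(2)[of "D s0 *v w"] w by fastforce
    then show ?thesis using False \<rho>(1) by (simp add: w_def norm_D_scale field_simps)
  qed simp
  then show ?thesis using s0 by blast
qed

text \<open>Iterating \<open>D_half\<close> gives decay of \<open>D s\<close> like a power \<open>s powr (1 / N)\<close>; the inequality is stated
  without roots.\<close>
lemma D_decay: "\<exists>c N. c > 0 \<and> N \<ge> 1 \<and> (\<forall>s v. 0 < s \<longrightarrow> s \<le> 1 \<longrightarrow> norm (D s *v v) ^ N \<le> c * s * norm v ^ N)"
proof -
  obtain B where B: "B > 0" "\<And>s v. 0 < s \<Longrightarrow> s \<le> 1 \<Longrightarrow> norm (D s *v v) \<le> B * norm v"
    using D_bounded by blast
  obtain s0 where s0: "0 < s0" "s0 < 1" "\<And>v. norm (D s0 *v v) \<le> norm v / 2"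
    using D_half by blast
  obtain N0 where N0: "(1/2) ^ N0 < s0" using s0(1) real_arch_pow_inv[of s0 "1/2"] by auto
  define N where "N = Suc N0"
  have N: "(1/2) ^ N \<le> s0" using N0 s0 by (simp add: N_def)
  define c where "c = B ^ N / s0"
  have c: "c > 0" using B s0 by (simp add: c_def)
  have *: "norm (D s *v v) ^ N \<le> c * s * norm v ^ N" if "0 < s" "s \<le> 1" "s0 ^ Suc k \<le> s" for k s v
    using that
  proof (induction k arbitrary: s)
    case 0
    have "norm (D s *v v) ^ N \<le> (B * norm v) ^ N"
      using B(2) 0 by (intro power_mono) auto
    also have "\<dots> = c * s0 * norm v ^ N"
      using s0 by (simp add: c_def power_mult_distrib)
    also have "\<dots> \<le> c * s * norm v ^ N"
      using 0 c by (intro mult_right_mono mult_left_mono) auto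
    finally show ?case .
  next
    case (Suc k)
    show ?case
    proof (cases "s0 ^ Suc k \<le> s")
      case True
      then show ?thesis using Suc by blast
    next
      case False
      define s' where "s' = s / s0"
      have ss: "s = s0 * s'" using s0 by (simp add: s'_def)
      have s0k: "s0 ^ Suc k \<le> s0" using s0 by (simp add: power_le_one mult_left_le)
      have s': "0 < s'" "s' \<le> 1" "s0 ^ Suc k \<le> s'"
        using Suc.prems s0 False s0k by (auto simp: s'_def field_simps)
      have "norm (D s *v v) = norm (D s0 *v (D s' *v v))"
        using s0 s' by (simp add: D_D ss)
      then have "norm (D s *v v) ^ N \<le> (norm (D s' *v v) / 2) ^ N"
        using s0(3)[of "D s' *v v"] by (intro power_mono) auto
      also have "\<dots> = (1/2)^N * norm (D s' *v v) ^ N"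
        by (simp add: power_divide)
      also have "\<dots> \<le> s0 * (c * s' * norm v ^ N)"
        using Suc.IH[OF s'] N s0 by (intro mult_mono) auto
      finally show ?thesis by (simp add: ss mult_ac)
    qed
  qed
  have "norm (D s *v v) ^ N \<le> c * s * norm v ^ N" if s: "0 < s" "s \<le> 1" for s v
  proof -
    obtain k where "s0 ^ k < s" using real_arch_pow_inv[OF s(1) s0(2)] by blast
    moreover have "s0 ^ Suc k \<le> s0 ^ k" using s0 by (intro power_decreasing) auto
    ultimately have "s0 ^ Suc k \<le> s" by linarith
    then show ?thesis by (rule *[OF s])
  qed
  then show ?thesis using c by (intro exI[of _ c] exI[of _ N]) (auto simp: N_def)
qed

lemma unit_time:
  assumes "norm \<xi> > 1"
  shows "\<exists>s. 0 < s \<and> s < 1 \<and> norm (D s *v \<xi>) = 1"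
proof -
  obtain c N where cN: "c > 0" "N \<ge> 1" "\<And>s v. 0 < s \<Longrightarrow> s \<le> 1 \<Longrightarrow> norm (D s *v v) ^ N \<le> c * s * norm v ^ N"
    using D_decay by blast
  have p: "norm \<xi> ^ N > 0" using assms by (intro zero_less_power) linarith
  define s where "s = min 1 (1 / (2 * c * norm \<xi> ^ N))"
  have s: "0 < s" "s \<le> 1" "c * s * norm \<xi> ^ N < 1"
    using cN(1) p by (auto simp: s_def min_def field_simps)
  have "norm (D s *v \<xi>) ^ N < 1" using cN(3)[OF s(1,2), of \<xi>] s(3) by linarith
  then have "norm (D s *v \<xi>) < 1"
    using cN(2) by (meson linorder_not_less one_le_power)
  then have "\<exists>u\<ge>s. u \<le> 1 \<and> norm (D u *v \<xi>) = 1"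
    using assms s by (intro IVT') (auto simp: D_one intro!: continuous_on_norm continuous_on_subset[OF D_cont])
  then obtain u where u: "u \<ge> s" "u \<le> 1" "norm (D u *v \<xi>) = 1" by auto
  then have "u \<noteq> 1" using assms D_one by auto
  then show ?thesis using u s by (intro exI[of _ u]) auto
qed

lemma R_le_sphere_bound: "R \<xi> \<le> sphere_bound \<Longrightarrow> norm \<xi> \<le> 1"
proof (rule ccontr)
  assume R: "R \<xi> \<le> sphere_bound" and "\<not> norm \<xi> \<le> 1"
  then have "norm \<xi> > 1" by simp
  then obtain s where s: "0 < s" "s < 1" "norm (D s *v \<xi>) = 1" using unit_time by blast
  then have "sphere_bound \<le> s * R \<xi>" using sphere_bound(2)[of "D s *v \<xi>"] R_hom[of s] by simp
  also have "\<dots> \<le> s * sphere_bound" using R s by simp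
  also have "\<dots> < sphere_bound" using s sphere_bound(1) by simp
  finally show False by simp
qed

text \<open>A point outside the unit ball is carried to the unit sphere by some \<open>D s\<close> with \<open>s < 1\<close>, which
  lowers \<open>R\<close>; this settles one sublevel set, and the dilations carry it to all others.\<close>
lemma R_sublevel_bounded: "\<exists>B>0. \<forall>\<xi>. R \<xi> \<le> T \<longrightarrow> norm \<xi> \<le> B"
proof -
  define T' where "T' = max T 1"
  have T': "T' > 0" "T \<le> T'" by (auto simp: T'_def)
  obtain K where K: "K > 0" "\<And>v. norm (D (T' / sphere_bound) *v v) \<le> norm v * K"
    using bounded_linear.pos_bounded[OF matrix_vector_mul_bounded_linear[of "D (T' / sphere_bound)"]] by blast
  have "norm \<xi> \<le> K" if "R \<xi> \<le> T" for \<xi>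
  proof -
    define \<eta> where "\<eta> = D (sphere_bound / T') *v \<xi>"
    have "R \<eta> = sphere_bound / T' * R \<xi>" using R_hom T' sphere_bound(1) by (simp add: \<eta>_def)
    also have "\<dots> \<le> sphere_bound / T' * T'" using that T' sphere_bound(1) by (intro mult_left_mono) auto
    finally have "R \<eta> \<le> sphere_bound" using T' by simp
    then have n: "norm \<eta> \<le> 1" by (rule R_le_sphere_bound)
    have "\<xi> = D (T' / sphere_bound) *v \<eta>"
      unfolding \<eta>_def using D_inv(1)[of "T' / sphere_bound" \<xi>] T' sphere_bound(1) by simp
    then have "norm \<xi> \<le> norm \<eta> * K" using K by simp
    also have "\<dots> \<le> K" using n K by (simp add: mult_le_cancel_right1)
    finally show ?thesis .
  qed
  then show ?thesis using K by blast
qed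

lemma R_upper_quad: "\<exists>C>0. \<forall>\<xi>. norm \<xi> \<le> 1 \<longrightarrow> R \<xi> \<le> C * (norm \<xi>)\<^sup>2"
proof -
  obtain C where C: "\<And>\<xi>. norm \<xi> \<le> 1 \<Longrightarrow> R \<xi> \<le> C * (norm \<xi>)\<^sup>2" using R_quad by blast
  have "R \<xi> \<le> (\<bar>C\<bar> + 1) * (norm \<xi>)\<^sup>2" if "norm \<xi> \<le> 1" for \<xi>
    using C[OF that] by (rule order_trans) (intro mult_right_mono, auto)
  then show ?thesis by (intro exI[of _ "\<bar>C\<bar> + 1"]) auto
qed

text \<open>The quadratic upper bound near the origin prevents \<open>D s\<close> from contracting faster than
  \<open>s powr (1 / 2)\<close>. Applied to the orbit that brings a large \<open>\<xi>\<close> to the unit sphere, this bounds the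
  time \<open>s\<close> from above, and \<open>R \<xi>\<close> is at least a constant over \<open>s\<close>.\<close>
lemma R_lower_quad: "\<exists>c>0. \<forall>\<xi>. norm \<xi> \<ge> 1 \<longrightarrow> R \<xi> \<ge> c * (norm \<xi>)\<^sup>2"
proof -
  obtain C where C: "C > 0" "\<And>\<xi>. norm \<xi> \<le> 1 \<Longrightarrow> R \<xi> \<le> C * (norm \<xi>)\<^sup>2" using R_upper_quad by blast
  obtain \<rho> where \<rho>: "0 < \<rho>" "\<rho> < 1" "\<And>v s. norm v \<le> \<rho> \<Longrightarrow> 0 < s \<Longrightarrow> s \<le> 1 \<Longrightarrow> R v < sphere_bound \<and> norm (D s *v v) < 1"
    using small_stays_in_ball by blast
  obtain b where b: "b > 0" "\<And>\<xi>. \<xi> \<in> sphere 0 \<rho> \<Longrightarrow> b \<le> R \<xi>"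
    using R_min_compact[of "sphere 0 \<rho>"] \<rho>(1) by auto
  define c1 where "c1 = b / (C * \<rho>\<^sup>2)"
  have c1: "c1 > 0" using b C \<rho> by (simp add: c1_def)
  have low: "c1 * s * (norm v)\<^sup>2 \<le> (norm (D s *v v))\<^sup>2" if s: "0 < s" "s \<le> 1" for s v
  proof (cases "v = 0")
    case False
    define w where "w = (\<rho> / norm v) *\<^sub>R v"
    have nw: "norm w = \<rho>" using False \<rho> by (simp add: w_def)
    have "s * b \<le> s * R w" using b(2)[of w] nw s by simp
    also have "\<dots> = R (D s *v w)" using R_hom s by simp
    also have "\<dots> \<le> C * (norm (D s *v w))\<^sup>2"
      using \<rho>(3)[of w s] nw s by (intro C(2)) auto
    also have "norm (D s *v w) = \<rho> / norm v * norm (D s *v v)"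
      using \<rho> by (simp add: w_def norm_D_scale)
    finally show ?thesis using False \<rho> C by (simp add: c1_def field_simps power2_eq_square)
  qed simp
  define c where "c = min sphere_bound (sphere_bound * c1)"
  have c: "c > 0" using sphere_bound c1 by (simp add: c_def)
  have "R \<xi> \<ge> c * (norm \<xi>)\<^sup>2" if n: "norm \<xi> \<ge> 1" for \<xi>
  proof (cases "norm \<xi> = 1")
    case True
    then show ?thesis using sphere_bound(2)[OF True] by (simp add: c_def)
  next
    case False
    then have "norm \<xi> > 1" using n by simp
    then obtain s where s: "0 < s" "s < 1" "norm (D s *v \<xi>) = 1" using unit_time by blast
    have a: "c1 * s * (norm \<xi>)\<^sup>2 \<le> 1" using low[of s \<xi>] s by simp
    have "sphere_bound \<le> s * R \<xi>" using sphere_bound(2)[of "D s *v \<xi>"] R_hom[of s] s by simp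
    moreover have "s * (c * (norm \<xi>)\<^sup>2) \<le> sphere_bound"
    proof -
      have "s * (c * (norm \<xi>)\<^sup>2) \<le> s * ((sphere_bound * c1) * (norm \<xi>)\<^sup>2)"
        using s by (intro mult_left_mono mult_right_mono) (auto simp: c_def)
      also have "\<dots> = sphere_bound * (c1 * s * (norm \<xi>)\<^sup>2)" by simp
      also have "\<dots> \<le> sphere_bound" using a sphere_bound(1) by simp
      finally show ?thesis .
    qed
    ultimately have "s * (c * (norm \<xi>)\<^sup>2) \<le> s * R \<xi>" by linarith
    then show ?thesis using s by simp
  qed
  then show ?thesis using c by blast
qed

text \<open>Near the origin \<open>R\<close> dominates some power of the norm, so Taylor remainders of high order are
  negligible against it.\<close>
lemma power_norm_le_R: "\<exists>N C. N \<ge> 1 \<and> C > 0 \<and> (\<forall>\<xi>. R \<xi> \<le> 1 \<longrightarrow> norm \<xi> ^ N \<le> C * R \<xi>)"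
proof -
  obtain c N where cN: "c > 0" "N \<ge> 1" "\<And>s v. 0 < s \<Longrightarrow> s \<le> 1 \<Longrightarrow> norm (D s *v v) ^ N \<le> c * s * norm v ^ N"
    using D_decay by blast
  obtain B where B: "B > 0" "\<And>\<xi>. R \<xi> \<le> 1 \<Longrightarrow> norm \<xi> \<le> B" using R_sublevel_bounded by blast
  have "norm \<xi> ^ N \<le> (c * B ^ N) * R \<xi>" if "R \<xi> \<le> 1" for \<xi>
  proof (cases "\<xi> = 0")
    case True
    then show ?thesis using cN(2) by (simp add: R_0 zero_power)
  next
    case False
    define t where "t = R \<xi>"
    have t: "0 < t" "t \<le> 1" using R_pos[OF False] that by (auto simp: t_def)
    have 1: "R (D (1 / t) *v \<xi>) = 1" using R_hom[of "1/t" \<xi>] t by (simp add: t_def)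
    have "norm \<xi> ^ N = norm (D t *v (D (1 / t) *v \<xi>)) ^ N" using D_inv t by simp
    also have "\<dots> \<le> c * t * norm (D (1 / t) *v \<xi>) ^ N" using cN(3) t by blast
    also have "\<dots> \<le> c * t * B ^ N"
      using B(2)[of "D (1 / t) *v \<xi>"] 1 cN t by (intro mult_left_mono power_mono) auto
    finally show ?thesis by (simp add: t_def mult_ac)
  qed
  then show ?thesis using cN B(1) by (intro exI[of _ N] exI[of _ "c * B ^ N"]) auto
qed

text \<open>A compact cross-section of the dilations acting on pairs (\<open>compact_unit_level\<close>, \<open>reduce_to_level\<close>).\<close>
definition unit_level :: "((real^'d) \<times> (real^'d)) set" where
  "unit_level = {p. R (fst p) + R (snd p) = 1}"

lemma compact_unit_level: "compact unit_level"
proof -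
  obtain B where B: "B > 0" "\<And>\<xi>. R \<xi> \<le> 1 \<Longrightarrow> norm \<xi> \<le> B" using R_sublevel_bounded by blast
  have "unit_level \<subseteq> cball 0 B \<times> cball 0 B"
  proof
    fix p assume "p \<in> unit_level"
    then have "R (fst p) \<le> 1" "R (snd p) \<le> 1"
      using R_nonneg[of "fst p"] R_nonneg[of "snd p"] by (auto simp: unit_level_def)
    then show "p \<in> cball 0 B \<times> cball 0 B" using B(2) by (auto simp: mem_Times_iff)
  qed
  then have "bounded unit_level"
    using bounded_Times[OF bounded_cball bounded_cball] bounded_subset by blast
  moreover have "closed unit_level"
  proof -
    have "continuous_on UNIV (\<lambda>p::(real^'d) \<times> (real^'d). R (fst p) + R (snd p))"
      by (intro continuous_on_add continuous_on_compose2[OF R_cont] continuous_intros) auto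
    then have "closed ((\<lambda>p. R (fst p) + R (snd p)) -` {1})"
      by (intro closed_vimage) auto
    then show ?thesis by (simp add: unit_level_def vimage_def)
  qed
  ultimately show ?thesis by (simp add: compact_eq_bounded_closed)
qed

lemma reduce_to_unit_level:
  fixes f :: "real^'d \<Rightarrow> real^'d \<Rightarrow> real"
  assumes hom: "\<And>t \<xi> \<nu>. t > 0 \<Longrightarrow> f (D t *v \<xi>) (D t *v \<nu>) = t * f \<xi> \<nu>"
    and lev: "\<And>p. p \<in> unit_level \<Longrightarrow> f (fst p) (snd p) \<le> 0"
  shows "f \<xi> \<nu> \<le> 0"
proof (cases "R \<xi> + R \<nu> = 0")
  case True
  then have "R \<xi> = 0" "R \<nu> = 0" using R_nonneg[of \<xi>] R_nonneg[of \<nu>] by auto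
  then have "\<xi> = 0" "\<nu> = 0" by (auto simp: R_eq_0)
  then show ?thesis using hom[of 2 0 0] by simp
next
  case False
  define t where "t = R \<xi> + R \<nu>"
  have t: "t > 0" using False R_nonneg[of \<xi>] R_nonneg[of \<nu>] by (simp add: t_def)
  have "(D (1/t) *v \<xi>, D (1/t) *v \<nu>) \<in> unit_level"
    using t R_hom[of "1/t"] by (simp add: unit_level_def add_divide_distrib[symmetric]) (simp add: t_def)
  from lev[OF this] have "f (D (1/t) *v \<xi>) (D (1/t) *v \<nu>) \<le> 0" by simp
  then have "1 / t * f \<xi> \<nu> \<le> 0" using hom[of "1/t" \<xi> \<nu>] t by simp
  then show ?thesis using t by (simp add: divide_le_0_iff)
qed

lemma homogeneous_upper:
  fixes f :: "real^'d \<Rightarrow> real^'d \<Rightarrow> real"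
  assumes cont: "continuous_on UNIV (\<lambda>p. f (fst p) (snd p))"
    and hom: "\<And>t \<xi> \<nu>. t > 0 \<Longrightarrow> f (D t *v \<xi>) (D t *v \<nu>) = t * f \<xi> \<nu>"
  shows "\<exists>C>0. \<forall>\<xi> \<nu>. f \<xi> \<nu> \<le> C * (R \<xi> + R \<nu>)"
proof -
  have "bounded ((\<lambda>p. f (fst p) (snd p)) ` unit_level)"
    by (intro compact_imp_bounded compact_continuous_image compact_unit_level continuous_on_subset[OF cont]) auto
  then obtain C where C: "C > 0" "\<And>p. p \<in> unit_level \<Longrightarrow> \<bar>f (fst p) (snd p)\<bar> \<le> C"
    unfolding bounded_pos by auto
  have "f \<xi> \<nu> - C * (R \<xi> + R \<nu>) \<le> 0" for \<xi> \<nu>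
  proof (rule reduce_to_unit_level[where f = "\<lambda>\<xi> \<nu>. f \<xi> \<nu> - C * (R \<xi> + R \<nu>)"])
    show "f (fst p) (snd p) - C * (R (fst p) + R (snd p)) \<le> 0" if "p \<in> unit_level" for p
      using C(2)[OF that] that by (auto simp: unit_level_def)
  qed (simp add: hom R_hom algebra_simps)
  then show ?thesis using C(1) by (intro exI[of _ C]) (auto simp: algebra_simps)
qed

text \<open>On the part of the cross-section where \<open>f \<xi> \<nu> \<le> R \<xi> / 2\<close>, the value \<open>R \<nu>\<close> is bounded away from
  zero, as \<open>\<nu> = 0\<close> would give \<open>f \<xi> 0 = R \<xi> = 1\<close>. There a large multiple of \<open>R \<nu>\<close> compensates.\<close>
lemma homogeneous_lower:
  fixes f :: "real^'d \<Rightarrow> real^'d \<Rightarrow> real"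
  assumes cont: "continuous_on UNIV (\<lambda>p. f (fst p) (snd p))"
    and hom: "\<And>t \<xi> \<nu>. t > 0 \<Longrightarrow> f (D t *v \<xi>) (D t *v \<nu>) = t * f \<xi> \<nu>"
    and base: "\<And>\<xi>. f \<xi> 0 = R \<xi>"
  shows "\<exists>C>0. \<forall>\<xi> \<nu>. f \<xi> \<nu> \<ge> R \<xi> / 2 - C * R \<nu>"
proof -
  define h where "h p = f (fst p) (snd p) - R (fst p) / 2" for p
  have R1: "continuous_on UNIV (\<lambda>p::(real^'d) \<times> (real^'d). R (fst p))"
    and R2: "continuous_on UNIV (\<lambda>p::(real^'d) \<times> (real^'d). R (snd p))"
    by (intro continuous_on_compose2[OF R_cont] continuous_intros; simp)+
  have hc: "continuous_on UNIV h" unfolding h_def by (intro continuous_intros cont R1) auto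
  define Z where "Z = unit_level \<inter> h -` {..0}"
  have "closed (h -` {..0})" using hc by (intro closed_vimage) auto
  then have Zc: "compact Z" unfolding Z_def by (intro compact_Int_closed compact_unit_level)
  have "bounded (h ` unit_level)"
    by (intro compact_imp_bounded compact_continuous_image compact_unit_level continuous_on_subset[OF hc]) auto
  then obtain B where B: "B > 0" "\<And>p. p \<in> unit_level \<Longrightarrow> \<bar>h p\<bar> \<le> B"
    unfolding bounded_pos by auto
  have "\<exists>b>0. \<forall>p\<in>Z. b \<le> R (snd p)"
  proof (cases "Z = {}")
    case False
    then obtain z where z: "z \<in> Z" "\<forall>p\<in>Z. R (snd z) \<le> R (snd p)"
      using continuous_attains_inf[OF Zc False continuous_on_subset[OF R2]] by auto
    have "snd z \<noteq> 0"
    proof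
      assume 0: "snd z = 0"
      then have "R (fst z) = 1" "h z \<le> 0" using z(1) by (auto simp: Z_def unit_level_def R_0)
      then show False using base[of "fst z"] 0 by (simp add: h_def)
    qed
    then show ?thesis using z R_pos by metis
  qed (auto intro: exI[of _ 1])
  then obtain b where b: "b > 0" "\<And>p. p \<in> Z \<Longrightarrow> b \<le> R (snd p)" by blast
  define C where "C = B / b"
  have C: "C > 0" using B b by (simp add: C_def)
  have "R \<xi> / 2 - C * R \<nu> - f \<xi> \<nu> \<le> 0" for \<xi> \<nu>
  proof (rule reduce_to_unit_level[where f = "\<lambda>\<xi> \<nu>. R \<xi> / 2 - C * R \<nu> - f \<xi> \<nu>"])
    fix p assume p: "p \<in> unit_level"
    show "R (fst p) / 2 - C * R (snd p) - f (fst p) (snd p) \<le> 0"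
    proof (cases "h p \<le> 0")
      case True
      then have "p \<in> Z" using p by (simp add: Z_def)
      then have "B \<le> C * R (snd p)" using b B(1) by (simp add: C_def field_simps)
      then show ?thesis using B(2)[OF p] by (simp add: h_def)
    next
      case False
      then show ?thesis using mult_nonneg_nonneg[OF less_imp_le[OF C] R_nonneg[of "snd p"]] by (simp add: h_def)
    qed
  qed (simp add: hom R_hom algebra_simps)
  then show ?thesis using C by (intro exI[of _ C]) (auto simp: algebra_simps)
qed

text \<open>By the dilations only the level \<open>R \<zeta> = 1\<close> matters, where \<open>\<zeta>\<close> is bounded and the quadratic upper
  bound near the origin applies to \<open>s *\<^sub>R \<zeta>\<close>.\<close>
lemma R_small_multiple: "\<exists>K s1. K > 0 \<and> s1 > 0 \<and> (\<forall>s \<zeta>. \<bar>s\<bar> \<le> s1 \<longrightarrow> R (s *\<^sub>R \<zeta>) \<le> K * s\<^sup>2 * R \<zeta>)"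
proof -
  obtain C where C: "C > 0" "\<And>\<xi>. norm \<xi> \<le> 1 \<Longrightarrow> R \<xi> \<le> C * (norm \<xi>)\<^sup>2" using R_upper_quad by blast
  obtain B where B: "B > 0" "\<And>\<xi>. R \<xi> \<le> 1 \<Longrightarrow> norm \<xi> \<le> B" using R_sublevel_bounded by blast
  have "R (s *\<^sub>R \<zeta>) \<le> (C * B\<^sup>2) * s\<^sup>2 * R \<zeta>" if s: "\<bar>s\<bar> \<le> 1 / B" for s \<zeta>
  proof (cases "\<zeta> = 0")
    case False
    define t where "t = R \<zeta>"
    have t: "0 < t" using R_pos[OF False] by (auto simp: t_def)
    define \<eta> where "\<eta> = D (1 / t) *v \<zeta>"
    have 1: "R \<eta> = 1" using R_hom[of "1/t" \<zeta>] t by (simp add: t_def \<eta>_def)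
    then have nB: "norm \<eta> \<le> B" using B(2) by simp
    have "norm (s *\<^sub>R \<eta>) \<le> 1"
      using mult_mono[OF s nB] B(1) by simp
    then have "R (s *\<^sub>R \<eta>) \<le> C * (\<bar>s\<bar> * norm \<eta>)\<^sup>2" using C(2)[of "s *\<^sub>R \<eta>"] by simp
    also have "\<dots> \<le> C * (\<bar>s\<bar> * B)\<^sup>2"
      using nB C(1) by (intro mult_left_mono power_mono) auto
    finally have 2: "R (s *\<^sub>R \<eta>) \<le> (C * B\<^sup>2) * s\<^sup>2" by (simp add: power_mult_distrib mult_ac)
    have "s *\<^sub>R \<zeta> = D t *v (s *\<^sub>R \<eta>)"
      using D_inv(1)[OF t, of \<zeta>] by (simp add: matrix_vector_mult_scaleR \<eta>_def)
    then have "R (s *\<^sub>R \<zeta>) = t * R (s *\<^sub>R \<eta>)" using R_hom t by simp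
    also have "\<dots> \<le> t * ((C * B\<^sup>2) * s\<^sup>2)" using 2 t by simp
    finally show ?thesis by (simp add: t_def mult_ac)
  qed (simp add: R_0)
  then show ?thesis using C B(1) by (intro exI[of _ "C * B\<^sup>2"] exI[of _ "1 / B"]) auto
qed

text \<open>By the quadratic growth of \<open>R\<close> only a bounded set of \<open>\<zeta>\<close> can give \<open>w \<bullet> \<zeta> - R \<zeta> > 0\<close>. A
  \<open>\<zeta>\<close> that reaches half of the supremum serves as the direction of the tilt; the lost factor goes into
  the constant in the exponent.\<close>
lemma legendre_bounds:
  assumes "L > 0"
  shows "\<exists>B B'. B > 0 \<and> B' > 0 \<and> (\<forall>w. norm w \<le> L \<longrightarrow> 0 \<le> legendre R w \<and> legendre R w \<le> B \<and>
     (\<exists>\<zeta>. norm \<zeta> \<le> B' \<and> legendre R w / 2 \<le> w \<bullet> \<zeta> - R \<zeta>))"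
proof -
  obtain c where c: "c > 0" "\<And>\<xi>. norm \<xi> \<ge> 1 \<Longrightarrow> R \<xi> \<ge> c * (norm \<xi>)\<^sup>2" using R_lower_quad by blast
  define B' where "B' = max 1 (L / c)"
  have B': "B' > 0" "1 \<le> B'" "L / c \<le> B'" by (auto simp: B'_def)
  define B where "B = L * B'"
  have B: "B > 0" using assms B' by (simp add: B_def)
  have in_ball: "norm \<zeta> \<le> B'" if w: "norm w \<le> L" and pos: "w \<bullet> \<zeta> - R \<zeta> > 0" for w \<zeta>
  proof (rule ccontr)
    assume n: "\<not> norm \<zeta> \<le> B'"
    then have n1: "norm \<zeta> \<ge> 1" "norm \<zeta> > L / c" using B' by auto
    have "w \<bullet> \<zeta> \<le> norm w * norm \<zeta>" by (rule norm_cauchy_schwarz)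
    also have "\<dots> \<le> L * norm \<zeta>" using w by (intro mult_right_mono) auto
    also have "\<dots> \<le> (c * norm \<zeta>) * norm \<zeta>"
      using n1 c by (intro mult_right_mono) (auto simp: field_simps)
    also have "\<dots> \<le> R \<zeta>" using c(2)[OF n1(1)] by (simp add: power2_eq_square mult_ac)
    finally show False using pos by simp
  qed
  have up: "w \<bullet> \<zeta> - R \<zeta> \<le> B" if w: "norm w \<le> L" for w \<zeta>
  proof (cases "w \<bullet> \<zeta> - R \<zeta> > 0")
    case True
    have "w \<bullet> \<zeta> \<le> norm w * norm \<zeta>" by (rule norm_cauchy_schwarz)
    also have "\<dots> \<le> L * B'" using w in_ball[OF w True] assms by (intro mult_mono) auto
    finally show ?thesis using R_nonneg[of \<zeta>] by (simp add: B_def)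
  qed (use B in auto)
  have "0 \<le> legendre R w \<and> legendre R w \<le> B \<and> (\<exists>\<zeta>. norm \<zeta> \<le> B' \<and> legendre R w / 2 \<le> w \<bullet> \<zeta> - R \<zeta>)"
    if w: "norm w \<le> L" for w
  proof -
    have bdd: "bdd_above (range (\<lambda>\<zeta>. w \<bullet> \<zeta> - R \<zeta>))" using up[OF w] by (auto simp: bdd_above_def)
    have ge0: "0 \<le> legendre R w"
      unfolding legendre_def by (rule cSUP_upper2[OF bdd, of 0]) (auto simp: R_0)
    have leB: "legendre R w \<le> B"
      unfolding legendre_def by (rule cSUP_least) (auto intro: up[OF w])
    have "\<exists>\<zeta>. norm \<zeta> \<le> B' \<and> legendre R w / 2 \<le> w \<bullet> \<zeta> - R \<zeta>"
    proof (cases "legendre R w = 0")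
      case True
      then show ?thesis using B' by (intro exI[of _ 0]) (auto simp: R_0)
    next
      case False
      then have "legendre R w / 2 < legendre R w" using ge0 by simp
      then obtain \<zeta> where z: "legendre R w / 2 < w \<bullet> \<zeta> - R \<zeta>"
        unfolding legendre_def using less_cSUP_iff[OF UNIV_not_empty bdd] by auto
      then have "w \<bullet> \<zeta> - R \<zeta> > 0" using ge0 by linarith
      then show ?thesis using in_ball[OF w] z by (intro exI[of _ \<zeta>]) auto
    qed
    then show ?thesis using ge0 leB by blast
  qed
  then show ?thesis using B B' by blast
qed

lemma R_lower_linear: "\<exists>c>0. \<forall>\<xi>. R \<xi> \<ge> c * norm \<xi> - c"
proof -
  obtain c where c: "c > 0" "\<And>\<xi>. norm \<xi> \<ge> 1 \<Longrightarrow> R \<xi> \<ge> c * (norm \<xi>)\<^sup>2" using R_lower_quad by blast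
  have "R \<xi> \<ge> c * norm \<xi> - c" for \<xi>
  proof (cases "norm \<xi> \<ge> 1")
    case True
    have "c * norm \<xi> \<le> c * (norm \<xi>)\<^sup>2" using True c(1) self_le_power[of "norm \<xi>" 2] by simp
    then show ?thesis using c(2)[OF True] c(1) by linarith
  next
    case False
    then show ?thesis using R_nonneg[of \<xi>] c(1)
      by (smt (verit) mult_left_le)
  qed
  then show ?thesis using c(1) by blast
qed

text \<open>The substitution \<open>\<xi> = D t \<eta>\<close> has determinant \<open>t powr \<mu>\<close> and turns \<open>R \<xi>\<close> into \<open>t * R \<eta>\<close>.\<close>
lemma integral_exp_R:
  assumes "c > 0"
  shows "\<exists>C>0. \<forall>t>0. \<exists>I. ((\<lambda>\<xi>. exp (- (t * c * R \<xi>))) has_integral I) UNIV \<and> I \<le> C * t powr (- \<mu>)"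
proof -
  obtain b where b: "b > 0" "\<And>\<xi>. R \<xi> \<ge> b * norm \<xi> - b" using R_lower_linear by blast
  have Rm [measurable]: "R \<in> borel_measurable borel" using R_cont by (rule borel_measurable_continuous_onI)
  define d where "d = real CARD('d)"
  have d: "d > 0" by (simp add: d_def)
  \<comment> \<open>The norm is at least the mean of the absolute coordinates, whence the division by the dimension.\<close>
  define a where "a = c * b / d"
  have a: "a > 0" using assms b d by (simp add: a_def)
  have int1: "integrable lborel (\<lambda>t::real. exp (- (a * \<bar>t\<bar>)))"
  proof -
    define g where "g t = indicator {0..} t * exp (- a * t)" for t :: real
    have gm [measurable]: "g \<in> borel_measurable borel" unfolding g_def by measurable
    have "((\<lambda>x. if x \<in> {0..} then exp (- a * x) else 0) has_integral exp (- a * 0) / a) UNIV"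
      using has_integral_exp_minus_to_infinity[OF a, of 0] by (simp only: has_integral_restrict_UNIV)
    also have "(\<lambda>x. if x \<in> {0..} then exp (- a * x) else 0) = g"
      by (auto simp: g_def fun_eq_iff)
    finally have "integral\<^sup>N lborel g = ennreal (exp (- a * 0) / a)"
      by (intro nn_integral_has_integral_lborel) (auto simp: g_def)
    then have g1: "integrable lborel g"
      by (intro integrableI_nn_integral_finite[where x="exp (- a * 0) / a"]) (use a in \<open>auto simp: g_def\<close>)
    then have g2: "integrable lborel (\<lambda>t. g (- t))"
      using lborel_integrable_real_affine[of g "-1" 0] by simp
    show ?thesis
      by (rule Bochner_Integration.integrable_bound[OF Bochner_Integration.integrable_add[OF g1 g2]])
         (auto simp: g_def split: split_indicator)
  qed
  have dom: "exp (- (c * R \<xi>)) \<le> exp (c * b) * (\<Prod>i\<in>UNIV. exp (- (a * \<bar>\<xi> $ i\<bar>)))" for \<xi>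
  proof -
    have "(\<Sum>i\<in>UNIV. \<bar>\<xi> $ i\<bar>) \<le> (\<Sum>i\<in>(UNIV::'d set). norm \<xi>)"
      by (intro sum_mono component_le_norm_cart)
    then have "(\<Sum>i\<in>UNIV. \<bar>\<xi> $ i\<bar>) \<le> d * norm \<xi>" by (simp add: d_def)
    then have "a * (\<Sum>i\<in>UNIV. \<bar>\<xi> $ i\<bar>) \<le> c * (b * norm \<xi>)"
      using mult_left_mono[of _ "d * norm \<xi>" a] a d by (simp add: a_def)
    also have "\<dots> \<le> c * (R \<xi> + b)" using b(2)[of \<xi>] assms by (intro mult_left_mono) auto
    finally have "- (c * R \<xi>) \<le> c * b + (\<Sum>i\<in>UNIV. - (a * \<bar>\<xi> $ i\<bar>))"
      by (simp add: algebra_simps sum_distrib_left sum_negf)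
    then show ?thesis by (simp add: exp_add[symmetric] exp_sum[symmetric])
  qed
  have I1: "integrable lborel (\<lambda>\<xi>. exp (- (c * R \<xi>)))"
  proof (rule Bochner_Integration.integrable_bound)
    show "integrable lborel (\<lambda>\<xi>::real^'d. exp (c * b) * (\<Prod>i\<in>UNIV. exp (- (a * \<bar>\<xi> $ i\<bar>))))"
      by (intro integrable_mult_right integral_lborel_vec_prod(1) int1)
    show "AE \<xi> in lborel. norm (exp (- (c * R \<xi>))) \<le> norm (exp (c * b) * (\<Prod>i\<in>UNIV. exp (- (a * \<bar>\<xi> $ i\<bar>))))"
      using dom by (intro AE_I2) (auto intro: order_trans[OF _ abs_ge_self])
  qed measurable
  define C where "C = (\<integral>\<xi>. exp (- (c * R \<xi>)) \<partial>lborel)"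
  have C0: "C \<ge> 0" by (simp add: C_def)
  have nnC: "(\<integral>\<^sup>+\<xi>. ennreal (exp (- (c * R \<xi>))) \<partial>lborel) = ennreal C"
    unfolding C_def by (rule nn_integral_eq_integral[OF I1]) auto
  have "\<exists>I. ((\<lambda>\<xi>. exp (- (t * c * R \<xi>))) has_integral I) UNIV \<and> I \<le> (C + 1) * t powr (- \<mu>)" if t: "t > 0" for t
  proof -
    have det: "det (D t) = t powr \<mu>" "det (D t) \<noteq> 0" using D_det[OF t] t by auto
    have "ennreal C = ennreal \<bar>det (D t)\<bar> * (\<integral>\<^sup>+\<xi>. ennreal (exp (- (c * R (D t *v \<xi>)))) \<partial>lborel)"
      unfolding nnC[symmetric] by (rule nn_integral_lborel_linear[OF det(2)]) measurable
    also have "\<dots> = ennreal (t powr \<mu>) * (\<integral>\<^sup>+\<xi>. ennreal (exp (- (t * c * R \<xi>))) \<partial>lborel)"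
      using t by (simp add: R_hom det mult_ac)
    finally have e: "ennreal C = ennreal (t powr \<mu>) * (\<integral>\<^sup>+\<xi>. ennreal (exp (- (t * c * R \<xi>))) \<partial>lborel)" .
    have "ennreal (t powr (- \<mu>)) * ennreal C = (\<integral>\<^sup>+\<xi>. ennreal (exp (- (t * c * R \<xi>))) \<partial>lborel)"
      unfolding e mult.assoc[symmetric] using t by (simp add: ennreal_mult[symmetric] powr_add[symmetric])
    then have nn: "(\<integral>\<^sup>+\<xi>. ennreal (exp (- (t * c * R \<xi>))) \<partial>lborel) = ennreal (t powr (- \<mu>) * C)"
      using C0 by (simp add: ennreal_mult)
    have "((\<lambda>\<xi>. exp (- (t * c * R \<xi>))) has_integral (t powr (- \<mu>) * C)) UNIV"
        by (rule nn_integral_has_integral[OF _ _ nn]) (auto simp: C0)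
    moreover have "t powr (- \<mu>) * C \<le> (C + 1) * t powr (- \<mu>)" by (simp add: algebra_simps)
    ultimately show ?thesis by blast
  qed
  then show ?thesis using C0 by (intro exI[of _ "C + 1"]) auto
qed

end

section \<open>Fourier series on a complex tube\<close>

text \<open>The character \<open>exp (\<i> x \<bullet> (\<xi> + \<i>\<nu>))\<close> with the complex argument split into its real part \<open>\<xi>\<close> and its
  imaginary part \<open>\<nu>\<close>.\<close>
definition tilted_char :: "int ^ 'd \<Rightarrow> real ^ 'd \<Rightarrow> real ^ 'd \<Rightarrow> complex" where
  "tilted_char x \<xi> \<nu> = exp (Complex (- (real_vec x \<bullet> \<nu>)) (real_vec x \<bullet> \<xi>))"

definition weighted :: "real \<Rightarrow> (int ^ 'd \<Rightarrow> complex) \<Rightarrow> bool" where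
  "weighted a c \<longleftrightarrow> (\<lambda>x. cmod (c x) * exp (a * norm (real_vec x))) summable_on UNIV"

text \<open>The Fourier transform of \<open>c\<close> at \<open>\<xi> + \<i>\<nu>\<close>; meaningful when \<open>weighted a c\<close> and \<open>norm \<nu> \<le> a\<close>.\<close>
definition fourier_tube :: "(int ^ 'd \<Rightarrow> complex) \<Rightarrow> real ^ 'd \<Rightarrow> real ^ 'd \<Rightarrow> complex" where
  "fourier_tube c \<xi> \<nu> = (\<Sum>\<^sub>\<infinity>x. c x * tilted_char x \<xi> \<nu>)"

text \<open>Functions with an absolutely convergent Fourier series on the closed tube of radius \<open>a\<close>. They
  form an algebra, so the pieces of the localization, polynomials in such functions, again have
  coefficients to which the inversion formula applies.\<close>
definition tube_series :: "real \<Rightarrow> (real ^ 'd \<Rightarrow> real ^ 'd \<Rightarrow> complex) \<Rightarrow> bool" where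
  "tube_series a T \<longleftrightarrow> (\<exists>c. weighted a c \<and> (\<forall>\<xi> \<nu>. norm \<nu> \<le> a \<longrightarrow> T \<xi> \<nu> = fourier_tube c \<xi> \<nu>))"

lemma real_vec_add: "real_vec (x + y) = real_vec x + real_vec y"
  and real_vec_diff: "real_vec (x - y) = real_vec x - real_vec y"
  and real_vec_minus: "real_vec (- x) = - real_vec x"
  and real_vec_0: "real_vec 0 = 0"
  by (simp_all add: real_vec_def vec_eq_iff)

lemma tilted_char_add: "tilted_char (x + y) \<xi> \<nu> = tilted_char x \<xi> \<nu> * tilted_char y \<xi> \<nu>"
  unfolding tilted_char_def real_vec_add exp_add[symmetric]
  by (rule arg_cong[where f=exp]) (simp add: complex_eq_iff inner_add_left)

lemma tilted_char_0: "tilted_char 0 \<xi> \<nu> = 1"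
proof -
  have "Complex 0 0 = 0" by (simp add: complex_eq_iff)
  then show ?thesis by (simp add: tilted_char_def real_vec_0)
qed

lemma norm_tilted_char: "cmod (tilted_char x \<xi> \<nu>) = exp (- (real_vec x \<bullet> \<nu>))"
  by (simp add: tilted_char_def)

lemma norm_tilted_char_le: "norm \<nu> \<le> a \<Longrightarrow> cmod (tilted_char x \<xi> \<nu>) \<le> exp (a * norm (real_vec x))"
proof -
  assume "norm \<nu> \<le> a"
  then have "norm (real_vec x) * norm \<nu> \<le> norm (real_vec x) * a"
    by (intro mult_left_mono) auto
  then show ?thesis
    using Cauchy_Schwarz_ineq2[of "real_vec x" \<nu>] by (simp add: norm_tilted_char mult.commute)
qed

lemma fourier_eq_fourier_tube: "fourier \<phi> \<xi> = fourier_tube \<phi> \<xi> 0"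
proof -
  have "\<i> * complex_of_real r = Complex 0 r" for r
    by (simp add: complex_eq_iff)
  then show ?thesis
    by (simp add: fourier_def fourier_tube_def tilted_char_def)
qed

lemma norm_term_le:
  "norm \<nu> \<le> a \<Longrightarrow> cmod (c x * tilted_char x \<xi> \<nu>) \<le> cmod (c x) * exp (a * norm (real_vec x))"
  using norm_tilted_char_le[of \<nu> a x \<xi>] by (simp add: norm_mult mult_left_mono)

lemma weighted_abs_summable:
  assumes "weighted a c" "norm \<nu> \<le> a"
  shows "(\<lambda>x. cmod (c x * tilted_char x \<xi> \<nu>)) summable_on UNIV"
  using assms(1) unfolding weighted_def
  by (rule summable_on_comparison_test) (use norm_term_le[OF assms(2)] in auto)

lemma weighted_summable:
  assumes "weighted a c" "norm \<nu> \<le> a"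
  shows "(\<lambda>x. c x * tilted_char x \<xi> \<nu>) summable_on UNIV"
  using weighted_abs_summable[OF assms] by (rule abs_summable_summable)

lemma norm_fourier_tube_le:
  assumes "weighted a c" "norm \<nu> \<le> a"
  shows "cmod (fourier_tube c \<xi> \<nu>) \<le> (\<Sum>\<^sub>\<infinity>x. cmod (c x) * exp (a * norm (real_vec x)))"
proof -
  have "cmod (fourier_tube c \<xi> \<nu>) \<le> (\<Sum>\<^sub>\<infinity>x. cmod (c x * tilted_char x \<xi> \<nu>))"
    unfolding fourier_tube_def by (rule norm_infsum_bound) (rule weighted_abs_summable[OF assms])
  also have "\<dots> \<le> (\<Sum>\<^sub>\<infinity>x. cmod (c x) * exp (a * norm (real_vec x)))"
    using assms by (intro infsum_mono weighted_abs_summable[OF assms] norm_term_le) (auto simp: weighted_def)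
  finally show ?thesis .
qed

lemma summable_on_product_nonneg:
  fixes p q :: "'a \<Rightarrow> real"
  assumes "p summable_on UNIV" "q summable_on UNIV" "\<And>x. p x \<ge> 0" "\<And>x. q x \<ge> 0"
  shows "(\<lambda>(u, y). p u * q y) summable_on UNIV"
proof -
  have "(\<lambda>(u, y). p u * q y) summable_on (UNIV \<times> UNIV)"
  proof (rule summable_on_SigmaI)
    show "((\<lambda>y. case (x, y) of (u, y) \<Rightarrow> p u * q y) has_sum (p x * infsum q UNIV)) UNIV" for x
      using has_sum_cmult_right[OF has_sum_infsum[OF assms(2)], of "p x"] by simp
    show "(\<lambda>x. p x * infsum q UNIV) summable_on UNIV"
      using assms(1) by (rule summable_on_cmult_left)
  qed (use assms in auto)
  then show ?thesis by simp
qed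

lemma bij_shear: "bij_betw (\<lambda>(x, y). (x - y, y)) (UNIV :: ((int^'d) \<times> (int^'d)) set) UNIV"
  by (rule bij_betw_byWitness[where f'="\<lambda>(x, y). (x + y, y)"]) auto

text \<open>The weight is submultiplicative, so the double family
  \<open>c1 (x - y) * c2 y\<close> is absolutely summable with weight; the shear \<open>(x, y) \<mapsto> (x - y, y)\<close> turns it into a
  product of two single sums.\<close>
lemma convolution_weighted:
  assumes a: "a \<ge> 0" and c: "weighted a c1" "weighted a c2"
  shows "weighted a (convolution c1 c2)"
    and "norm \<nu> \<le> a \<Longrightarrow> fourier_tube (convolution c1 c2) \<xi> \<nu> = fourier_tube c1 \<xi> \<nu> * fourier_tube c2 \<xi> \<nu>"
proof -
  let ?w = "\<lambda>c x. cmod (c x) * exp (a * norm (real_vec x))"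
  have "(\<lambda>(u, y). ?w c1 u * ?w c2 y) summable_on UNIV"
    using c by (intro summable_on_product_nonneg) (auto simp: weighted_def)
  then have G: "(\<lambda>(x, y). ?w c1 (x - y) * ?w c2 y) summable_on UNIV"
    by (subst (asm) summable_on_reindex_bij_betw[OF bij_shear, symmetric]) (simp add: case_prod_unfold)
  have le: "cmod (c1 (x - y) * c2 y) * exp (a * norm (real_vec x)) \<le> ?w c1 (x - y) * ?w c2 y" for x y
  proof -
    have "norm (real_vec x) \<le> norm (real_vec (x - y)) + norm (real_vec y)"
      using norm_triangle_ineq[of "real_vec (x - y)" "real_vec y"] by (simp add: real_vec_diff)
    then have X: "exp (a * norm (real_vec x)) \<le> exp (a * norm (real_vec (x - y))) * exp (a * norm (real_vec y))"
      using mult_left_mono[OF _ a] by (fastforce simp: exp_add[symmetric] algebra_simps)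
    show ?thesis
      using mult_left_mono[OF X, of "cmod (c1 (x - y) * c2 y)"]
      by (simp add: norm_mult mult_ac)
  qed
  have S: "(\<lambda>(x, y). cmod (c1 (x - y) * c2 y) * exp (a * norm (real_vec x))) summable_on (UNIV \<times> UNIV)"
    unfolding UNIV_Times_UNIV using G
    by (rule summable_on_comparison_test) (use le in \<open>auto split: prod.splits\<close>)
  have Sx: "(\<lambda>y. cmod (c1 (x - y) * c2 y)) summable_on UNIV" for x
  proof -
    have "(\<lambda>y. cmod (c1 (x - y) * c2 y) * exp (a * norm (real_vec x))) summable_on UNIV"
      using summable_on_SigmaD1[OF S, of x] by simp
    from summable_on_cmult_left[OF this, of "exp (- (a * norm (real_vec x)))"]
    show ?thesis by (simp add: mult.assoc exp_minus)
  qed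
  have "(\<lambda>x. \<Sum>\<^sub>\<infinity>y. cmod (c1 (x - y) * c2 y) * exp (a * norm (real_vec x))) summable_on UNIV"
    by (rule summable_on_Sigma_banach[OF S])
  then show "weighted a (convolution c1 c2)"
    unfolding weighted_def
  proof (rule summable_on_comparison_test)
    fix x
    have "cmod (convolution c1 c2 x) \<le> (\<Sum>\<^sub>\<infinity>y. cmod (c1 (x - y) * c2 y))"
      unfolding convolution_def by (rule norm_infsum_bound) (rule Sx)
    then have "cmod (convolution c1 c2 x) * exp (a * norm (real_vec x)) \<le>
      (\<Sum>\<^sub>\<infinity>y. cmod (c1 (x - y) * c2 y)) * exp (a * norm (real_vec x))"
      by (intro mult_right_mono) auto
    also have "\<dots> = (\<Sum>\<^sub>\<infinity>y. cmod (c1 (x - y) * c2 y) * exp (a * norm (real_vec x)))"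
      by (rule infsum_cmult_left[symmetric]) (rule Sx)
    finally show "cmod (convolution c1 c2 x) * exp (a * norm (real_vec x)) \<le>
      (\<Sum>\<^sub>\<infinity>y. cmod (c1 (x - y) * c2 y) * exp (a * norm (real_vec x)))" .
  qed auto
  show "fourier_tube (convolution c1 c2) \<xi> \<nu> = fourier_tube c1 \<xi> \<nu> * fourier_tube c2 \<xi> \<nu>" if nu: "norm \<nu> \<le> a"
  proof -
    let ?t = "\<lambda>c x. c x * tilted_char x \<xi> \<nu>"
    have abs2: "(\<lambda>(u, y). cmod (?t c1 u) * cmod (?t c2 y)) summable_on UNIV"
      by (intro summable_on_product_nonneg weighted_abs_summable[OF c(1) nu] weighted_abs_summable[OF c(2) nu]) auto
    have H: "(\<lambda>p. ?t c1 (fst p) * ?t c2 (snd p)) summable_on UNIV"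
      by (rule abs_summable_summable) (use abs2 in \<open>simp add: norm_mult case_prod_unfold\<close>)
    then have H': "(\<lambda>(u, y). ?t c1 u * ?t c2 y) summable_on (UNIV \<times> UNIV)"
      by (simp add: case_prod_unfold)
    have K: "(\<lambda>(x, y). ?t c1 (x - y) * ?t c2 y) summable_on (UNIV \<times> UNIV)"
      using H by (subst (asm) summable_on_reindex_bij_betw[OF bij_shear, symmetric]) (simp add: case_prod_unfold)
    have e: "?t c1 (x - y) * ?t c2 y = c1 (x - y) * c2 y * tilted_char x \<xi> \<nu>" for x y
      using tilted_char_add[of "x - y" y \<xi> \<nu>] by simp
    have "fourier_tube (convolution c1 c2) \<xi> \<nu> = (\<Sum>\<^sub>\<infinity>x. \<Sum>\<^sub>\<infinity>y. ?t c1 (x - y) * ?t c2 y)"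
      unfolding fourier_tube_def
    proof (rule infsum_cong)
      fix x
      have "(\<lambda>y. c1 (x - y) * c2 y) summable_on UNIV" by (rule abs_summable_summable) (rule Sx)
      then show "convolution c1 c2 x * tilted_char x \<xi> \<nu> = (\<Sum>\<^sub>\<infinity>y. ?t c1 (x - y) * ?t c2 y)"
        unfolding convolution_def e by (rule infsum_cmult_left[symmetric])
    qed
    also have "\<dots> = (\<Sum>\<^sub>\<infinity>(x, y)\<in>UNIV \<times> UNIV. ?t c1 (x - y) * ?t c2 y)"
      by (rule infsum_Sigma'_banach[OF K])
    also have "\<dots> = (\<Sum>\<^sub>\<infinity>p. ?t c1 (fst p) * ?t c2 (snd p))"
      by (subst infsum_reindex_bij_betw[OF bij_shear, symmetric]) (simp add: case_prod_unfold)
    also have "\<dots> = (\<Sum>\<^sub>\<infinity>u. \<Sum>\<^sub>\<infinity>y. ?t c1 u * ?t c2 y)"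
      unfolding infsum_Sigma'_banach[OF H'] case_prod_unfold UNIV_Times_UNIV ..
    also have "\<dots> = (\<Sum>\<^sub>\<infinity>u. ?t c1 u * fourier_tube c2 \<xi> \<nu>)"
      unfolding fourier_tube_def by (intro infsum_cong infsum_cmult_right weighted_summable[OF c(2) nu])
    also have "\<dots> = fourier_tube c1 \<xi> \<nu> * fourier_tube c2 \<xi> \<nu>"
      unfolding fourier_tube_def by (intro infsum_cmult_left weighted_summable[OF c(1) nu])
    finally show ?thesis .
  qed
qed

lemma conv_power_weighted:
  assumes a: "a \<ge> 0" and c: "weighted a \<phi>" and n: "n \<ge> 1"
  shows "weighted a (conv_power \<phi> n) \<and> (\<forall>\<xi> \<nu>. norm \<nu> \<le> a \<longrightarrow> fourier_tube (conv_power \<phi> n) \<xi> \<nu> = fourier_tube \<phi> \<xi> \<nu> ^ n)"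
  using n
proof (induction n rule: dec_induct)
  case base
  then show ?case using c by (simp add: conv_power_def)
next
  case (step n)
  have e: "conv_power \<phi> (Suc n) = convolution (conv_power \<phi> n) \<phi>"
    using step(1) by (cases n) (auto simp: conv_power_def)
  then show ?case
    using convolution_weighted[OF a _ c, of "conv_power \<phi> n"] step.IH by (auto simp: mult.commute)
qed

lemma tube_series_tilted_char: "tube_series a (\<lambda>\<xi> \<nu>. k * tilted_char y \<xi> \<nu>)"
proof -
  define c where "c x = (if x = y then k else 0)" for x
  have "fourier_tube c \<xi> \<nu> = (\<Sum>\<^sub>\<infinity>x\<in>{y}. c x * tilted_char x \<xi> \<nu>)" for \<xi> \<nu>
    unfolding fourier_tube_def by (rule infsum_cong_neutral) (auto simp: c_def)
  then have "fourier_tube c \<xi> \<nu> = k * tilted_char y \<xi> \<nu>" for \<xi> \<nu> by (simp add: c_def)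
  moreover have "weighted a c"
    unfolding weighted_def by (rule finite_nonzero_values_imp_summable_on) (simp add: c_def)
  ultimately show ?thesis unfolding tube_series_def by metis
qed

lemma tube_series_const: "tube_series a (\<lambda>\<xi> \<nu>. k)"
  using tube_series_tilted_char[of a k 0] by (simp add: tilted_char_0)

lemma tube_series_add:
  assumes "tube_series a S" "tube_series a T"
  shows "tube_series a (\<lambda>\<xi> \<nu>. S \<xi> \<nu> + T \<xi> \<nu>)"
proof -
  obtain c1 c2 where c: "weighted a c1" "\<And>\<xi> \<nu>. norm \<nu> \<le> a \<Longrightarrow> S \<xi> \<nu> = fourier_tube c1 \<xi> \<nu>"
      "weighted a c2" "\<And>\<xi> \<nu>. norm \<nu> \<le> a \<Longrightarrow> T \<xi> \<nu> = fourier_tube c2 \<xi> \<nu>"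
    using assms unfolding tube_series_def by metis
  have "weighted a (\<lambda>x. c1 x + c2 x)"
  proof -
    have "(\<lambda>x. cmod (c1 x) * exp (a * norm (real_vec x)) + cmod (c2 x) * exp (a * norm (real_vec x))) summable_on UNIV"
      using c(1,3) unfolding weighted_def by (rule summable_on_add)
    then show ?thesis unfolding weighted_def
      by (rule summable_on_comparison_test) (auto simp: norm_triangle_ineq distrib_right[symmetric] intro!: mult_right_mono)
  qed
  moreover have "norm \<nu> \<le> a \<Longrightarrow> S \<xi> \<nu> + T \<xi> \<nu> = fourier_tube (\<lambda>x. c1 x + c2 x) \<xi> \<nu>" for \<xi> \<nu>
    unfolding c(2,4) fourier_tube_def distrib_right
    by (rule infsum_add[symmetric]) (auto intro: weighted_summable c)
  ultimately show ?thesis unfolding tube_series_def by blast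
qed

lemma tube_series_mult:
  assumes "a \<ge> 0" "tube_series a S" "tube_series a T"
  shows "tube_series a (\<lambda>\<xi> \<nu>. S \<xi> \<nu> * T \<xi> \<nu>)"
proof -
  obtain c1 c2 where c: "weighted a c1" "\<And>\<xi> \<nu>. norm \<nu> \<le> a \<Longrightarrow> S \<xi> \<nu> = fourier_tube c1 \<xi> \<nu>"
      "weighted a c2" "\<And>\<xi> \<nu>. norm \<nu> \<le> a \<Longrightarrow> T \<xi> \<nu> = fourier_tube c2 \<xi> \<nu>"
    using assms unfolding tube_series_def by metis
  show ?thesis unfolding tube_series_def
    using convolution_weighted[OF assms(1) c(1,3)] c(2,4)
    by (intro exI[of _ "convolution c1 c2"]) auto
qed

lemma tube_series_diff:
  assumes "a \<ge> 0" "tube_series a S" "tube_series a T"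
  shows "tube_series a (\<lambda>\<xi> \<nu>. S \<xi> \<nu> - T \<xi> \<nu>)"
  using tube_series_add[OF assms(2) tube_series_mult[OF assms(1) tube_series_const[of a "-1"] assms(3)]] by simp

lemma tube_series_sum:
  "(\<And>i. i \<in> I \<Longrightarrow> tube_series a (T i)) \<Longrightarrow> tube_series a (\<lambda>\<xi> \<nu>. \<Sum>i\<in>I. T i \<xi> \<nu>)"
  by (induction I rule: infinite_finite_induct) (auto intro: tube_series_add tube_series_const)

lemma tube_series_prod:
  "a \<ge> 0 \<Longrightarrow> (\<And>i. i \<in> I \<Longrightarrow> tube_series a (T i)) \<Longrightarrow> tube_series a (\<lambda>\<xi> \<nu>. \<Prod>i\<in>I. T i \<xi> \<nu>)"
  by (induction I rule: infinite_finite_induct) (auto intro: tube_series_mult tube_series_const)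

lemma tube_series_power:
  "a \<ge> 0 \<Longrightarrow> tube_series a T \<Longrightarrow> tube_series a (\<lambda>\<xi> \<nu>. T \<xi> \<nu> ^ n)"
  by (induction n) (auto intro: tube_series_mult tube_series_const)

lemma tube_series_fourier_tube: "weighted a c \<Longrightarrow> tube_series a (fourier_tube c)"
  by (auto simp: tube_series_def)

text \<open>The closure of \<open>torus\<close>. It contains several translates of a peak that lies on its boundary.\<close>
definition closed_torus :: "(real ^ 'd) set" where "closed_torus = cbox (\<chi> i. - pi) (\<chi> i. pi)"

section \<open>Inversion with a tilt\<close>

lemma has_integral_exp_int:
  "((\<lambda>t. exp (\<i> * of_int k * complex_of_real t)) has_integral (if k = 0 then 2 * pi else 0)) {-pi..pi}"
proof (cases "k = 0")
  case True
  then show ?thesis using has_integral_const_real[of "1::complex" "-pi" pi] by (simp add: scaleR_conv_of_real)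
next
  case False
  define F where "F t = exp (\<i> * of_int k * complex_of_real t) / (\<i> * of_int k)" for t
  have "((\<lambda>t. exp (\<i> * of_int k * complex_of_real t)) has_integral F pi - F (- pi)) {-pi..pi}"
  proof (rule fundamental_theorem_of_calculus)
    fix t :: real assume "t \<in> {-pi..pi}"
    have "((\<lambda>z. exp (\<i> * of_int k * z) / (\<i> * of_int k)) has_field_derivative exp (\<i> * of_int k * complex_of_real t)) (at (complex_of_real t))"
      using False by (auto intro!: derivative_eq_intros)
    then show "(F has_vector_derivative exp (\<i> * of_int k * complex_of_real t)) (at t within {-pi..pi})"
      unfolding F_def by (rule has_vector_derivative_real_field)
  qed auto
  moreover have "F pi = F (- pi)"
  proof -
    have "exp (\<i> * of_int k * complex_of_real pi) = exp (\<i> * of_int k * complex_of_real (- pi)) * exp (2 * of_int k * pi * \<i>)"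
      unfolding exp_add[symmetric] by (rule arg_cong[where f=exp]) (simp add: algebra_simps)
    also have "exp (2 * of_int k * pi * \<i>) = 1" by (rule exp_integer_2pi) auto
    finally have E: "exp (\<i> * of_int k * complex_of_real pi) = exp (\<i> * of_int k * complex_of_real (- pi))"
      by (simp only: mult_1_right)
    show ?thesis unfolding F_def E ..
  qed
  ultimately show ?thesis using False by simp
qed

lemma has_integral_tilted_char:
  fixes y :: "int^'d"
  shows "((\<lambda>\<xi>. tilted_char y \<xi> \<nu>) has_integral (if y = 0 then of_real ((2 * pi) ^ CARD('d)) else 0)) closed_torus"
proof -
  define f where "f i t = indicator {-pi..pi} t *\<^sub>R exp (\<i> * of_int (y $ i) * complex_of_real t)" for i t
  have 1: "integrable lborel (f i)" and 2: "(\<integral>t. f i t \<partial>lborel) = (if y $ i = 0 then 2 * pi else 0)" for i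
  proof -
    have "set_integrable lborel {-pi..pi} (\<lambda>t. exp (\<i> * of_int (y $ i) * complex_of_real t))"
      by (rule borel_integrable_compact[unfolded set_integrable_def[symmetric]] borel_integrable_atLeastAtMost') (auto intro!: continuous_intros)
    then show i: "integrable lborel (f i)" by (simp add: set_integrable_def f_def[abs_def])
    have "(f i has_integral (\<integral>t. f i t \<partial>lborel)) UNIV" by (rule has_integral_integral_lborel[OF i])
    moreover have "(f i has_integral (if y $ i = 0 then 2 * pi else 0)) UNIV"
    proof -
      have "f i = (\<lambda>t. if t \<in> {-pi..pi} then exp (\<i> * of_int (y $ i) * complex_of_real t) else 0)"
        by (auto simp: f_def fun_eq_iff)
      then show ?thesis using has_integral_exp_int[of "y $ i"] by (simp only: has_integral_restrict_UNIV)
    qed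
    ultimately show "(\<integral>t. f i t \<partial>lborel) = (if y $ i = 0 then 2 * pi else 0)" by (rule has_integral_unique)
  qed
  have e: "(\<Prod>i\<in>UNIV. f i (\<xi> $ i)) = (if \<xi> \<in> closed_torus then tilted_char y \<xi> 0 else 0)" for \<xi>
  proof (cases "\<xi> \<in> closed_torus")
    case True
    then have "f i (\<xi> $ i) = exp (\<i> * of_int (y $ i) * complex_of_real (\<xi> $ i))" for i
      by (auto simp: f_def closed_torus_def mem_box_cart)
    then have "(\<Prod>i\<in>UNIV. f i (\<xi> $ i)) = exp (\<Sum>i\<in>UNIV. \<i> * of_int (y $ i) * complex_of_real (\<xi> $ i))"
      by (simp add: exp_sum)
    also have "(\<Sum>i\<in>UNIV. \<i> * of_int (y $ i) * complex_of_real (\<xi> $ i)) = Complex 0 (real_vec y \<bullet> \<xi>)"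
      by (simp add: complex_eq_iff inner_vec_def real_vec_def)
    finally show ?thesis using True by (simp add: tilted_char_def)
  next
    case False
    then obtain i where "\<not> (- pi \<le> \<xi> $ i \<and> \<xi> $ i \<le> pi)" by (auto simp: closed_torus_def mem_box_cart)
    then have "f i (\<xi> $ i) = 0" by (auto simp: f_def)
    then have "(\<Prod>i\<in>UNIV. f i (\<xi> $ i)) = 0" by (meson finite UNIV_I prod_zero)
    then show ?thesis using False by simp
  qed
  have "(\<Prod>i\<in>UNIV. (\<integral>t. f i t \<partial>lborel)) = (if y = 0 then of_real ((2 * pi) ^ CARD('d)) else 0)"
  proof (cases "y = 0")
    case False
    then obtain i where "y $ i \<noteq> 0" by (auto simp: vec_eq_iff)
    then have "(\<integral>t. f i t \<partial>lborel) = 0" by (simp add: 2)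
    then have "(\<Prod>i\<in>UNIV. (\<integral>t. f i t \<partial>lborel)) = 0" by (meson finite UNIV_I prod_zero)
    then show ?thesis using False by simp
  qed (simp add: 2)
  then have "((\<lambda>\<xi>. \<Prod>i\<in>UNIV. f i (\<xi> $ i)) has_integral (if y = 0 then of_real ((2 * pi) ^ CARD('d)) else 0)) UNIV"
    using has_integral_integral_lborel[OF integral_lborel_vec_prod(1)[of f, OF 1]] integral_lborel_vec_prod(2)[of f, OF 1]
    by simp
  then have h: "((\<lambda>\<xi>. tilted_char y \<xi> 0) has_integral (if y = 0 then of_real ((2 * pi) ^ CARD('d)) else 0)) closed_torus"
    unfolding e by (simp only: has_integral_restrict_UNIV)
  have "tilted_char y \<xi> \<nu> = of_real (exp (- (real_vec y \<bullet> \<nu>))) * tilted_char y \<xi> 0" for \<xi>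
    unfolding tilted_char_def exp_of_real[symmetric] exp_add[symmetric]
    by (rule arg_cong[where f=exp]) (simp add: complex_eq_iff)
  then have "((\<lambda>\<xi>. tilted_char y \<xi> \<nu>) has_integral of_real (exp (- (real_vec y \<bullet> \<nu>))) * (if y = 0 then of_real ((2 * pi) ^ CARD('d)) else 0)) closed_torus"
    using has_integral_mult_right[OF h] by simp
  then show ?thesis by (cases "y = 0") (simp_all add: real_vec_0)
qed

lemma continuous_on_tilted_char: "continuous_on S (\<lambda>\<xi>. tilted_char y \<xi> \<nu>)"
  unfolding tilted_char_def Complex_eq by (intro continuous_intros)

lemma uniform_limit_fourier_tube:
  assumes "weighted a c" "norm \<nu> \<le> a"
  shows "uniform_limit UNIV (\<lambda>F \<xi>. \<Sum>x\<in>F. c x * tilted_char x \<xi> \<nu>) (\<lambda>\<xi>. fourier_tube c \<xi> \<nu>) (finite_subsets_at_top UNIV)"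
  unfolding fourier_tube_def
  by (rule Weierstrass_m_test_general[where M="\<lambda>x. cmod (c x) * exp (a * norm (real_vec x))"])
     (use assms norm_term_le in \<open>auto simp: weighted_def\<close>)

text \<open>The integral does not depend on \<open>\<nu>\<close>: this is the contour shift. Each summand integrates to
  zero except the one at \<open>x\<close>, for which the two tilts cancel.\<close>
lemma has_integral_inversion:
  fixes c :: "int^'d \<Rightarrow> complex"
  assumes "weighted a c" "norm \<nu> \<le> a"
  shows "((\<lambda>\<xi>. fourier_tube c \<xi> \<nu> * tilted_char (- x) \<xi> \<nu>) has_integral (of_real ((2 * pi) ^ CARD('d)) * c x)) closed_torus"
proof -
  define f where "f F \<xi> = (\<Sum>y\<in>F. c y * tilted_char (y - x) \<xi> \<nu>)" for F \<xi>
  let ?FS = "finite_subsets_at_top (UNIV :: (int^'d) set)"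
  have e: "f F \<xi> = (\<Sum>y\<in>F. c y * tilted_char y \<xi> \<nu>) * tilted_char (- x) \<xi> \<nu>" for F \<xi>
    using tilted_char_add[of _ "- x" \<xi> \<nu>] by (simp add: f_def sum_distrib_right mult.assoc)
  have u: "uniform_limit closed_torus f (\<lambda>\<xi>. fourier_tube c \<xi> \<nu> * tilted_char (- x) \<xi> \<nu>) ?FS"
    unfolding e[abs_def]
  proof (rule uniform_lim_mult[OF uniform_limit_on_subset[OF uniform_limit_fourier_tube[OF assms]]])
    show "bounded ((\<lambda>\<xi>. fourier_tube c \<xi> \<nu>) ` closed_torus)"
      using norm_fourier_tube_le[OF assms] by (auto simp: bounded_iff)
    show "bounded ((\<lambda>\<xi>. tilted_char (- x) \<xi> \<nu>) ` closed_torus)"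
      by (auto simp: bounded_iff norm_tilted_char)
  qed (auto intro: uniform_limit_const)
  have cont: "continuous_on closed_torus (f F)" for F
    unfolding f_def by (intro continuous_intros continuous_on_tilted_char)
  obtain I J where IJ: "\<And>F. (f F has_integral I F) closed_torus"
    "((\<lambda>\<xi>. fourier_tube c \<xi> \<nu> * tilted_char (- x) \<xi> \<nu>) has_integral J) closed_torus" "(I \<longlongrightarrow> J) ?FS"
    by (rule uniform_limit_integral_cbox[OF u[unfolded closed_torus_def] cont[unfolded closed_torus_def] finite_subsets_at_top_neq_bot, folded closed_torus_def]) blast
  let ?v = "of_real ((2 * pi) ^ CARD('d)) * c x"
  have I: "I F = ?v" if "finite F" "x \<in> F" for F
  proof -
    have "(f F has_integral (\<Sum>y\<in>F. c y * (if y - x = 0 then of_real ((2 * pi) ^ CARD('d)) else 0))) closed_torus"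
      unfolding f_def by (intro has_integral_sum has_integral_mult_right has_integral_tilted_char that)
    also have "(\<Sum>y\<in>F. c y * (if y - x = 0 then of_real ((2 * pi) ^ CARD('d)) else 0)) = (\<Sum>y\<in>F. if y = x then ?v else 0)"
      by (intro sum.cong) auto
    also have "\<dots> = ?v" using that by simp
    finally show ?thesis using IJ(1)[of F] has_integral_unique by blast
  qed
  have "eventually (\<lambda>F. I F = ?v) ?FS"
    unfolding eventually_finite_subsets_at_top by (rule exI[of _ "{x}"]) (use I in auto)
  then have "(I \<longlongrightarrow> ?v) ?FS" by (rule tendsto_eventually)
  then have "J = ?v" using IJ(3) tendsto_unique finite_subsets_at_top_neq_bot by blast
  then show ?thesis using IJ(2) by simp
qed

lemma continuous_on_fourier_tube:
  assumes "weighted a c" "norm \<nu> \<le> a"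
  shows "continuous_on S (\<lambda>\<xi>. fourier_tube c \<xi> \<nu>)"
proof -
  have "continuous_on UNIV (\<lambda>\<xi>. fourier_tube c \<xi> \<nu>)"
    by (rule uniform_limit_theorem[OF _ uniform_limit_fourier_tube[OF assms]])
       (auto intro!: always_eventually continuous_intros continuous_on_tilted_char)
  then show ?thesis by (rule continuous_on_subset) auto
qed

lemma coefficient_bound:
  fixes c :: "int^'d \<Rightarrow> complex"
  assumes "weighted a c" "norm \<nu> \<le> a" and g: "(g has_integral I) closed_torus"
    and le: "\<And>\<xi>. \<xi> \<in> closed_torus \<Longrightarrow> cmod (fourier_tube c \<xi> \<nu>) \<le> g \<xi>"
  shows "(2 * pi) ^ CARD('d) * cmod (c x) \<le> exp (real_vec x \<bullet> \<nu>) * I"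
proof -
  have "cmod (of_real ((2 * pi) ^ CARD('d)) * c x) \<le> exp (real_vec x \<bullet> \<nu>) * I"
  proof (rule order_trans[OF _ eq_refl])
    note i = has_integral_inversion[OF assms(1,2), of x]
    have "cmod (integral closed_torus (\<lambda>\<xi>. fourier_tube c \<xi> \<nu> * tilted_char (- x) \<xi> \<nu>)) \<le> integral closed_torus (\<lambda>\<xi>. exp (real_vec x \<bullet> \<nu>) * g \<xi>)"
      using i has_integral_mult_right[OF g, of "exp (real_vec x \<bullet> \<nu>)"] le
      by (intro integral_norm_bound_integral) (auto simp: norm_mult norm_tilted_char real_vec_minus mult.commute intro: mult_right_mono)
    then show "cmod (of_real ((2 * pi) ^ CARD('d)) * c x) \<le> integral closed_torus (\<lambda>\<xi>. exp (real_vec x \<bullet> \<nu>) * g \<xi>)"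
      unfolding integral_unique[OF i] .
    show "integral closed_torus (\<lambda>\<xi>. exp (real_vec x \<bullet> \<nu>) * g \<xi>) = exp (real_vec x \<bullet> \<nu>) * I"
      by (rule integral_unique[OF has_integral_mult_right[OF g]])
  qed
  then show ?thesis by (simp add: norm_mult norm_power)
qed

section \<open>Regularity on the tube\<close>

lemma fourier_tube_periodic: "fourier_tube c (\<xi> + (2 * pi) *\<^sub>R real_vec m) \<nu> = fourier_tube c \<xi> \<nu>"
proof -
  have "tilted_char x (\<xi> + (2 * pi) *\<^sub>R real_vec m) \<nu> = tilted_char x \<xi> \<nu>" for x
  proof -
    define k where "k = (\<Sum>i\<in>UNIV. x $ i * m $ i)"
    have "real_vec x \<bullet> real_vec m = of_int k"
      by (simp add: inner_vec_def real_vec_def k_def)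
    then have "tilted_char x (\<xi> + (2 * pi) *\<^sub>R real_vec m) \<nu> = tilted_char x \<xi> \<nu> * exp (complex_of_real (2 * of_int k * pi) * \<i>)"
      unfolding tilted_char_def exp_add[symmetric]
      by (intro arg_cong[where f=exp]) (simp add: complex_eq_iff inner_add_right)
    also have "exp (complex_of_real (2 * of_int k * pi) * \<i>) = 1" by (rule exp_integer_2pi) auto
    finally show ?thesis by simp
  qed
  then show ?thesis by (simp add: fourier_tube_def)
qed

lemma norm_exp_diff_le:
  fixes z w :: complex
  assumes "Re z \<le> b" "Re w \<le> b"
  shows "cmod (exp z - exp w) \<le> exp b * cmod (z - w)"
proof (rule differentiable_bound[where S="{u. Re u \<le> b}" and f'="\<lambda>u h. exp u * h"])
  show "convex {u. Re u \<le> b}" by (rule convex_halfspace_Re_le)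
  show "(exp has_derivative (\<lambda>h. exp u * h)) (at u within {u. Re u \<le> b})" for u :: complex
    using DERIV_exp[of u] by (auto simp: has_field_derivative_def intro: has_derivative_at_withinI)
  show "onorm (\<lambda>h. exp u * h) \<le> exp b" if "u \<in> {u. Re u \<le> b}" for u
    using that by (intro onorm_le) (simp add: norm_mult mult_right_mono)
qed (use assms in auto)

lemma fourier_tube_lipschitz:
  assumes a: "a > 0" and c: "weighted a c"
  shows "\<exists>K>0. \<forall>\<xi> \<xi>' \<nu> \<nu>'. norm \<nu> \<le> a / 2 \<longrightarrow> norm \<nu>' \<le> a / 2 \<longrightarrow>
    cmod (fourier_tube c \<xi> \<nu> - fourier_tube c \<xi>' \<nu>') \<le> K * (norm (\<xi> - \<xi>') + norm (\<nu> - \<nu>'))"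
proof -
  define S where "S = (\<Sum>\<^sub>\<infinity>x. cmod (c x) * exp (a * norm (real_vec x)))"
  have S0: "S \<ge> 0" unfolding S_def by (intro infsum_nonneg) auto
  have "cmod (fourier_tube c \<xi> \<nu> - fourier_tube c \<xi>' \<nu>') \<le> (2 / a * S + 1) * (norm (\<xi> - \<xi>') + norm (\<nu> - \<nu>'))"
    if nu: "norm \<nu> \<le> a / 2" "norm \<nu>' \<le> a / 2" for \<xi> \<xi>' \<nu> \<nu>'
  proof -
    let ?d = "norm (\<xi> - \<xi>') + norm (\<nu> - \<nu>')"
    have nu': "norm \<nu> \<le> a" "norm \<nu>' \<le> a" using nu a by auto
    have le: "cmod (c x * tilted_char x \<xi> \<nu> - c x * tilted_char x \<xi>' \<nu>') \<le> cmod (c x) * exp (a * norm (real_vec x)) * (2 / a * ?d)" for x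
    proof -
      let ?r = "norm (real_vec x)"
      have b: "- (real_vec x \<bullet> v) \<le> a / 2 * ?r" if "norm v \<le> a / 2" for v
        using Cauchy_Schwarz_ineq2[of "real_vec x" v] mult_left_mono[OF that, of ?r] by (simp add: mult.commute)
      have "cmod (tilted_char x \<xi> \<nu> - tilted_char x \<xi>' \<nu>') \<le> exp (a / 2 * ?r) * cmod (Complex (- (real_vec x \<bullet> \<nu>)) (real_vec x \<bullet> \<xi>) - Complex (- (real_vec x \<bullet> \<nu>')) (real_vec x \<bullet> \<xi>'))"
        unfolding tilted_char_def by (rule norm_exp_diff_le) (use b nu in auto)
      also have "cmod (Complex (- (real_vec x \<bullet> \<nu>)) (real_vec x \<bullet> \<xi>) - Complex (- (real_vec x \<bullet> \<nu>')) (real_vec x \<bullet> \<xi>'))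
          \<le> \<bar>real_vec x \<bullet> (\<nu> - \<nu>')\<bar> + \<bar>real_vec x \<bullet> (\<xi> - \<xi>')\<bar>"
        by (rule order_trans[OF cmod_le]) (simp add: inner_diff_right)
      also have "\<dots> \<le> ?r * ?d"
        using Cauchy_Schwarz_ineq2[of "real_vec x" "\<nu> - \<nu>'"] Cauchy_Schwarz_ineq2[of "real_vec x" "\<xi> - \<xi>'"]
        by (simp add: algebra_simps)
      finally have "cmod (tilted_char x \<xi> \<nu> - tilted_char x \<xi>' \<nu>') \<le> exp (a / 2 * ?r) * (?r * ?d)"
        by (simp add: mult_left_mono)
      also have "\<dots> \<le> exp (a / 2 * ?r) * (2 / a * exp (a / 2 * ?r) * ?d)"
      proof -
        have "?r \<le> 2 / a * exp (a / 2 * ?r)"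
          using exp_ge_add_one_self[of "a / 2 * ?r"] a by (simp add: field_simps)
        then show ?thesis by (intro mult_left_mono mult_right_mono) auto
      qed
      also have "\<dots> = (exp (a / 2 * ?r) * exp (a / 2 * ?r)) * (2 / a * ?d)" by (simp only: mult_ac)
      also have "exp (a / 2 * ?r) * exp (a / 2 * ?r) = exp (a * ?r)" by (simp add: exp_add[symmetric])
      finally show ?thesis
        unfolding right_diff_distrib[symmetric] norm_mult mult.assoc[of "cmod (c x)"]
        by (rule mult_left_mono) auto
    qed
    have s1: "(\<lambda>x. cmod (c x) * exp (a * norm (real_vec x)) * (2 / a * ?d)) summable_on UNIV"
      using c unfolding weighted_def by (rule summable_on_cmult_left)
    have s2: "(\<lambda>x. cmod (c x * tilted_char x \<xi> \<nu> - c x * tilted_char x \<xi>' \<nu>')) summable_on UNIV"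
      by (rule summable_on_comparison_test[OF s1]) (use le in auto)
    have "fourier_tube c \<xi> \<nu> - fourier_tube c \<xi>' \<nu>' = (\<Sum>\<^sub>\<infinity>x. c x * tilted_char x \<xi> \<nu> - c x * tilted_char x \<xi>' \<nu>')"
      unfolding fourier_tube_def 
      using infsum_add[OF weighted_summable[OF c nu'(1)] summable_on_uminus[THEN iffD2, OF weighted_summable[OF c nu'(2)]], of \<xi> \<xi>']
      by (simp add: infsum_uminus)
    then have "cmod (fourier_tube c \<xi> \<nu> - fourier_tube c \<xi>' \<nu>') \<le> (\<Sum>\<^sub>\<infinity>x. cmod (c x * tilted_char x \<xi> \<nu> - c x * tilted_char x \<xi>' \<nu>'))"
      using norm_infsum_bound[OF s2] by simp
    also have "\<dots> \<le> (\<Sum>\<^sub>\<infinity>x. cmod (c x) * exp (a * norm (real_vec x)) * (2 / a * ?d))"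
      by (rule infsum_mono[OF s2 s1 le])
    also have "\<dots> = S * (2 / a * ?d)"
      unfolding S_def by (rule infsum_cmult_left) (use c in \<open>simp add: weighted_def\<close>)
    also have "\<dots> \<le> (2 / a * S + 1) * ?d" by (simp add: algebra_simps)
    finally show ?thesis .
  qed
  moreover have "2 / a * S + 1 > 0" using S0 a by (simp add: add_nonneg_pos)
  ultimately show ?thesis by blast
qed

text \<open>On the complex line \<open>s \<mapsto> \<xi> + s \<nu>\<close> the extension is a locally uniform limit of exponential
  polynomials in \<open>s\<close>.\<close>
lemma holomorphic_on_complex_line:
  assumes c: "weighted a c" and r: "r > 0" "r * norm \<nu> \<le> a"
  shows "(\<lambda>s. fourier_tube c (\<xi> + Re s *\<^sub>R \<nu>) (Im s *\<^sub>R \<nu>)) holomorphic_on ball 0 r"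
proof -
  have e: "tilted_char x (\<xi> + Re s *\<^sub>R \<nu>) (Im s *\<^sub>R \<nu>) = exp (\<i> * (of_real (real_vec x \<bullet> \<xi>) + s * of_real (real_vec x \<bullet> \<nu>)))" for x s
    unfolding tilted_char_def by (rule arg_cong[where f=exp]) (simp add: complex_eq_iff inner_add_right)
  let ?f = "\<lambda>F s. \<Sum>x\<in>F. c x * tilted_char x (\<xi> + Re s *\<^sub>R \<nu>) (Im s *\<^sub>R \<nu>)"
  have nu: "norm (Im s *\<^sub>R \<nu>) \<le> a" if "s \<in> cball 0 r" for s
  proof -
    have "\<bar>Im s\<bar> \<le> r" using that abs_Im_le_cmod[of s] by simp
    then show ?thesis using r(2) mult_right_mono[of "\<bar>Im s\<bar>" r "norm \<nu>"] by simp
  qed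
  have u: "uniform_limit (cball 0 r) ?f (\<lambda>s. fourier_tube c (\<xi> + Re s *\<^sub>R \<nu>) (Im s *\<^sub>R \<nu>)) (finite_subsets_at_top UNIV)"
    unfolding fourier_tube_def
    by (rule Weierstrass_m_test_general[where M="\<lambda>x. cmod (c x) * exp (a * norm (real_vec x))"])
       (use c norm_term_le[OF nu] in \<open>auto simp: weighted_def\<close>)
  have "?f F holomorphic_on UNIV" for F
    unfolding e by (intro holomorphic_intros)
  then have ev: "eventually (\<lambda>F. continuous_on (cball 0 r) (?f F) \<and> ?f F holomorphic_on ball 0 r) (finite_subsets_at_top UNIV)"
    by (intro always_eventually allI conjI holomorphic_on_imp_continuous_on) (auto intro: holomorphic_on_subset)
  show ?thesis
    using holomorphic_uniform_limit[OF ev u] finite_subsets_at_top_neq_bot by blast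
qed

section \<open>Exponential decay of the coefficients\<close>

lemma shift_into_torus: "\<exists>m. \<xi> + (2 * pi) *\<^sub>R real_vec m \<in> torus"
proof -
  define m :: "int^'a" where "m = (\<chi> i. \<lfloor>(pi - \<xi> $ i) / (2 * pi)\<rfloor>)"
  have "- pi < \<xi> $ i + 2 * pi * real_of_int (m $ i) \<and> \<xi> $ i + 2 * pi * real_of_int (m $ i) \<le> pi" for i
  proof -
    have mi: "m $ i = \<lfloor>(pi - \<xi> $ i) / (2 * pi)\<rfloor>" by (simp add: m_def)
    have "real_of_int (m $ i) \<le> (pi - \<xi> $ i) / (2 * pi)" "(pi - \<xi> $ i) / (2 * pi) < real_of_int (m $ i) + 1"
      unfolding mi by (rule of_int_floor_le, rule real_of_int_floor_add_one_gt)
    then have "2 * pi * real_of_int (m $ i) \<le> pi - \<xi> $ i" "pi - \<xi> $ i < 2 * pi * (real_of_int (m $ i) + 1)"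
      by (simp_all add: field_simps)
    then show ?thesis by (simp add: algebra_simps)
  qed
  then have "\<xi> + (2 * pi) *\<^sub>R real_vec m \<in> torus"
    by (simp add: torus_def real_vec_def)
  then show ?thesis ..
qed

text \<open>Holomorphic extension in one variable at a time with radius and bound explicit, a form that passes
  through periodicity and compactness.\<close>
definition extends_along_axes :: "(int ^ 'd \<Rightarrow> complex) \<Rightarrow> real \<Rightarrow> real \<Rightarrow> real ^ 'd \<Rightarrow> bool" where
  "extends_along_axes \<phi> r M \<xi> \<longleftrightarrow> (\<forall>j. \<exists>G. G holomorphic_on ball 0 r \<and> (\<forall>h\<in>ball 0 r. cmod (G h) \<le> M) \<and>
     (\<forall>t::real. \<bar>t\<bar> < r \<longrightarrow> G (of_real t) = fourier \<phi> (\<xi> + t *\<^sub>R axis j 1)))"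

lemma extends_along_axes_mono: "extends_along_axes \<phi> r M \<xi> \<Longrightarrow> r' \<le> r \<Longrightarrow> M \<le> M' \<Longrightarrow> extends_along_axes \<phi> r' M' \<xi>"
  unfolding extends_along_axes_def
proof (intro allI)
  fix j
  assume "\<forall>j. \<exists>G. G holomorphic_on ball 0 r \<and> (\<forall>h\<in>ball 0 r. cmod (G h) \<le> M) \<and>
     (\<forall>t::real. \<bar>t\<bar> < r \<longrightarrow> G (of_real t) = fourier \<phi> (\<xi> + t *\<^sub>R axis j 1))"
    and le: "r' \<le> r" "M \<le> M'"
  then obtain G where G: "G holomorphic_on ball 0 r" "\<forall>h\<in>ball 0 r. cmod (G h) \<le> M"
     "\<forall>t::real. \<bar>t\<bar> < r \<longrightarrow> G (of_real t) = fourier \<phi> (\<xi> + t *\<^sub>R axis j 1)" by blast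
  have "ball (0::complex) r' \<subseteq> ball 0 r" using le by auto
  then show "\<exists>G. G holomorphic_on ball 0 r' \<and> (\<forall>h\<in>ball 0 r'. cmod (G h) \<le> M') \<and>
     (\<forall>t::real. \<bar>t\<bar> < r' \<longrightarrow> G (of_real t) = fourier \<phi> (\<xi> + t *\<^sub>R axis j 1))"
    using G le by (intro exI[of _ G]) (auto intro: holomorphic_on_subset order_trans)
qed

lemma fourier_periodic: "fourier \<phi> (\<xi> + (2 * pi) *\<^sub>R real_vec m) = fourier \<phi> \<xi>"
  by (simp add: fourier_eq_fourier_tube fourier_tube_periodic)

lemma extends_along_axes_periodic: "extends_along_axes \<phi> r M (\<xi> + (2 * pi) *\<^sub>R real_vec m) \<longleftrightarrow> extends_along_axes \<phi> r M \<xi>"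
proof -
  have "\<xi> + (2 * pi) *\<^sub>R real_vec m + t *\<^sub>R axis j 1 = (\<xi> + t *\<^sub>R axis j 1) + (2 * pi) *\<^sub>R real_vec m" for t j
    by simp
  then show ?thesis by (simp only: extends_along_axes_def fourier_periodic)
qed

lemma norm_complex_vec: "norm (complex_vec v) = norm v"
  by (simp add: norm_vec_def complex_vec_def)

lemma norm_axis_complex: "norm (axis j h :: complex^'d) = cmod h"
proof -
  have "(norm ((axis j h :: complex^'d) $ i))\<^sup>2 = (if i = j then (cmod h)\<^sup>2 else 0)" for i
    by (simp add: axis_def)
  then show ?thesis by (simp add: norm_vec_def L2_set_def)
qed

text \<open>A ball around the base point on which the given extension is bounded contains discs of half the
  radius around all nearby points, in every coordinate direction.\<close>
lemma extends_along_axes_near_torus: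
  fixes \<phi> :: "int^'d \<Rightarrow> complex"
  assumes "\<phi> \<in> H_class" "\<zeta> \<in> torus"
  shows "\<exists>r>0. \<exists>M. \<forall>\<xi>\<in>ball \<zeta> r. extends_along_axes \<phi> r M \<xi>"
proof -
  obtain U F where UF: "complex_vec ` torus \<subseteq> U" "holomorphic_sev F U"
    "\<And>\<xi>. complex_vec \<xi> \<in> U \<Longrightarrow> F (complex_vec \<xi>) = fourier \<phi> \<xi>"
    using assms(1) unfolding H_class_def by blast
  have U: "open U" and der: "\<And>z. z \<in> U \<Longrightarrow> \<exists>F'. (F has_derivative F') (at z) \<and> Vector_Spaces.linear (*s) (*) F'"
    using UF(2) by (auto simp: holomorphic_sev_def)
  have zU: "complex_vec \<zeta> \<in> U" using UF(1) assms(2) by auto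
  obtain \<epsilon> where \<epsilon>: "\<epsilon> > 0" "ball (complex_vec \<zeta>) \<epsilon> \<subseteq> U" using U zU open_contains_ball by blast
  have "isCont F (complex_vec \<zeta>)" using der[OF zU] has_derivative_continuous by blast
  then obtain \<delta> where \<delta>: "\<delta> > 0" "\<And>z. dist z (complex_vec \<zeta>) < \<delta> \<Longrightarrow> dist (F z) (F (complex_vec \<zeta>)) < 1"
    unfolding continuous_at_eps_delta using zero_less_one by metis
  define M where "M = cmod (F (complex_vec \<zeta>)) + 1"
  define r where "r = min \<epsilon> \<delta> / 2"
  have r: "r > 0" using \<epsilon> \<delta> by (simp add: r_def)
  have "extends_along_axes \<phi> r M \<xi>" if \<xi>: "\<xi> \<in> ball \<zeta> r" for \<xi>
    unfolding extends_along_axes_def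
  proof
    fix j
    define z where "z h = complex_vec \<xi> + axis j h" for h
    have near: "dist (z h) (complex_vec \<zeta>) < min \<epsilon> \<delta>" if "h \<in> ball 0 r" for h
    proof -
      have "dist (z h) (complex_vec \<zeta>) \<le> norm (complex_vec \<xi> - complex_vec \<zeta>) + norm (axis j h)"
        unfolding z_def dist_norm by (metis norm_triangle_ineq add_diff_eq add.commute diff_add_eq)
      also have "complex_vec \<xi> - complex_vec \<zeta> = complex_vec (\<xi> - \<zeta>)"
        by (simp add: complex_vec_def vec_eq_iff)
      also have "norm (complex_vec (\<xi> - \<zeta>)) + norm (axis j h) < r + r"
        using that \<xi> by (simp add: norm_complex_vec norm_axis_complex dist_norm norm_minus_commute)
      finally show ?thesis by (simp add: r_def)
    qed
    have inU: "z h \<in> U" if "h \<in> ball 0 r" for h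
      using near[OF that] \<epsilon> by (auto simp: dist_commute)
    have bl: "bounded_linear (axis j :: complex \<Rightarrow> complex^'d)"
      unfolding linear_conv_bounded_linear[symmetric]
    proof (rule linearI)
      show "axis j (b1 + b2) = (axis j b1 + axis j b2 :: complex^'d)" for b1 b2
        by (simp add: axis_def vec_eq_iff)
      show "axis j (r *\<^sub>R b) = (r *\<^sub>R axis j b :: complex^'d)" for r b
        by (simp add: axis_def vec_eq_iff)
    qed
    have hol: "(\<lambda>h. F (z h)) holomorphic_on ball 0 r"
      unfolding holomorphic_on_def
    proof
      fix h assume h: "h \<in> ball (0::complex) r"
      obtain F' where F': "(F has_derivative F') (at (z h))" "Vector_Spaces.linear (*s) (*) F'"
        using der[OF inU[OF h]] by blast
      have "(z has_derivative axis j) (at h)"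
        unfolding z_def using bounded_linear.has_derivative[OF bl has_derivative_ident] 
        by (auto intro!: derivative_eq_intros)
      then have d: "((\<lambda>h. F (z h)) has_derivative (\<lambda>k. F' (axis j k))) (at h)"
        using has_derivative_compose[of z "axis j" h UNIV F F'] F'(1) by simp
      have lin: "F' (axis j k) = F' (axis j 1) * k" for k
      proof -
        have e: "axis j k = k *s axis j 1" by (simp add: axis_def vec_eq_iff)
        interpret L: Vector_Spaces.linear "(*s)" "(*)" F' by (rule F'(2))
        show ?thesis unfolding e by (simp add: L.scale mult.commute)
      qed
      have eq: "(\<lambda>k. F' (axis j k)) = (*) (F' (axis j 1))"
        by (rule ext) (rule lin)
      have "((\<lambda>h. F (z h)) has_field_derivative F' (axis j 1)) (at h)"
        unfolding has_field_derivative_def by (rule has_derivative_eq_rhs[OF d eq])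
      then show "(\<lambda>h. F (z h)) field_differentiable at h within ball 0 r"
        using field_differentiable_def field_differentiable_at_within by blast
    qed
    have bd: "cmod (F (z h)) \<le> M" if "h \<in> ball 0 r" for h
      using \<delta>(2)[of "z h"] near[OF that] norm_triangle_ineq2[of "F (z h)" "F (complex_vec \<zeta>)"]
      by (simp add: M_def dist_norm)
    have ag: "F (z (of_real t)) = fourier \<phi> (\<xi> + t *\<^sub>R axis j 1)" if "\<bar>t\<bar> < r" for t
    proof -
      have "z (of_real t) = complex_vec (\<xi> + t *\<^sub>R axis j 1)"
        by (simp add: z_def complex_vec_def axis_def vec_eq_iff)
      then show ?thesis using UF(3)[of "\<xi> + t *\<^sub>R axis j 1"] inU[of "of_real t"] that by simp
    qed
    show "\<exists>G. G holomorphic_on ball 0 r \<and> (\<forall>h\<in>ball 0 r. cmod (G h) \<le> M) \<and>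
       (\<forall>t::real. \<bar>t\<bar> < r \<longrightarrow> G (of_real t) = fourier \<phi> (\<xi> + t *\<^sub>R axis j 1))"
      using hol bd ag by (intro exI[of _ "\<lambda>h. F (z h)"]) auto
  qed
  then show ?thesis using r by blast
qed

lemma compact_closed_torus: "compact closed_torus" by (simp add: closed_torus_def)

text \<open>Periodicity supplies the extension at the points of the closed torus that are missing from the
  half-open one; compactness then makes the radius and the bound uniform.\<close>
lemma extends_along_axes_uniform:
  fixes \<phi> :: "int^'d \<Rightarrow> complex"
  assumes "\<phi> \<in> H_class"
  shows "\<exists>r>0. \<exists>M. \<forall>\<xi>\<in>closed_torus. extends_along_axes \<phi> r M \<xi>"
proof -
  have "\<exists>r>0. \<exists>M. \<forall>\<xi>\<in>ball \<zeta> r. extends_along_axes \<phi> r M \<xi>" for \<zeta>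
  proof -
    obtain m where "\<zeta> + (2 * pi) *\<^sub>R real_vec m \<in> torus" using shift_into_torus by blast
    from extends_along_axes_near_torus[OF assms this] obtain r M where
      r: "r > 0" "\<And>\<xi>. \<xi> \<in> ball (\<zeta> + (2 * pi) *\<^sub>R real_vec m) r \<Longrightarrow> extends_along_axes \<phi> r M \<xi>" by blast
    have "extends_along_axes \<phi> r M \<xi>" if "\<xi> \<in> ball \<zeta> r" for \<xi>
      using r(2)[of "\<xi> + (2 * pi) *\<^sub>R real_vec m"] that by (simp add: extends_along_axes_periodic dist_norm)
    then show ?thesis using r by blast
  qed
  then obtain r M where rM: "\<And>\<zeta>. r \<zeta> > 0" "\<And>\<zeta> \<xi>. \<xi> \<in> ball \<zeta> (r \<zeta>) \<Longrightarrow> extends_along_axes \<phi> (r \<zeta>) (M \<zeta>) \<xi>"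
    by metis
  obtain C where C: "C \<subseteq> closed_torus" "finite C" "(closed_torus :: (real^'d) set) \<subseteq> (\<Union>c\<in>C. ball c (r c))"
    by (rule compactE_image[OF compact_closed_torus, of closed_torus "\<lambda>\<zeta>. ball \<zeta> (r \<zeta>)"]) (use rM(1) in auto)
  have ne: "C \<noteq> {}"
  proof -
    have "(0 :: real^'d) \<in> closed_torus" by (simp add: closed_torus_def mem_box_cart)
    then show ?thesis using C(3) by auto
  qed
  define r0 where "r0 = Min (r ` C)"
  define M0 where "M0 = Max (M ` C)"
  have "r0 > 0" using rM(1) C(2) ne by (simp add: r0_def)
  moreover have "extends_along_axes \<phi> r0 M0 \<xi>" if \<xi>: "\<xi> \<in> closed_torus" for \<xi>
  proof -
    obtain c where c: "c \<in> C" "\<xi> \<in> ball c (r c)" using C(3) \<xi> by blast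
    then have "extends_along_axes \<phi> (r c) (M c) \<xi>" using rM by blast
    then show ?thesis by (rule extends_along_axes_mono) (use c C(2) in \<open>auto simp: r0_def M0_def\<close>)
  qed
  ultimately show ?thesis by blast
qed

text \<open>Expand \<open>fourier \<phi> (\<xi> + h e\<^sub>j)\<close> in powers of \<open>h\<close>. The Taylor coefficients \<open>g k\<close> are continuous in \<open>\<xi>\<close>
  and satisfy Cauchy bounds uniformly in \<open>\<xi>\<close>. The power series in \<open>h\<close> formed
  from their Fourier coefficients at \<open>x\<close> equals \<open>\<phi> x * exp (\<i> x\<^sub>j h)\<close>, up to the factor \<open>(2 * pi) ^ d\<close>, for
  real \<open>h\<close> and then, by the identity theorem, in a disc. Evaluation at an imaginary \<open>h\<close> of the right sign gives the exponential factor.\<close>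
lemma coordinate_decay:
  fixes \<phi> :: "int^'d \<Rightarrow> complex"
  assumes l1: "weighted 0 \<phi>" and r: "r > 0" and ext: "\<And>\<xi>. \<xi> \<in> closed_torus \<Longrightarrow> extends_along_axes \<phi> r M \<xi>"
  shows "(2 * pi) ^ CARD('d) * cmod (\<phi> x) * exp (r / 4 * \<bar>real_of_int (x $ j)\<bar>) \<le> 2 * (M * measure lborel (closed_torus :: (real^'d) set))"
proof -
  define \<rho> where "\<rho> = r / 2"
  have \<rho>: "\<rho> > 0" "\<rho> < r" using r by (auto simp: \<rho>_def)
  have half: "(\<lambda>i. (1/2::real) ^ i) sums 2" using geometric_sums[of "1/2::real"] by simp
  let ?V = "of_real ((2 * pi) ^ CARD('d)) :: complex"
  let ?f = "\<lambda>t \<xi>. fourier \<phi> (\<xi> + t *\<^sub>R axis j 1)"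
  have "\<exists>G. \<forall>\<xi>\<in>closed_torus. G \<xi> holomorphic_on ball 0 r \<and> (\<forall>h\<in>ball 0 r. cmod (G \<xi> h) \<le> M) \<and>
     (\<forall>t::real. \<bar>t\<bar> < r \<longrightarrow> G \<xi> (of_real t) = ?f t \<xi>)"
    by (rule bchoice) (use ext in \<open>auto simp: extends_along_axes_def\<close>)
  then obtain G where G0: "\<forall>\<xi>\<in>closed_torus. G \<xi> holomorphic_on ball 0 r \<and> (\<forall>h\<in>ball 0 r. cmod (G \<xi> h) \<le> M) \<and>
     (\<forall>t::real. \<bar>t\<bar> < r \<longrightarrow> G \<xi> (of_real t) = ?f t \<xi>)" by blast
  have G: "\<And>\<xi>. \<xi> \<in> closed_torus \<Longrightarrow> G \<xi> holomorphic_on ball 0 r"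
    "\<And>\<xi> h. \<xi> \<in> closed_torus \<Longrightarrow> cmod h < r \<Longrightarrow> cmod (G \<xi> h) \<le> M"
    "\<And>\<xi> t. \<xi> \<in> closed_torus \<Longrightarrow> \<bar>t\<bar> < r \<Longrightarrow> G \<xi> (complex_of_real t) = ?f t \<xi>"
    using G0 by auto
  have 0: "(0 :: real^'d) \<in> closed_torus" by (simp add: closed_torus_def mem_box_cart)
  have M0: "M \<ge> 0" using G(2)[OF 0, of 0] r by (simp add: order_trans[OF norm_ge_zero])
  define g where "g k \<xi> = (deriv ^^ k) (G \<xi>) 0 / fact k" for k \<xi>
  have gb: "cmod (g k \<xi>) \<le> M / \<rho> ^ k" if \<xi>: "\<xi> \<in> closed_torus" for k \<xi>
  proof -
    have sub: "cball (0::complex) \<rho> \<subseteq> ball 0 r" using \<rho> by auto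
    have "cmod ((deriv ^^ k) (G \<xi>) 0) \<le> fact k * M / \<rho> ^ k"
    proof (rule Cauchy_inequality)
      show "G \<xi> holomorphic_on ball 0 \<rho>"
        using G(1)[OF \<xi>] by (rule holomorphic_on_subset) (use \<rho> in auto)
      show "continuous_on (cball 0 \<rho>) (G \<xi>)"
        using holomorphic_on_imp_continuous_on[OF G(1)[OF \<xi>]] sub by (rule continuous_on_subset)
      show "norm (G \<xi> z) \<le> M" if "norm (0 - z) = \<rho>" for z
        using G(2)[OF \<xi>, of z] that \<rho> by simp
    qed (use \<rho> in auto)
    then show ?thesis by (simp add: g_def norm_divide field_simps)
  qed
  have gs: "(\<lambda>k. g k \<xi> * of_real t ^ k) sums ?f t \<xi>" if \<xi>: "\<xi> \<in> closed_torus" and t: "\<bar>t\<bar> < r" for \<xi> t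
    using holomorphic_power_series[OF G(1)[OF \<xi>], of "of_real t"] G(3)[OF \<xi> t] t by (simp add: g_def)
  have fc: "continuous_on S (?f t)" for t S
  proof -
    have "continuous_on UNIV (\<lambda>\<xi>. fourier_tube \<phi> \<xi> 0)" by (rule continuous_on_fourier_tube[OF l1]) simp
    then show ?thesis unfolding fourier_eq_fourier_tube
      by (rule continuous_on_compose2) (auto intro!: continuous_intros)
  qed
  have gc: "continuous_on closed_torus (g k)" for k
  proof (induction k rule: less_induct)
    case (less k)
    define t where "t n = \<rho> / (2 + real n)" for n
    have t: "t n > 0" "t n \<le> \<rho> / 2" for n using \<rho> by (auto simp: t_def field_simps)
    have tr: "\<bar>t n\<bar> < r" for n using t[of n] \<rho> by linarith
    \<comment> \<open>Difference quotients of order \<open>k\<close>: continuous by induction, and converging to \<open>g k\<close> uniformly.\<close>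
    define q where "q n \<xi> = (?f (t n) \<xi> - (\<Sum>i<k. g i \<xi> * of_real (t n) ^ i)) / of_real (t n) ^ k" for n \<xi>
    have qc: "continuous_on closed_torus (q n)" for n
      unfolding q_def using t[of n] by (intro continuous_intros fc less.IH) auto
    have err: "cmod (q n \<xi> - g k \<xi>) \<le> (2 * M / \<rho> ^ Suc k) * t n" if \<xi>: "\<xi> \<in> closed_torus" for n \<xi>
    proof -
      let ?t = "complex_of_real (t n)"
      have *: "(\<lambda>i. g (i + Suc k) \<xi> * ?t ^ (i + Suc k)) sums (?f (t n) \<xi> - (\<Sum>i<Suc k. g i \<xi> * ?t ^ i))"
        by (rule sums_split_initial_segment[OF gs[OF \<xi> tr]])
      have s: "(\<lambda>i. g (i + Suc k) \<xi> * ?t ^ Suc i) sums (q n \<xi> - g k \<xi>)"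
      proof -
        have t0: "?t \<noteq> 0" using t(1)[of n] by simp
        have "(?f (t n) \<xi> - (\<Sum>i<Suc k. g i \<xi> * ?t ^ i)) / ?t ^ k = q n \<xi> - g k \<xi>"
          using t0 by (simp add: q_def diff_divide_distrib add_divide_distrib)
        moreover have "g (i + Suc k) \<xi> * ?t ^ (i + Suc k) / ?t ^ k = g (i + Suc k) \<xi> * ?t ^ Suc i" for i
          using t0 by (simp add: power_add)
        ultimately show ?thesis using sums_divide[OF *, of "?t ^ k"] by (simp only:)
      qed
      have le: "cmod (g (i + Suc k) \<xi> * ?t ^ Suc i) \<le> (M / \<rho> ^ Suc k * t n) * (1/2) ^ i" for i
      proof -
        have "cmod (g (i + Suc k) \<xi> * ?t ^ Suc i) \<le> M / \<rho> ^ (i + Suc k) * (t n * (\<rho> / 2) ^ i)"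
          unfolding norm_mult norm_power using gb[OF \<xi>, of "i + Suc k"] t[of n] M0 \<rho>
          by (intro mult_mono) (auto intro!: mult_left_mono power_mono)
        also have "\<dots> = (M / \<rho> ^ Suc k * t n) * (1/2) ^ i"
          using \<rho> by (simp add: power_add field_simps)
        finally show ?thesis .
      qed
      have gsum: "(\<lambda>i. (M / \<rho> ^ Suc k * t n) * (1/2) ^ i) sums ((M / \<rho> ^ Suc k * t n) * 2)"
        by (rule sums_mult[OF half])
      have "cmod (q n \<xi> - g k \<xi>) \<le> (M / \<rho> ^ Suc k * t n) * 2"
        unfolding sums_unique[OF s] sums_unique[OF gsum]
        using le norm_suminf_le[of "\<lambda>i. g (i + Suc k) \<xi> * ?t ^ Suc i" "\<lambda>i. (M / \<rho> ^ Suc k * t n) * (1/2) ^ i"] sums_summable[OF gsum] by blast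
      then show ?thesis by (simp add: mult_ac)
    qed
    have "uniform_limit closed_torus q (g k) sequentially"
    proof (rule uniform_limitI)
      fix e :: real assume e: "e > 0"
      have "(\<lambda>n. (2 * M / \<rho> ^ Suc k) * t n) \<longlonglongrightarrow> (2 * M / \<rho> ^ Suc k) * 0"
        unfolding t_def by (intro tendsto_mult tendsto_const) real_asymp
      then have "\<forall>\<^sub>F n in sequentially. (2 * M / \<rho> ^ Suc k) * t n < e"
        using e by (intro order_tendstoD) auto
      then show "\<forall>\<^sub>F n in sequentially. \<forall>\<xi>\<in>closed_torus. dist (q n \<xi>) (g k \<xi>) < e"
        by eventually_elim (use err in \<open>auto simp: dist_norm intro: le_less_trans\<close>)
    qed
    then show ?case
      by (rule uniform_limit_theorem[rotated]) (auto intro: always_eventually qc)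
  qed
  define A where "A k = integral closed_torus (\<lambda>\<xi>. g k \<xi> * tilted_char (- x) \<xi> 0)" for k
  have AI: "((\<lambda>\<xi>. g k \<xi> * tilted_char (- x) \<xi> 0) has_integral A k) closed_torus" for k
    unfolding A_def closed_torus_def
    by (intro integrable_integral integrable_continuous continuous_intros gc[unfolded closed_torus_def] continuous_on_tilted_char)
  let ?C = "M * measure lborel (closed_torus :: (real^'d) set)"
  have Ab: "cmod (A k) \<le> ?C / \<rho> ^ k" for k
  proof -
    have "cmod (A k) \<le> (M / \<rho> ^ k) * measure lborel (closed_torus :: (real^'d) set)"
      unfolding closed_torus_def
    proof (rule has_integral_bound[OF _ AI[unfolded closed_torus_def]])
      show "cmod (g k \<xi> * tilted_char (- x) \<xi> 0) \<le> M / \<rho> ^ k" if "\<xi> \<in> cbox (\<chi> i. - pi) (\<chi> i. pi)" for \<xi>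
        using gb[of \<xi> k] that by (simp add: norm_mult norm_tilted_char closed_torus_def)
    qed (use M0 \<rho> in auto)
    then show ?thesis by simp
  qed
  have As: "(\<lambda>k. A k * of_real t ^ k) sums (?V * \<phi> x * exp (\<i> * of_int (x $ j) * of_real t))" if t: "\<bar>t\<bar> < \<rho>" for t
  proof -
    have tr: "\<bar>t\<bar> < r" using t \<rho> by simp
    let ?h = "\<lambda>k \<xi>. (g k \<xi> * tilted_char (- x) \<xi> 0) * of_real t ^ k"
    define F where "F \<xi> = ?f t \<xi> * tilted_char (- x) \<xi> 0" for \<xi>
    have sF: "(\<lambda>k. ?h k \<xi>) sums F \<xi>" if "\<xi> \<in> closed_torus" for \<xi>
      using sums_mult2[OF gs[OF that tr], of "tilted_char (- x) \<xi> 0"] by (simp add: F_def mult_ac)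
    have "uniform_limit closed_torus (\<lambda>n \<xi>. \<Sum>k<n. ?h k \<xi>) (\<lambda>\<xi>. suminf (\<lambda>k. ?h k \<xi>)) sequentially"
    proof (rule Weierstrass_m_test)
      show "norm (?h k \<xi>) \<le> M * (\<bar>t\<bar> / \<rho>) ^ k" if "\<xi> \<in> closed_torus" for k \<xi>
        using mult_right_mono[OF gb[OF that, of k], of "\<bar>t\<bar> ^ k"]
        by (simp add: norm_mult norm_power norm_tilted_char power_divide)
      show "summable (\<lambda>k. M * (\<bar>t\<bar> / \<rho>) ^ k)"
        using t \<rho> by (intro summable_mult summable_geometric) simp
    qed
    then have u: "uniform_limit closed_torus (\<lambda>n \<xi>. \<Sum>k<n. ?h k \<xi>) F sequentially"
      by (rule uniform_limit_cong'[THEN iffD1, rotated 2]) (use sF sums_unique in \<open>auto simp: sums_iff\<close>)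
    have c: "continuous_on closed_torus (\<lambda>\<xi>. \<Sum>k<n. ?h k \<xi>)" for n
      by (intro continuous_intros gc continuous_on_tilted_char)
    obtain I J where IJ: "\<And>n. ((\<lambda>\<xi>. \<Sum>k<n. ?h k \<xi>) has_integral I n) closed_torus" "(F has_integral J) closed_torus" "I \<longlonglongrightarrow> J"
      by (rule uniform_limit_integral_cbox[OF u[unfolded closed_torus_def] c[unfolded closed_torus_def] sequentially_bot, folded closed_torus_def]) blast
    have "I n = (\<Sum>k<n. A k * of_real t ^ k)" for n
    proof -
      have "((\<lambda>\<xi>. \<Sum>k<n. ?h k \<xi>) has_integral (\<Sum>k<n. A k * of_real t ^ k)) closed_torus"
        by (intro has_integral_sum has_integral_mult_left AI) auto
      then show ?thesis using IJ(1) has_integral_unique by blast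
    qed
    then have "I = (\<lambda>n. \<Sum>k<n. A k * of_real t ^ k)" by blast
    then have "(\<lambda>k. A k * of_real t ^ k) sums J" using IJ(3) unfolding sums_def by (simp only:)
    also have "J = ?V * (\<phi> x * tilted_char x (t *\<^sub>R axis j 1) 0)"
    proof -
      define c where "c y = \<phi> y * tilted_char y (t *\<^sub>R axis j 1) 0" for y
      have cm: "cmod (c y) = cmod (\<phi> y)" for y by (simp add: c_def norm_mult norm_tilted_char)
      have w: "weighted 0 c" using l1 by (simp add: weighted_def cm)
      have ea: "tilted_char y (\<xi> + v) 0 = tilted_char y \<xi> 0 * tilted_char y v 0" for y \<xi> v
        unfolding tilted_char_def exp_add[symmetric] by (rule arg_cong[where f=exp]) (simp add: complex_eq_iff inner_add_right)
      have "?f t \<xi> = fourier_tube c \<xi> 0" for \<xi>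
        unfolding fourier_eq_fourier_tube fourier_tube_def c_def ea by (simp only: mult_ac)
      then have "(F has_integral ?V * c x) closed_torus"
        unfolding F_def using has_integral_inversion[OF w, of 0 x] by simp
      then show ?thesis using IJ(2) has_integral_unique by (auto simp: c_def)
    qed
    also have "tilted_char x (t *\<^sub>R axis j 1) 0 = exp (\<i> * of_int (x $ j) * of_real t)"
      unfolding tilted_char_def by (rule arg_cong[where f=exp]) (simp add: complex_eq_iff inner_axis real_vec_def)
    finally show ?thesis by (simp add: mult_ac)
  qed
  have Ale: "cmod (A k * h ^ k) \<le> ?C * (cmod h / \<rho>) ^ k" for k h
    using mult_right_mono[OF Ab, of "cmod h ^ k" k] by (simp add: norm_mult norm_power power_divide)
  have Asum: "summable (\<lambda>k. A k * h ^ k)" if "cmod h < \<rho>" for h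
    by (rule summable_comparison_test'[where g="\<lambda>k. ?C * (cmod h / \<rho>) ^ k"])
       (use Ale that \<rho> in \<open>auto intro!: summable_mult summable_geometric\<close>)
  define H where "H h = (\<Sum>k. A k * h ^ k)" for h
  have Hhol: "H holomorphic_on ball 0 \<rho>"
    by (rule power_series_holomorphic[of 0 \<rho> A]) (use Asum in \<open>auto simp: H_def intro: summable_sums\<close>)
  define K where "K h = ?V * \<phi> x * exp (\<i> * of_int (x $ j) * h)" for h
  have "H h - K h = 0" if "h \<in> ball 0 \<rho>" for h
  proof (rule analytic_continuation[of "\<lambda>h. H h - K h" "ball 0 \<rho>" "complex_of_real ` {0<..<\<rho>}" 0])
    show "(\<lambda>h. H h - K h) holomorphic_on ball 0 \<rho>"
      unfolding K_def by (intro holomorphic_intros Hhol)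
    show "0 islimpt complex_of_real ` {0<..<\<rho>}"
      unfolding islimpt_approachable
    proof (intro allI impI)
      fix e :: real assume "e > 0"
      then show "\<exists>x'\<in>complex_of_real ` {0<..<\<rho>}. x' \<noteq> 0 \<and> dist x' 0 < e"
        using \<rho> by (intro bexI[of _ "complex_of_real (min e \<rho> / 2)"] imageI) (auto simp del: of_real_divide)
    qed
    show "H z - K z = 0" if z: "z \<in> complex_of_real ` {0<..<\<rho>}" for z
    proof -
      obtain t where t: "z = of_real t" "0 < t" "t < \<rho>" using z by auto
      have "(\<lambda>k. A k * z ^ k) sums K z"
        unfolding K_def t(1) by (rule As) (use t in auto)
      then show ?thesis by (simp add: H_def sums_iff)
    qed
  qed (use \<rho> that in auto)
  then have HK: "H h = K h" if "cmod h < \<rho>" for h using that by simp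
  \<comment> \<open>The sign makes \<open>exp (\<i> x\<^sub>j h)\<close> grow, so that boundedness of the power series forces decay of \<open>\<phi> x\<close>.\<close>
  define h where "h = - \<i> * of_real (sgn (real_of_int (x $ j)) * (\<rho> / 2))"
  have hn: "cmod h \<le> \<rho> / 2" using \<rho> by (simp add: h_def norm_mult abs_mult abs_sgn_eq)
  have "\<i> * of_int (x $ j) * h = of_real (\<rho> / 2 * \<bar>real_of_int (x $ j)\<bar>)"
    by (simp add: h_def complex_eq_iff sgn_if)
  then have "cmod (K h) = (2 * pi) ^ CARD('d) * cmod (\<phi> x) * exp (\<rho> / 2 * \<bar>real_of_int (x $ j)\<bar>)"
    by (simp add: K_def norm_mult norm_power exp_of_real del: of_real_mult of_real_divide)
  moreover have "cmod (H h) \<le> ?C * 2"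
  proof -
    have le: "cmod (A k * h ^ k) \<le> ?C * (1/2) ^ k" for k
    proof -
      have "cmod h / \<rho> \<le> 1 / 2" using hn \<rho> by (simp add: field_simps)
      then have "(cmod h / \<rho>) ^ k \<le> (1/2) ^ k" using \<rho> by (intro power_mono) auto
      then show ?thesis using Ale[of k h] M0 by (meson mult_left_mono mult_nonneg_nonneg measure_nonneg order_trans)
    qed
    have s: "(\<lambda>k. ?C * (1/2) ^ k) sums (?C * 2)"
      by (rule sums_mult[OF half])
    have "cmod (H h) \<le> (\<Sum>k. ?C * (1/2) ^ k)" unfolding H_def
      by (rule norm_suminf_le[OF le sums_summable[OF s]])
    also have "\<dots> = ?C * 2" by (rule sums_unique[OF s, symmetric])
    finally show ?thesis .
  qed
  ultimately show ?thesis using HK[of h] hn \<rho> by (simp add: \<rho>_def mult.commute)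
qed

lemma summable_on_exp_abs_int:
  assumes "b > 0"
  shows "(\<lambda>k::int. exp (- (b * \<bar>real_of_int k\<bar>))) summable_on UNIV"
proof -
  have n: "(\<lambda>n::nat. exp (- (b * real n))) summable_on UNIV"
  proof (rule summable_nonneg_imp_summable_on)
    have "summable (\<lambda>n. exp (- b) ^ n)" using assms by (intro summable_geometric) auto
    then show "summable (\<lambda>n::nat. exp (- (b * real n)))" by (simp add: exp_of_nat_mult[symmetric] mult.commute)
  qed auto
  have 1: "(\<lambda>k::int. exp (- (b * \<bar>real_of_int k\<bar>))) summable_on range int"
    using n by (subst summable_on_reindex) (auto simp: o_def)
  have 2: "(\<lambda>k::int. exp (- (b * \<bar>real_of_int k\<bar>))) summable_on range (\<lambda>n. - int n)"
    using n by (subst summable_on_reindex) (auto simp: o_def inj_on_def)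
  have "UNIV = range int \<union> range (\<lambda>n. - int n)"
    by (auto simp: image_iff) (metis int_cases2)
  then show ?thesis using summable_on_union[OF 1 2] by simp
qed

lemma summable_on_exp_abs_int_vec:
  assumes b: "b > 0"
  shows "(\<lambda>x::int^'d. exp (- (b * (\<Sum>i\<in>UNIV. \<bar>real_of_int (x $ i)\<bar>)))) summable_on UNIV"
proof (rule nonneg_bounded_partial_sums_imp_summable_on)
  define Q where "Q = (\<Sum>\<^sub>\<infinity>k::int. exp (- (b * \<bar>real_of_int k\<bar>)))"
  show "\<forall>\<^sub>F X in finite_subsets_at_top UNIV. (\<Sum>x\<in>X. exp (- (b * (\<Sum>i\<in>UNIV. \<bar>real_of_int ((x::int^'d) $ i)\<bar>)))) \<le> Q ^ CARD('d)"
  proof (rule eventually_finite_subsets_at_top_weakI)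
    fix X :: "(int^'d) set" assume X: "finite X"
    define I where "I = (\<Union>x\<in>X. range (\<lambda>i. x $ i))"
    have I: "finite I" using X by (auto simp: I_def)
    let ?P = "PiE (UNIV :: 'd set) (\<lambda>_. I)"
    have "(\<Sum>x\<in>X. exp (- (b * (\<Sum>i\<in>UNIV. \<bar>real_of_int (x $ i)\<bar>)))) \<le>
       (\<Sum>x\<in>vec_lambda ` ?P. exp (- (b * (\<Sum>i\<in>UNIV. \<bar>real_of_int (x $ i)\<bar>))))"
    proof (rule sum_mono2)
      show "finite (vec_lambda ` ?P)" using I by (intro finite_imageI finite_PiE) auto
      show "X \<subseteq> vec_lambda ` ?P"
      proof
        fix x assume "x \<in> X"
        then have "(\<lambda>i. x $ i) \<in> ?P" by (auto simp: I_def)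
        then show "x \<in> vec_lambda ` ?P" by (metis image_eqI vec_lambda_eta)
      qed
    qed auto
    also have "\<dots> = (\<Sum>f\<in>?P. exp (- (b * (\<Sum>i\<in>UNIV. \<bar>real_of_int (f i)\<bar>))))"
      by (subst sum.reindex) (auto simp: inj_on_def vec_lambda_inject)
    also have "\<dots> = (\<Sum>f\<in>?P. \<Prod>i\<in>UNIV. exp (- (b * \<bar>real_of_int (f i)\<bar>)))"
      by (simp add: exp_sum[symmetric] sum_negf sum_distrib_left)
    also have "\<dots> = (\<Prod>i\<in>(UNIV::'d set). \<Sum>k\<in>I. exp (- (b * \<bar>real_of_int k\<bar>)))"
      by (rule prod_sum_PiE[symmetric]) (use I in auto)
    also have "\<dots> \<le> Q ^ CARD('d)"
    proof -
      have "(\<Sum>k\<in>I. exp (- (b * \<bar>real_of_int k\<bar>))) \<le> Q"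
        unfolding Q_def by (rule finite_sum_le_infsum[OF summable_on_exp_abs_int[OF b] I]) auto
      then show ?thesis by (simp add: power_mono sum_nonneg)
    qed
    finally show "(\<Sum>x\<in>X. exp (- (b * (\<Sum>i\<in>UNIV. \<bar>real_of_int (x $ i)\<bar>)))) \<le> Q ^ CARD('d)" .
  qed
qed auto

text \<open>The decay in each coordinate is applied to the largest one, which controls the norm up to the
  dimension. Half of the rate is spent on summability.\<close>
lemma H_class_weighted:
  fixes \<phi> :: "int^'d \<Rightarrow> complex"
  assumes "\<phi> \<in> H_class"
  shows "\<exists>a>0. weighted a \<phi>"
proof -
  have l1: "weighted 0 \<phi>" using assms by (simp add: H_class_def weighted_def)
  obtain r M where r: "r > 0" "\<And>\<xi>. \<xi> \<in> closed_torus \<Longrightarrow> extends_along_axes \<phi> r M \<xi>"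
    using extends_along_axes_uniform[OF assms] by blast
  define C where "C = 2 * (M * measure lborel (closed_torus :: (real^'d) set)) / (2 * pi) ^ CARD('d)"
  have dec: "cmod (\<phi> x) * exp (r / 4 * \<bar>real_of_int (x $ j)\<bar>) \<le> C" for x j
    using coordinate_decay[OF l1 r(1) r(2), of x j] by (simp add: C_def field_simps)
  define d where "d = real CARD('d)"
  have d: "d > 0" by (simp add: d_def)
  define a where "a = r / (8 * d)"
  have a: "a > 0" using r d by (simp add: a_def)
  have le: "cmod (\<phi> x) * exp (a * norm (real_vec x)) \<le> C * exp (- (a * (\<Sum>i\<in>UNIV. \<bar>real_of_int (x $ i)\<bar>)))" for x
  proof -
    define s where "s = (\<Sum>i\<in>UNIV. \<bar>real_of_int (x $ i)\<bar>)"
    obtain j where j: "\<And>i. \<bar>real_of_int (x $ i)\<bar> \<le> \<bar>real_of_int (x $ j)\<bar>"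
      using obtains_MAX[of "UNIV :: 'd set" "\<lambda>i. \<bar>real_of_int (x $ i)\<bar>"]
      by (metis Max_ge UNIV_I UNIV_not_empty finite finite_imageI rangeI)
    have "s \<le> (\<Sum>i\<in>(UNIV::'d set). \<bar>real_of_int (x $ j)\<bar>)" unfolding s_def by (rule sum_mono) (rule j)
    then have s: "s \<le> d * \<bar>real_of_int (x $ j)\<bar>" by (simp add: d_def)
    have "norm (real_vec x) \<le> s"
      using norm_le_l1_cart[of "real_vec x"] by (simp add: s_def real_vec_def)
    then have "a * norm (real_vec x) + a * s \<le> a * s + a * s" using a by simp
    also have "\<dots> \<le> 2 * a * (d * \<bar>real_of_int (x $ j)\<bar>)" using mult_left_mono[OF s, of "2 * a"] a by simp
    also have "\<dots> = r / 4 * \<bar>real_of_int (x $ j)\<bar>" using d by (simp add: a_def)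
    finally have "cmod (\<phi> x) * exp (a * norm (real_vec x) + a * s) \<le> cmod (\<phi> x) * exp (r / 4 * \<bar>real_of_int (x $ j)\<bar>)"
      by (intro mult_left_mono) auto
    also have "\<dots> \<le> C" by (rule dec)
    finally have "cmod (\<phi> x) * exp (a * norm (real_vec x) + a * s) * exp (- (a * s)) \<le> C * exp (- (a * s))"
      by (intro mult_right_mono) auto
    then show ?thesis by (simp add: mult.assoc exp_add[symmetric] s_def)
  qed
  have "weighted a \<phi>" unfolding weighted_def
    by (rule summable_on_comparison_test[OF summable_on_cmult_right[OF summable_on_exp_abs_int_vec[OF a], of C]])
       (use le in auto)
  then show ?thesis using a by blast
qed

section \<open>The dilations of a positive-homogeneous polynomial\<close>

lemma complex_polynomial_continuous:
  assumes "complex_polynomial P"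
  shows "continuous_on S P"
proof -
  obtain B a where "finite B" and P: "\<And>\<xi>. P \<xi> = (\<Sum>\<beta>\<in>B. a \<beta> * (\<Prod>i\<in>UNIV. complex_of_real (\<xi> $ i) ^ (\<beta> $ i)))"
    using assms unfolding complex_polynomial_def by blast
  have "P = (\<lambda>\<xi>. \<Sum>\<beta>\<in>B. a \<beta> * (\<Prod>i\<in>UNIV. complex_of_real (\<xi> $ i) ^ (\<beta> $ i)))"
    using P by blast
  then show ?thesis by (simp only:) (intro continuous_intros)
qed

text \<open>A nonnegative polynomial is at most \<open>Re (P \<xi>) + Re (P (- \<xi>))\<close>, and in this sum the
  linear terms cancel.\<close>
lemma nonneg_polynomial_quadratic:
  fixes P :: "real^'d \<Rightarrow> complex"
  assumes "complex_polynomial P" and nn: "\<And>\<xi>. Re (P \<xi>) \<ge> 0" and z: "Re (P 0) = 0"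
  shows "\<exists>C. \<forall>\<xi>. norm \<xi> \<le> 1 \<longrightarrow> Re (P \<xi>) \<le> C * (norm \<xi>)\<^sup>2"
proof -
  obtain B :: "(nat^'d) set" and a where B: "finite B" and P: "\<And>\<xi>. P \<xi> = (\<Sum>\<beta>\<in>B. a \<beta> * (\<Prod>i\<in>UNIV. complex_of_real (\<xi> $ i) ^ (\<beta> $ i)))"
    using assms(1) unfolding complex_polynomial_def by blast
  define mon where "mon \<beta> \<xi> = (\<Prod>i\<in>UNIV. (\<xi> $ i) ^ (\<beta> $ i))" for \<beta> :: "nat^'d" and \<xi> :: "real^'d"
  have RP: "Re (P \<xi>) = (\<Sum>\<beta>\<in>B. Re (a \<beta>) * mon \<beta> \<xi>)" for \<xi>
  proof -
    have "(\<Prod>i\<in>UNIV. complex_of_real (\<xi> $ i) ^ (\<beta> $ i)) = complex_of_real (mon \<beta> \<xi>)" for \<beta>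
      by (simp add: mon_def)
    then show ?thesis by (simp add: P)
  qed
  have mon_le: "\<bar>mon \<beta> \<xi>\<bar> \<le> norm \<xi> ^ (\<Sum>i\<in>UNIV. \<beta> $ i)" for \<beta> \<xi>
  proof -
    have "\<bar>mon \<beta> \<xi>\<bar> = (\<Prod>i\<in>UNIV. \<bar>\<xi> $ i\<bar> ^ (\<beta> $ i))" by (simp add: mon_def abs_prod power_abs)
    also have "\<dots> \<le> (\<Prod>i\<in>UNIV. norm \<xi> ^ (\<beta> $ i))"
      by (intro prod_mono conjI power_mono component_le_norm_cart) auto
    finally show ?thesis by (simp add: power_sum)
  qed
  have mon_minus: "mon \<beta> (- \<xi>) = (- 1) ^ (\<Sum>i\<in>UNIV. \<beta> $ i) * mon \<beta> \<xi>" for \<beta> \<xi>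
  proof -
    have "mon \<beta> (- \<xi>) = (\<Prod>i\<in>UNIV. (- 1) ^ (\<beta> $ i) * (\<xi> $ i) ^ (\<beta> $ i))"
      unfolding mon_def by (intro prod.cong refl) (simp add: power_mult_distrib[symmetric])
    then show ?thesis by (simp add: prod.distrib mon_def power_sum)
  qed
  have key: "\<bar>mon \<beta> \<xi> + mon \<beta> (- \<xi>) - 2 * mon \<beta> 0\<bar> \<le> 2 * (norm \<xi>)\<^sup>2" if n: "norm \<xi> \<le> 1" for \<beta> \<xi>
  proof -
    define s where "s = (\<Sum>i\<in>UNIV. \<beta> $ i)"
    consider "s = 0" | "s = 1" | "s \<ge> 2" by linarith
    then show ?thesis
    proof cases
      case 1
      then have "\<beta> $ i = 0" for i unfolding s_def by simp
      then show ?thesis by (simp add: mon_def)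
    next
      case 2
      have "mon \<beta> 0 = 0" using mon_le[of \<beta> 0] 2 by (simp add: s_def)
      then show ?thesis using mon_minus[of \<beta> \<xi>] 2 by (simp add: s_def)
    next
      case 3
      have "mon \<beta> 0 = 0" using mon_le[of \<beta> 0] 3 by (simp add: s_def zero_power)
      moreover have "norm \<xi> ^ s \<le> (norm \<xi>)\<^sup>2" using 3 n by (intro power_decreasing) auto
      ultimately show ?thesis using mon_le[of \<beta> \<xi>] mon_le[of \<beta> "- \<xi>"] by (simp add: s_def)
    qed
  qed
  define C where "C = 2 * (\<Sum>\<beta>\<in>B. \<bar>Re (a \<beta>)\<bar>)"
  have "Re (P \<xi>) \<le> C * (norm \<xi>)\<^sup>2" if n: "norm \<xi> \<le> 1" for \<xi>
  proof -
    have "Re (P \<xi>) \<le> Re (P \<xi>) + Re (P (- \<xi>)) - 2 * Re (P 0)" using nn[of "- \<xi>"] z by simp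
    also have "\<dots> = (\<Sum>\<beta>\<in>B. Re (a \<beta>) * (mon \<beta> \<xi> + mon \<beta> (- \<xi>) - 2 * mon \<beta> 0))"
      by (simp add: RP sum.distrib sum_subtractf sum_distrib_left algebra_simps)
    also have "\<dots> \<le> (\<Sum>\<beta>\<in>B. \<bar>Re (a \<beta>)\<bar> * (2 * (norm \<xi>)\<^sup>2))"
    proof (rule sum_mono)
      fix \<beta>
      have "Re (a \<beta>) * (mon \<beta> \<xi> + mon \<beta> (- \<xi>) - 2 * mon \<beta> 0) \<le> \<bar>Re (a \<beta>) * (mon \<beta> \<xi> + mon \<beta> (- \<xi>) - 2 * mon \<beta> 0)\<bar>" by simp
      also have "\<dots> \<le> \<bar>Re (a \<beta>)\<bar> * (2 * (norm \<xi>)\<^sup>2)"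
        unfolding abs_mult by (intro mult_left_mono key n) auto
      finally show "Re (a \<beta>) * (mon \<beta> \<xi> + mon \<beta> (- \<xi>) - 2 * mon \<beta> 0) \<le> \<bar>Re (a \<beta>)\<bar> * (2 * (norm \<xi>)\<^sup>2)" .
    qed
    also have "\<dots> = C * (norm \<xi>)\<^sup>2" by (simp add: C_def sum_distrib_left sum_distrib_right mult_ac)
    finally show ?thesis .
  qed
  then show ?thesis by blast
qed

lemma Exp_homogeneous:
  "E \<in> Exp P \<Longrightarrow> t > 0 \<Longrightarrow> P (matrix_rpow t E *v \<xi>) = complex_of_real t * P \<xi>"
  by (simp add: Exp_def)

lemma pos_hom_flow:
  fixes P :: "real^'d \<Rightarrow> complex"
  assumes P: "pos_hom_polynomial P" and E: "E \<in> Exp P"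
  shows "homogeneous_flow (\<lambda>t. matrix_rpow t E) (\<lambda>\<xi>. Re (P \<xi>)) (trace E)"
proof
  note hom = Exp_homogeneous[OF E]
  have poly: "complex_polynomial P" and pos: "\<And>\<xi>. Re (P \<xi>) \<ge> 0" "\<And>\<xi>. Re (P \<xi>) = 0 \<Longrightarrow> \<xi> = 0"
    using P by (auto simp: pos_hom_polynomial_def)
  show "Re (P (matrix_rpow t E *v \<xi>)) = t * Re (P \<xi>)" if "t > 0" for t \<xi>
    using hom[OF that] by simp
  show "continuous_on UNIV (\<lambda>\<xi>. Re (P \<xi>))"
    by (intro continuous_intros complex_polynomial_continuous poly)
  show "Re (P \<xi>) > 0" if "\<xi> \<noteq> 0" for \<xi>
    using pos[of \<xi>] that by (metis order_le_less)
  have "Re (P 0) = 0" using hom[of 2 0] by simp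
  then show "\<exists>C. \<forall>\<xi>. norm \<xi> \<le> 1 \<longrightarrow> Re (P \<xi>) \<le> C * (norm \<xi>)\<^sup>2"
    by (intro nonneg_polynomial_quadratic poly pos)
qed (simp_all add: matrix_rpow_mult matrix_rpow_1 continuous_on_matrix_rpow det_matrix_rpow)

section \<open>Recovering a complex value from real ones\<close>

text \<open>Induction on the nodes: for a new node \<open>b\<close> write \<open>p x = p b + (x - b) * q x\<close> and interpolate
  \<open>q\<close>, whose degree is smaller by one.\<close>
lemma interpolation_weights_poly:
  fixes A :: "'a::field set"
  assumes "finite A"
  shows "\<exists>w. \<forall>p. p = 0 \<or> degree p < card A \<longrightarrow> poly p z = (\<Sum>a\<in>A. w a * poly p a)"
  using assms
proof (induction A)
  case (insert b A)
  then obtain w where w: "\<And>p. p = 0 \<or> degree p < card A \<Longrightarrow> poly p z = (\<Sum>a\<in>A. w a * poly p a)" by blast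
  define w' where "w' a = (if a = b then 1 - (\<Sum>a\<in>A. (z - b) * w a / (a - b)) else (z - b) * w a / (a - b))" for a
  have "poly p z = (\<Sum>a\<in>insert b A. w' a * poly p a)" if p: "p = 0 \<or> degree p < card (insert b A)" for p
  proof -
    define q where "q = synthetic_div p b"
    have pq: "poly p x = poly p b + (x - b) * poly q x" for x
    proof -
      have "poly ([:- b, 1:] * q + [:poly p b:]) x = poly p x"
        unfolding q_def synthetic_div_correct' ..
      then show ?thesis by (simp add: algebra_simps)
    qed
    have "q = 0 \<or> degree q < card A"
    proof (cases "degree p = 0")
      case True
      then show ?thesis by (simp add: q_def synthetic_div_eq_0_iff)
    next
      case False
      then show ?thesis using p insert(1,2) by (auto simp: q_def degree_synthetic_div)
    qed
    then have qz: "poly q z = (\<Sum>a\<in>A. w a * poly q a)" by (rule w)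
    have qa: "poly q a = (poly p a - poly p b) / (a - b)" if "a \<in> A" for a
    proof -
      have "a \<noteq> b" using that insert(2) by auto
      then show ?thesis using pq[of a] by (simp add: field_simps)
    qed
    have "poly p z = poly p b + (z - b) * (\<Sum>a\<in>A. w a * ((poly p a - poly p b) / (a - b)))"
      using pq[of z] qz by (simp add: qa)
    also have "(z - b) * (\<Sum>a\<in>A. w a * ((poly p a - poly p b) / (a - b)))
       = (\<Sum>a\<in>A. (z - b) * w a / (a - b) * poly p a) - (\<Sum>a\<in>A. (z - b) * w a / (a - b)) * poly p b"
      by (simp add: sum_distrib_left sum_distrib_right sum_subtractf[symmetric] diff_divide_distrib algebra_simps)
    also have "(\<Sum>a\<in>A. (z - b) * w a / (a - b) * poly p a) = (\<Sum>a\<in>A. w' a * poly p a)"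
      using insert(2) by (intro sum.cong) (auto simp: w'_def)
    finally show ?thesis using insert(1,2) by (simp add: w'_def algebra_simps)
  qed
  then show ?case by blast
qed auto

lemma interpolation_weights:
  "\<exists>w::nat \<Rightarrow> complex. \<forall>k\<le>N. (\<Sum>j\<le>N. w j * of_nat j ^ k) = z ^ k"
proof -
  let ?A = "of_nat ` {..N} :: complex set"
  have "\<exists>w. \<forall>p. p = 0 \<or> degree p < card ?A \<longrightarrow> poly p z = (\<Sum>a\<in>?A. w a * poly p a)"
    by (rule interpolation_weights_poly) simp
  then obtain w where w: "\<forall>p. p = 0 \<or> degree p < card ?A \<longrightarrow> poly p z = (\<Sum>a\<in>?A. w a * poly p a)" ..
  have inj: "inj_on (of_nat :: nat \<Rightarrow> complex) {..N}" by (simp add: inj_on_def)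
  have "(\<Sum>j\<le>N. w (of_nat j) * of_nat j ^ k) = z ^ k" if "k \<le> N" for k
    using w[rule_format, of "monom 1 k"] that by (simp add: card_image[OF inj] degree_monom_eq poly_monom sum.reindex[OF inj])
  then show ?thesis by (intro exI[of _ "\<lambda>j. w (of_nat j)"]) auto
qed

text \<open>The error functional annihilates the powers up to \<open>N\<close> and grows at most geometrically on the
  others, while Cauchy's inequality bounds the Taylor coefficients of \<open>u\<close>.\<close>
lemma interpolation_error:
  fixes w :: "nat \<Rightarrow> complex"
  assumes w: "\<And>k. k \<le> N \<Longrightarrow> (\<Sum>j\<le>N. w j * of_nat j ^ k) = \<i> ^ k" and N: "N \<ge> 1"
  shows "\<exists>C>0. \<forall>u \<rho> B. u holomorphic_on ball 0 \<rho> \<longrightarrow> (\<forall>s\<in>ball 0 \<rho>. cmod (u s) \<le> B) \<longrightarrow> \<rho> \<ge> 4 * real N \<longrightarrow>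
     cmod (u \<i> - (\<Sum>j\<le>N. w j * u (of_nat j))) \<le> C * B * (1 / \<rho>) ^ Suc N"
proof -
  define S where "S = 1 + (\<Sum>j\<le>N. cmod (w j))"
  have S: "S > 0" unfolding S_def by (intro add_pos_nonneg sum_nonneg) auto
  define C where "C = S * (2 * real N) ^ Suc N * 2"
  have C: "C > 0" using S N by (simp add: C_def)
  have "cmod (u \<i> - (\<Sum>j\<le>N. w j * u (of_nat j))) \<le> C * B * (1 / \<rho>) ^ Suc N"
    if u: "u holomorphic_on ball 0 \<rho>" and B: "\<And>s. s \<in> ball 0 \<rho> \<Longrightarrow> cmod (u s) \<le> B" and \<rho>: "\<rho> \<ge> 4 * real N" for u \<rho> B
  proof -
    define r where "r = \<rho> / 2"
    have N1: "real N \<ge> 1" using N by simp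
    have r: "r \<ge> 2 * real N" "r > 0" "r < \<rho>" "\<rho> > 0" using \<rho> N1 by (auto simp: r_def)
    have B0: "B \<ge> 0" using B[of 0] r by (simp add: order_trans[OF norm_ge_zero])
    define a where "a k = (deriv ^^ k) u 0 / fact k" for k
    have ab: "cmod (a k) \<le> B / r ^ k" for k
    proof -
      have "cmod ((deriv ^^ k) u 0) \<le> fact k * B / r ^ k"
      proof (rule Cauchy_inequality)
        show "u holomorphic_on ball 0 r" using u by (rule holomorphic_on_subset) (use r in auto)
        show "continuous_on (cball 0 r) u"
          by (rule continuous_on_subset[OF holomorphic_on_imp_continuous_on[OF u]]) (use r in auto)
        show "cmod (u z) \<le> B" if "cmod (0 - z) = r" for z using B[of z] that r by simp
      qed (use r in auto)
      then show ?thesis by (simp add: a_def norm_divide field_simps)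
    qed
    have us: "(\<lambda>k. a k * s ^ k) sums u s" if "cmod s < \<rho>" for s
      using holomorphic_power_series[OF u, of s] that by (simp add: a_def)
    define e where "e k = \<i> ^ k - (\<Sum>j\<le>N. w j * of_nat j ^ k)" for k
    have e0: "e k = 0" if "k \<le> N" for k using w[OF that] by (simp add: e_def)
    have eb: "cmod (e k) \<le> S * real N ^ k" for k
    proof -
      have "cmod (e k) \<le> cmod (\<i> ^ k) + (\<Sum>j\<le>N. cmod (w j * of_nat j ^ k))"
        unfolding e_def by (rule order_trans[OF norm_triangle_ineq4]) (intro add_left_mono norm_sum)
      also have "\<dots> \<le> real N ^ k + (\<Sum>j\<le>N. cmod (w j) * real N ^ k)"
        using N1 by (intro add_mono sum_mono) (auto simp: norm_power norm_mult intro!: mult_left_mono power_mono)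
      also have "\<dots> = S * real N ^ k" by (simp add: S_def sum_distrib_right distrib_right)
      finally show ?thesis .
    qed
    have nj: "cmod (of_nat j) < \<rho>" if "j \<le> N" for j
    proof -
      have "real j \<le> real N" using that by simp
      then show ?thesis using \<rho> N1 by simp
    qed
    have "(\<lambda>k. a k * \<i> ^ k - (\<Sum>j\<le>N. w j * (a k * of_nat j ^ k))) sums (u \<i> - (\<Sum>j\<le>N. w j * u (of_nat j)))"
      by (intro sums_diff sums_sum sums_mult us nj) (use \<rho> N1 in auto)
    also have "(\<lambda>k. a k * \<i> ^ k - (\<Sum>j\<le>N. w j * (a k * of_nat j ^ k))) = (\<lambda>k. a k * e k)"
      by (simp add: e_def fun_eq_iff right_diff_distrib sum_distrib_left mult_ac)
    finally have s: "(\<lambda>k. a (k + Suc N) * e (k + Suc N)) sums (u \<i> - (\<Sum>j\<le>N. w j * u (of_nat j)) - (\<Sum>k<Suc N. a k * e k))"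
      by (rule sums_split_initial_segment)
    moreover have "(\<Sum>k<Suc N. a k * e k) = 0" by (rule sum.neutral) (auto simp: e0)
    ultimately have s: "(\<lambda>k. a (k + Suc N) * e (k + Suc N)) sums (u \<i> - (\<Sum>j\<le>N. w j * u (of_nat j)))" by simp
    have le: "cmod (a (k + Suc N) * e (k + Suc N)) \<le> (B * S * (real N / r) ^ Suc N) * (1/2) ^ k" for k
    proof -
      have "cmod (a (k + Suc N) * e (k + Suc N)) \<le> B / r ^ (k + Suc N) * (S * real N ^ (k + Suc N))"
        unfolding norm_mult using B0 r by (intro mult_mono ab eb) auto
      also have "\<dots> = (B * S) * ((real N / r) ^ (k + Suc N))" by (simp only: power_divide times_divide_eq_left times_divide_eq_right mult_ac)
      also have "\<dots> = (B * S * (real N / r) ^ Suc N) * (real N / r) ^ k" by (simp only: power_add mult_ac)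
      also have "\<dots> \<le> (B * S * (real N / r) ^ Suc N) * (1/2) ^ k"
        using r B0 S by (intro mult_left_mono power_mono) (auto simp: field_simps)
      finally show ?thesis .
    qed
    have half: "(\<lambda>i. (1/2::real) ^ i) sums 2" using geometric_sums[of "1/2::real"] by simp
    have gs: "(\<lambda>k. (B * S * (real N / r) ^ Suc N) * (1/2) ^ k) sums ((B * S * (real N / r) ^ Suc N) * 2)"
      by (rule sums_mult[OF half])
    have "cmod (u \<i> - (\<Sum>j\<le>N. w j * u (of_nat j))) \<le> (\<Sum>k. (B * S * (real N / r) ^ Suc N) * (1/2) ^ k)"
      unfolding sums_unique[OF s] by (rule norm_suminf_le[OF le sums_summable[OF gs]])
    also have "\<dots> = (B * S * (real N / r) ^ Suc N) * 2" by (rule sums_unique[OF gs, symmetric])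
    also have "real N / r = 2 * real N * (1 / \<rho>)" by (simp add: r_def)
    also have "(B * S * (2 * real N * (1 / \<rho>)) ^ Suc N) * 2 = C * B * (1 / \<rho>) ^ Suc N"
      unfolding C_def power_mult_distrib by (simp only: mult_ac)
    finally show ?thesis .
  qed
  then show ?thesis using C by blast
qed

section \<open>The transform near a peak\<close>

text \<open>Restrict the logarithm of the transform to the line \<open>s \<mapsto> \<xi> + s \<nu>\<close> and interpolate its value at
  \<open>s = \<i>\<close> from the real nodes \<open>0, \<dots>, N\<close>. The drift term is linear, so it is reproduced exactly and
  gives \<open>- \<alpha> \<bullet> \<nu>\<close>. The polynomial gives \<open>Q\<close>, a continuous function homogeneous under the dilations
  with \<open>Q \<xi> 0 = P \<xi>\<close>, to which \<open>homogeneous_lower\<close> applies. The error term of the expansion is at most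
  a small multiple of the values of \<open>R\<close> at the nodes, which \<open>homogeneous_upper\<close> compares with
  \<open>R \<xi> + R \<nu>\<close>. The interpolation error has order \<open>N + 1\<close> in \<open>norm \<xi> + norm \<nu>\<close>, one more than the
  power dominated by \<open>R\<close> in \<open>power_norm_le_R\<close>.\<close>
lemma local_estimate:
  fixes \<phi> :: "int^'d \<Rightarrow> complex"
  assumes a: "a > 0" and wt: "weighted a \<phi>" and unit: "cmod (fourier \<phi> \<xi>0) = 1"
    and ex: "pos_hom_expansion \<phi> \<xi>0 \<alpha> P"
  shows "\<exists>\<delta>>0. \<exists>C>0. \<forall>\<xi> \<nu>. norm \<xi> \<le> \<delta> \<longrightarrow> norm \<nu> \<le> \<delta> \<longrightarrow>
    cmod (fourier_tube \<phi> (\<xi>0 + \<xi>) \<nu>) \<le> exp (- (\<alpha> \<bullet> \<nu>) - Re (P \<xi>) / 4 + C * Re (P \<nu>))"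
proof -
  have ph: "pos_hom_polynomial P" using ex by (simp add: pos_hom_expansion_def)
  then obtain E where E: "E \<in> Exp P" by (auto simp: pos_hom_polynomial_def)
  define R where "R \<xi> = Re (P \<xi>)" for \<xi>
  interpret homogeneous_flow "\<lambda>t. matrix_rpow t E" R "trace E"
    unfolding R_def[abs_def] by (rule pos_hom_flow[OF ph E])
  have Pc: "continuous_on UNIV P"
    using ph by (simp add: pos_hom_polynomial_def complex_polynomial_continuous)
  define c0 where "c0 = fourier \<phi> \<xi>0"
  have c0: "cmod c0 = 1" "c0 \<noteq> 0" using unit by (auto simp: c0_def)
  define T where "T \<xi> \<nu> = fourier_tube \<phi> (\<xi>0 + \<xi>) \<nu> / c0" for \<xi> \<nu>
  obtain K where K: "K > 0" "\<And>\<xi> \<xi>' \<nu> \<nu>'. norm \<nu> \<le> a / 2 \<Longrightarrow> norm \<nu>' \<le> a / 2 \<Longrightarrow>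
    cmod (fourier_tube \<phi> \<xi> \<nu> - fourier_tube \<phi> \<xi>' \<nu>') \<le> K * (norm (\<xi> - \<xi>') + norm (\<nu> - \<nu>'))"
    using fourier_tube_lipschitz[OF a wt] by blast
  define r0 where "r0 = min (a / 2) (1 / (4 * K))"
  have r0: "r0 > 0" "r0 \<le> a / 2" "K * r0 \<le> 1 / 4" using a K by (auto simp: r0_def min_def field_simps)
  have T1: "cmod (T \<xi> \<nu> - 1) \<le> 1 / 2" if "norm \<xi> \<le> r0" "norm \<nu> \<le> r0" for \<xi> \<nu>
  proof -
    have "T \<xi> \<nu> - 1 = (fourier_tube \<phi> (\<xi>0 + \<xi>) \<nu> - fourier_tube \<phi> \<xi>0 0) / c0"
      using c0 by (simp add: T_def c0_def fourier_eq_fourier_tube diff_divide_distrib)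
    then have "cmod (T \<xi> \<nu> - 1) = cmod (fourier_tube \<phi> (\<xi>0 + \<xi>) \<nu> - fourier_tube \<phi> \<xi>0 0)"
      by (simp add: norm_divide c0)
    also have "\<dots> \<le> K * (norm \<xi> + norm \<nu>)"
      using K(2)[of \<nu> 0 "\<xi>0 + \<xi>" \<xi>0] that r0 a by simp
    also have "\<dots> \<le> K * (r0 + r0)" using that K(1) by (intro mult_left_mono add_mono) auto
    finally show ?thesis using r0 by (simp add: algebra_simps)
  qed
  have nonpos: "v \<notin> \<real>\<^sub>\<le>\<^sub>0" if "v \<in> cball 1 (1/2)" for v :: complex
  proof -
    have "\<bar>Re (v - 1)\<bar> \<le> 1 / 2"
      using that abs_Re_le_cmod[of "v - 1"] by (simp add: dist_norm norm_minus_commute)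
    then have "\<bar>Re v - 1\<bar> \<le> 1 / 2" by simp
    then have "Re v > 0" using abs_ge_minus_self[of "Re v - 1"] by linarith
    then show ?thesis by (auto simp: complex_nonpos_Reals_iff)
  qed
  have "bounded (Ln ` cball 1 (1/2))"
    by (intro compact_imp_bounded compact_continuous_image continuous_on_Ln) (use nonpos in auto)
  then obtain B where B: "B > 0" "\<And>v. v \<in> cball 1 (1/2) \<Longrightarrow> cmod (Ln v) \<le> B"
    unfolding bounded_pos by auto
  obtain N C1 where N: "N \<ge> 1" "C1 > 0" "\<And>\<xi>. R \<xi> \<le> 1 \<Longrightarrow> norm \<xi> ^ N \<le> C1 * R \<xi>"
    using power_norm_le_R by blast
  have N1: "real N \<ge> 1" using N(1) by simp
  obtain w :: "nat \<Rightarrow> complex" where w: "\<And>k. k \<le> N \<Longrightarrow> (\<Sum>j\<le>N. w j * of_nat j ^ k) = \<i> ^ k"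
    using interpolation_weights[of N \<i>] by blast
  have w0: "(\<Sum>j\<le>N. w j) = 1" using w[of 0] by simp
  have w1: "(\<Sum>j\<le>N. w j * of_nat j) = \<i>" using w[of 1] N(1) by simp
  obtain Ce where Ce: "Ce > 0" "\<And>u \<rho> B. u holomorphic_on ball 0 \<rho> \<Longrightarrow> (\<forall>s\<in>ball 0 \<rho>. cmod (u s) \<le> B) \<Longrightarrow> \<rho> \<ge> 4 * real N \<Longrightarrow>
     cmod (u \<i> - (\<Sum>j\<le>N. w j * u (of_nat j))) \<le> Ce * B * (1 / \<rho>) ^ Suc N"
    using interpolation_error[OF w N(1)] by blast
  define S where "S = (\<Sum>j\<le>N. cmod (w j)) + 1"
  have S: "S > 0" unfolding S_def by (intro add_nonneg_pos sum_nonneg) auto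
  have lin: "matrix_rpow t E *v \<xi> + real j *\<^sub>R (matrix_rpow t E *v \<nu>) = matrix_rpow t E *v (\<xi> + real j *\<^sub>R \<nu>)" for t \<xi> \<nu> j
    by (simp add: matrix_vector_right_distrib matrix_vector_mult_scaleR)
  have cont_shift: "continuous_on UNIV (\<lambda>p::(real^'d) \<times> (real^'d). P (fst p + real j *\<^sub>R snd p))" for j
    by (rule continuous_on_compose2[OF Pc]) (auto intro!: continuous_intros)
  have "\<exists>C>0. \<forall>\<xi> \<nu>. (\<Sum>j\<le>N. R (\<xi> + real j *\<^sub>R \<nu>)) \<le> C * (R \<xi> + R \<nu>)"
  proof (rule homogeneous_upper)
    show "continuous_on UNIV (\<lambda>p. \<Sum>j\<le>N. R (fst p + real j *\<^sub>R snd p))"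
      unfolding R_def by (intro continuous_intros cont_shift)
    show "(\<Sum>j\<le>N. R (matrix_rpow t E *v \<xi> + real j *\<^sub>R (matrix_rpow t E *v \<nu>))) = t * (\<Sum>j\<le>N. R (\<xi> + real j *\<^sub>R \<nu>))"
      if "t > 0" for t \<xi> \<nu>
      unfolding lin R_hom[OF that] sum_distrib_left ..
  qed
  then obtain C2 where C2: "C2 > 0" "\<And>\<xi> \<nu>. (\<Sum>j\<le>N. R (\<xi> + real j *\<^sub>R \<nu>)) \<le> C2 * (R \<xi> + R \<nu>)" by blast
  have C2': "R (\<xi> + real j *\<^sub>R \<nu>) \<le> C2 * (R \<xi> + R \<nu>)" if "j \<le> N" for j \<xi> \<nu>
    by (rule order_trans[OF member_le_sum C2(2)]) (use that R_nonneg in auto)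
  define Q where "Q \<xi> \<nu> = (\<Sum>j\<le>N. w j * P (\<xi> + real j *\<^sub>R \<nu>))" for \<xi> \<nu>
  have "\<exists>C>0. \<forall>\<xi> \<nu>. Re (Q \<xi> \<nu>) \<ge> R \<xi> / 2 - C * R \<nu>"
  proof (rule homogeneous_lower)
    show "continuous_on UNIV (\<lambda>p. Re (Q (fst p) (snd p)))"
      unfolding Q_def by (intro continuous_intros cont_shift)
    show "Re (Q (matrix_rpow t E *v \<xi>) (matrix_rpow t E *v \<nu>)) = t * Re (Q \<xi> \<nu>)" if "t > 0" for t \<xi> \<nu>
    proof -
      have "Q (matrix_rpow t E *v \<xi>) (matrix_rpow t E *v \<nu>) = of_real t * Q \<xi> \<nu>"
        unfolding Q_def lin Exp_homogeneous[OF E that] sum_distrib_left by (simp only: mult_ac)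
      then show ?thesis by simp
    qed
    show "Re (Q \<xi> 0) = R \<xi>" for \<xi>
      by (simp add: Q_def R_def sum_distrib_right[symmetric] w0)
  qed
  then obtain C3 where C3: "C3 > 0" "\<And>\<xi> \<nu>. Re (Q \<xi> \<nu>) \<ge> R \<xi> / 2 - C3 * R \<nu>" by blast
  obtain \<Upsilon> where \<Upsilon>: "\<forall>\<^sub>F \<xi> in nhds 0. Gamma_at \<phi> \<xi>0 \<xi> = \<i> * complex_of_real (\<alpha> \<bullet> \<xi>) - P \<xi> + \<Upsilon> \<xi>"
    "\<Upsilon> \<in> o[at 0](\<lambda>\<xi>. complex_of_real (Re (P \<xi>)))"
    using ex unfolding pos_hom_expansion_def by blast
  \<comment> \<open>Makes the interpolated error term at most \<open>(R \<xi> + R \<nu>) / 8\<close>.\<close>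
  define \<epsilon> where "\<epsilon> = 1 / (8 * S * C2)"
  have \<epsilon>: "\<epsilon> > 0" using S C2 by (simp add: \<epsilon>_def)
  have "\<forall>\<^sub>F \<xi> in at 0. cmod (\<Upsilon> \<xi>) \<le> \<epsilon> * R \<xi>"
    using landau_o.smallD[OF \<Upsilon>(2) \<epsilon>] R_nonneg by (simp add: R_def)
  then obtain d0 where d0: "d0 > 0" "\<And>\<xi>. \<xi> \<noteq> 0 \<Longrightarrow> dist \<xi> 0 < d0 \<Longrightarrow> cmod (\<Upsilon> \<xi>) \<le> \<epsilon> * R \<xi>"
    unfolding eventually_at by blast
  obtain d1 where d1: "d1 > 0" "\<And>\<xi>. dist \<xi> 0 < d1 \<Longrightarrow> Gamma_at \<phi> \<xi>0 \<xi> = \<i> * complex_of_real (\<alpha> \<bullet> \<xi>) - P \<xi> + \<Upsilon> \<xi>"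
    using \<Upsilon>(1) unfolding eventually_nhds_metric by blast
  have P0: "P 0 = 0" using Exp_homogeneous[OF E, of 2 0] by simp
  have "\<Upsilon> 0 = 0"
    using d1(2)[of 0] d1(1) c0 P0 by (simp add: Gamma_at_def c0_def)
  then have Ub: "cmod (\<Upsilon> \<xi>) \<le> \<epsilon> * R \<xi>" if "norm \<xi> < d0" for \<xi>
    using d0(2)[of \<xi>] that by (cases "\<xi> = 0") (auto simp: R_0)
  have "isCont R 0" using R_cont by (simp add: continuous_on_eq_continuous_at)
  then obtain d2 where d2: "d2 > 0" "\<And>v. dist v 0 < d2 \<Longrightarrow> dist (R v) (R 0) < 1"
    unfolding continuous_at_eps_delta using zero_less_one by metis
  have R1: "R v \<le> 1" if "norm v < d2" for v using d2(2)[of v] that R_0 by (simp add: dist_norm)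
  define C6 where "C6 = Ce * B * (2 / r0) ^ Suc N * (2 ^ N * C1)"
  have C6: "C6 > 0" using Ce B r0 N by (simp add: C6_def)
  \<comment> \<open>Smallness ensures in turn: the radius of the disc is at least \<open>4 * N\<close>; the interpolation error is at
    most \<open>(R \<xi> + R \<nu>) / 8\<close>; all nodes lie where the expansion and its error bound are valid.\<close>
  define \<tau>0 where "\<tau>0 = min (min (r0 / (8 * real N)) (1 / (8 * C6))) (min (min d0 d1) d2 / (2 * (real N + 1)))"
  have \<tau>0: "\<tau>0 > 0" using r0 N1 C6 d0 d1 d2 by (simp add: \<tau>0_def)
  define \<delta> where "\<delta> = \<tau>0 / 2"
  have est: "cmod (fourier_tube \<phi> (\<xi>0 + \<xi>) \<nu>) \<le> exp (- (\<alpha> \<bullet> \<nu>) - Re (P \<xi>) / 4 + (C3 + 1 / 4) * Re (P \<nu>))"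
    if n: "norm \<xi> \<le> \<delta>" "norm \<nu> \<le> \<delta>" for \<xi> \<nu>
  proof (cases "\<xi> = 0 \<and> \<nu> = 0")
    case True
    then show ?thesis using unit P0 by (simp add: fourier_eq_fourier_tube)
  next
    case False
    define \<tau> where "\<tau> = norm \<xi> + norm \<nu>"
    have \<tau>: "\<tau> > 0" using False by (auto simp: \<tau>_def add_pos_nonneg add_nonneg_pos)
    have \<tau>le: "\<tau> \<le> \<tau>0" using n by (simp add: \<tau>_def \<delta>_def)
    have \<tau>1: "\<tau> \<le> r0 / (8 * real N)" "\<tau> \<le> 1 / (8 * C6)" and \<tau>2: "\<tau> \<le> min (min d0 d1) d2 / (2 * (real N + 1))"
      using \<tau>le by (auto simp: \<tau>0_def)
    have \<tau>r: "\<tau> * (8 * real N) \<le> r0" using \<tau>1(1) N1 by (simp add: field_simps)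
    have \<tau>8: "8 * \<tau> \<le> r0"
    proof -
      have "\<tau> * 8 \<le> \<tau> * (8 * real N)" using \<tau> N1 by (intro mult_left_mono) auto
      then show ?thesis using \<tau>r by linarith
    qed
    have \<tau>d: "(real N + 1) * \<tau> < d0" "(real N + 1) * \<tau> < d1" "(real N + 1) * \<tau> < d2"
    proof -
      have "2 * ((real N + 1) * \<tau>) \<le> min (min d0 d1) d2" using \<tau>2 by (simp add: field_simps)
      moreover have "(real N + 1) * \<tau> > 0" using \<tau> by simp
      ultimately show "(real N + 1) * \<tau> < d0" "(real N + 1) * \<tau> < d1" "(real N + 1) * \<tau> < d2" by linarith+
    qed
    \<comment> \<open>The largest disc, up to constants, on which the complex line stays within distance \<open>r0\<close>.\<close>
    define \<rho> where "\<rho> = r0 / (2 * \<tau>)"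
    have \<rho>: "\<rho> > 0" "\<rho> * \<tau> = r0 / 2" using r0 \<tau> by (simp_all add: \<rho>_def)
    have \<rho>N: "\<rho> \<ge> 4 * real N" using \<tau>r \<tau> by (simp add: \<rho>_def field_simps)
    have inball: "norm (\<xi> + Re s *\<^sub>R \<nu>) \<le> r0" "norm (Im s *\<^sub>R \<nu>) \<le> r0" if "s \<in> ball 0 \<rho>" for s
    proof -
      have s: "\<bar>Re s\<bar> \<le> \<rho>" "\<bar>Im s\<bar> \<le> \<rho>" using that abs_Re_le_cmod[of s] abs_Im_le_cmod[of s] by auto
      have nt: "norm \<nu> \<le> \<tau>" "norm \<xi> \<le> \<tau>" by (auto simp: \<tau>_def)
      have m: "\<bar>Re s\<bar> * norm \<nu> \<le> \<rho> * \<tau>" "\<bar>Im s\<bar> * norm \<nu> \<le> \<rho> * \<tau>" using s nt \<rho>(1) by (auto intro!: mult_mono)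
      have "norm (\<xi> + Re s *\<^sub>R \<nu>) \<le> norm \<xi> + \<bar>Re s\<bar> * norm \<nu>" using norm_triangle_ineq[of \<xi> "Re s *\<^sub>R \<nu>"] by simp
      then show "norm (\<xi> + Re s *\<^sub>R \<nu>) \<le> r0" using m(1) nt \<rho>(2) \<tau>8 \<tau> by linarith
      show "norm (Im s *\<^sub>R \<nu>) \<le> r0" using m(2) \<rho>(2) r0(1) by simp
    qed
    define u where "u s = Ln (T (\<xi> + Re s *\<^sub>R \<nu>) (Im s *\<^sub>R \<nu>))" for s
    have Tin: "T (\<xi> + Re s *\<^sub>R \<nu>) (Im s *\<^sub>R \<nu>) \<in> cball 1 (1/2)" if "s \<in> ball 0 \<rho>" for s
      using T1[OF inball[OF that]] by (simp add: dist_norm norm_minus_commute)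
    have "\<rho> * norm \<nu> \<le> a"
    proof -
      have "\<rho> * norm \<nu> \<le> \<rho> * \<tau>" using \<rho>(1) by (simp add: \<tau>_def)
      then show ?thesis using \<rho>(2) r0 a by linarith
    qed
    then have "(\<lambda>s. fourier_tube \<phi> ((\<xi>0 + \<xi>) + Re s *\<^sub>R \<nu>) (Im s *\<^sub>R \<nu>)) holomorphic_on ball 0 \<rho>"
      by (rule holomorphic_on_complex_line[OF wt \<rho>(1)])
    then have hT: "(\<lambda>s. T (\<xi> + Re s *\<^sub>R \<nu>) (Im s *\<^sub>R \<nu>)) holomorphic_on ball 0 \<rho>"
      unfolding T_def add.assoc using c0 by (intro holomorphic_intros) auto
    have hu: "u holomorphic_on ball 0 \<rho>"
      unfolding u_def by (intro holomorphic_on_Ln' hT nonpos Tin)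
    have \<tau>N: "\<tau> ^ N \<le> 2 ^ N * C1 * (R \<xi> + R \<nu>)"
    proof -
      define m where "m = max (norm \<xi>) (norm \<nu>)"
      have "\<tau> \<le> 2 * m" by (simp add: \<tau>_def m_def)
      then have "\<tau> ^ N \<le> (2 * m) ^ N" using \<tau> by (intro power_mono) auto
      also have "\<dots> \<le> 2 ^ N * (norm \<xi> ^ N + norm \<nu> ^ N)"
        unfolding power_mult_distrib m_def by (intro mult_left_mono) (auto simp: max_def)
      also have "\<dots> \<le> 2 ^ N * (C1 * R \<xi> + C1 * R \<nu>)"
      proof -
        have "norm \<xi> \<le> (real N + 1) * \<tau>" "norm \<nu> \<le> (real N + 1) * \<tau>"
          using \<tau> N1 by (auto simp: \<tau>_def algebra_simps intro: add_nonneg_nonneg)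
        then have "norm \<xi> < d2" "norm \<nu> < d2" using \<tau>d(3) by linarith+
        then show ?thesis by (intro mult_left_mono add_mono N(3) R1) auto
      qed
      finally show ?thesis by (simp add: algebra_simps)
    qed
    have "cmod (u \<i> - (\<Sum>j\<le>N. w j * u (of_nat j))) \<le> Ce * B * (1 / \<rho>) ^ Suc N"
      by (rule Ce(2)[OF hu _ \<rho>N]) (use B(2) Tin in \<open>auto simp: u_def\<close>)
    also have "1 / \<rho> = (2 / r0) * \<tau>" using r0 \<tau> by (simp add: \<rho>_def)
    also have "Ce * B * ((2 / r0) * \<tau>) ^ Suc N = Ce * B * (2 / r0) ^ Suc N * (\<tau> * \<tau> ^ N)"
      by (simp only: power_mult_distrib power_Suc mult_ac)
    also have "Ce * B * (2 / r0) ^ Suc N * (\<tau> * \<tau> ^ N) \<le> Ce * B * (2 / r0) ^ Suc N * (\<tau> * (2 ^ N * C1 * (R \<xi> + R \<nu>)))"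
      using Ce(1) B(1) r0(1) \<tau> by (intro mult_left_mono \<tau>N mult_nonneg_nonneg zero_le_power) auto
    also have "\<dots> = (C6 * \<tau>) * (R \<xi> + R \<nu>)" unfolding C6_def by (simp only: mult_ac)
    also have "\<dots> \<le> 1 / 8 * (R \<xi> + R \<nu>)"
      using \<tau>1(2) C6 R_nonneg[of \<xi>] R_nonneg[of \<nu>] by (intro mult_right_mono) (auto simp: field_simps)
    finally have err: "cmod (u \<i> - (\<Sum>j\<le>N. w j * u (of_nat j))) \<le> 1 / 8 * (R \<xi> + R \<nu>)" .
    have nj: "norm (\<xi> + real j *\<^sub>R \<nu>) \<le> (real N + 1) * \<tau>" if "j \<le> N" for j
    proof -
      have "norm (\<xi> + real j *\<^sub>R \<nu>) \<le> norm \<xi> + real j * norm \<nu>" using norm_triangle_ineq[of \<xi> "real j *\<^sub>R \<nu>"] by simp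
      also have "\<dots> \<le> \<tau> + real N * \<tau>" using that by (intro add_mono mult_mono) (auto simp: \<tau>_def)
      finally show ?thesis by (simp add: algebra_simps)
    qed
    have uj: "u (of_nat j) = \<i> * complex_of_real (\<alpha> \<bullet> \<xi>) + \<i> * complex_of_real (\<alpha> \<bullet> \<nu>) * of_nat j - P (\<xi> + real j *\<^sub>R \<nu>) + \<Upsilon> (\<xi> + real j *\<^sub>R \<nu>)"
      if "j \<le> N" for j
    proof -
      have "u (of_nat j) = Gamma_at \<phi> \<xi>0 (\<xi> + real j *\<^sub>R \<nu>)"
        by (simp add: u_def T_def Gamma_at_def c0_def fourier_eq_fourier_tube add_ac)
      also have "\<dots> = \<i> * complex_of_real (\<alpha> \<bullet> (\<xi> + real j *\<^sub>R \<nu>)) - P (\<xi> + real j *\<^sub>R \<nu>) + \<Upsilon> (\<xi> + real j *\<^sub>R \<nu>)"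
        using nj[OF that] \<tau>d(2) by (intro d1(2)) simp
      finally show ?thesis by (simp add: inner_add_right algebra_simps)
    qed
    define U where "U = (\<Sum>j\<le>N. w j * \<Upsilon> (\<xi> + real j *\<^sub>R \<nu>))"
    have "(\<Sum>j\<le>N. w j * u (of_nat j)) = (\<Sum>j\<le>N. \<i> * complex_of_real (\<alpha> \<bullet> \<xi>) * w j + \<i> * complex_of_real (\<alpha> \<bullet> \<nu>) * (w j * of_nat j)
        - w j * P (\<xi> + real j *\<^sub>R \<nu>) + w j * \<Upsilon> (\<xi> + real j *\<^sub>R \<nu>))"
      by (intro sum.cong refl) (simp add: uj algebra_simps)
    also have "\<dots> = \<i> * complex_of_real (\<alpha> \<bullet> \<xi>) - complex_of_real (\<alpha> \<bullet> \<nu>) - Q \<xi> \<nu> + U"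
      by (simp add: sum.distrib sum_subtractf sum_distrib_left[symmetric] w0 w1 Q_def U_def) (simp add: complex_eq_iff)
    finally have sm: "(\<Sum>j\<le>N. w j * u (of_nat j)) = \<i> * complex_of_real (\<alpha> \<bullet> \<xi>) - complex_of_real (\<alpha> \<bullet> \<nu>) - Q \<xi> \<nu> + U" .
    have re: "Re (\<Sum>j\<le>N. w j * u (of_nat j)) = - (\<alpha> \<bullet> \<nu>) - Re (Q \<xi> \<nu>) + Re U"
      unfolding sm by simp
    have "cmod U \<le> (\<Sum>j\<le>N. cmod (w j) * (\<epsilon> * (C2 * (R \<xi> + R \<nu>))))"
      unfolding U_def
    proof (rule order_trans[OF norm_sum], rule sum_mono)
      fix j assume "j \<in> {..N}"
      then have j: "j \<le> N" by simp
      have "cmod (\<Upsilon> (\<xi> + real j *\<^sub>R \<nu>)) \<le> \<epsilon> * R (\<xi> + real j *\<^sub>R \<nu>)"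
        using nj[OF j] \<tau>d(1) by (intro Ub) simp
      also have "\<dots> \<le> \<epsilon> * (C2 * (R \<xi> + R \<nu>))" using C2'[OF j] \<epsilon> by (intro mult_left_mono) auto
      finally show "cmod (w j * \<Upsilon> (\<xi> + real j *\<^sub>R \<nu>)) \<le> cmod (w j) * (\<epsilon> * (C2 * (R \<xi> + R \<nu>)))"
        unfolding norm_mult by (rule mult_left_mono) simp
    qed
    also have "\<dots> = (\<Sum>j\<le>N. cmod (w j)) * (\<epsilon> * (C2 * (R \<xi> + R \<nu>)))" by (simp add: sum_distrib_right)
    also have "\<dots> \<le> S * (\<epsilon> * (C2 * (R \<xi> + R \<nu>)))"
      using \<epsilon> C2(1) R_nonneg[of \<xi>] R_nonneg[of \<nu>] by (intro mult_right_mono) (auto simp: S_def)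
    also have "\<dots> = 1 / 8 * (R \<xi> + R \<nu>)" using S C2 by (simp add: \<epsilon>_def)
    finally have Ub': "cmod U \<le> 1 / 8 * (R \<xi> + R \<nu>)" .
    have "Re (u \<i>) \<le> Re (\<Sum>j\<le>N. w j * u (of_nat j)) + cmod (u \<i> - (\<Sum>j\<le>N. w j * u (of_nat j)))"
      using complex_Re_le_cmod[of "u \<i> - (\<Sum>j\<le>N. w j * u (of_nat j))"] unfolding minus_complex.sel by linarith
    also have "\<dots> \<le> - (\<alpha> \<bullet> \<nu>) - (R \<xi> / 2 - C3 * R \<nu>) + 1 / 8 * (R \<xi> + R \<nu>) + 1 / 8 * (R \<xi> + R \<nu>)"
      using re C3(2)[of \<xi> \<nu>] complex_Re_le_cmod[of U] Ub' err by linarith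
    also have "\<dots> = - (\<alpha> \<bullet> \<nu>) - R \<xi> / 4 + (C3 + 1 / 4) * R \<nu>" by (simp add: algebra_simps)
    finally have fin: "Re (u \<i>) \<le> - (\<alpha> \<bullet> \<nu>) - R \<xi> / 4 + (C3 + 1 / 4) * R \<nu>" .
    have i: "\<i> \<in> ball 0 \<rho>" using \<rho>N N1 by simp
    have "T \<xi> \<nu> \<noteq> 0" using nonpos[OF Tin[OF i]] by auto
    then have "cmod (T \<xi> \<nu>) = exp (Re (u \<i>))" by (simp add: u_def)
    moreover have "cmod (T \<xi> \<nu>) = cmod (fourier_tube \<phi> (\<xi>0 + \<xi>) \<nu>)" by (simp add: T_def norm_divide c0)
    ultimately show ?thesis using fin by (simp add: R_def)
  qed
  have "\<delta> > 0" using \<tau>0 by (simp add: \<delta>_def)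
  moreover have "C3 + 1 / 4 > 0" using C3 by simp
  ultimately show ?thesis using est by blast
qed

section \<open>Holomorphic localization\<close>

text \<open>For \<open>g\<close> in \<open>[0, 1]\<close>, the probability that more than half of \<open>n\<close> independent trials with success
  probability \<open>g\<close> succeed. As a polynomial in \<open>g\<close> it keeps holomorphy.\<close>
definition majority :: "nat \<Rightarrow> complex \<Rightarrow> complex" where
  "majority n g = (\<Sum>i\<in>{i. i \<le> n \<and> n < 2 * i}. of_nat (n choose i) * g ^ i * (1 - g) ^ (n - i))"

lemma majority_compl:
  "1 - majority n g = (\<Sum>i\<in>{i. i \<le> n \<and> \<not> n < 2 * i}. of_nat (n choose i) * g ^ i * (1 - g) ^ (n - i))"
proof -
  have "1 = (g + (1 - g)) ^ n" by simp
  also have "\<dots> = (\<Sum>i\<le>n. of_nat (n choose i) * g ^ i * (1 - g) ^ (n - i))" by (rule binomial_ring)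
  also have "{..n} = {i. i \<le> n \<and> n < 2 * i} \<union> {i. i \<le> n \<and> \<not> n < 2 * i}" by auto
  also have "(\<Sum>i\<in>\<dots>. of_nat (n choose i) * g ^ i * (1 - g) ^ (n - i)) =
    majority n g + (\<Sum>i\<in>{i. i \<le> n \<and> \<not> n < 2 * i}. of_nat (n choose i) * g ^ i * (1 - g) ^ (n - i))"
    unfolding majority_def by (rule sum.union_disjoint) auto
  finally show ?thesis by (simp add: algebra_simps)
qed

lemma norm_binomial_part_le:
  fixes g :: complex
  assumes "I \<subseteq> {..n}" and le: "\<And>i. i \<in> I \<Longrightarrow> cmod g ^ i * cmod (1 - g) ^ (n - i) \<le> u ^ i * v ^ (n - i)" and "u \<ge> 0" "v \<ge> 0"
  shows "cmod (\<Sum>i\<in>I. of_nat (n choose i) * g ^ i * (1 - g) ^ (n - i)) \<le> (u + v) ^ n"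
proof -
  have "cmod (\<Sum>i\<in>I. of_nat (n choose i) * g ^ i * (1 - g) ^ (n - i)) \<le> (\<Sum>i\<in>I. real (n choose i) * u ^ i * v ^ (n - i))"
    by (intro order_trans[OF norm_sum] sum_mono) (auto simp: norm_mult norm_power mult.assoc intro!: mult_left_mono le)
  also have "\<dots> \<le> (\<Sum>i\<le>n. real (n choose i) * u ^ i * v ^ (n - i))"
    using assms by (intro sum_mono2) auto
  also have "\<dots> = (u + v) ^ n" by (rule binomial_ring[symmetric])
  finally show ?thesis .
qed

lemma norm_majority_le: "cmod (majority n g) \<le> (cmod g + cmod (1 - g)) ^ n"
  unfolding majority_def by (rule norm_binomial_part_le) auto

text \<open>Each term contains more than \<open>n / 2\<close> factors \<open>g\<close>; the square root \<open>1 / 10\<close> of the bound on \<open>g\<close> is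
  charged to each of the \<open>n\<close> trials.\<close>
lemma majority_small:
  assumes "cmod g \<le> 1 / 100"
  shows "cmod (majority n g) \<le> (3 / 10) ^ n"
proof -
  have "cmod (majority n g) \<le> (1 / 10 + 1 / 5) ^ n"
    unfolding majority_def
  proof (rule norm_binomial_part_le)
    fix i assume "i \<in> {i. i \<le> n \<and> n < 2 * i}"
    then have i: "i \<le> n" "n < 2 * i" by auto
    have "cmod (1 - g) \<le> 2" using norm_triangle_ineq4[of 1 g] assms by simp
    then have "cmod g ^ i * cmod (1 - g) ^ (n - i) \<le> (1 / 100) ^ i * 2 ^ (n - i)"
      using assms by (intro mult_mono power_mono) auto
    also have "(1 / 100 :: real) ^ i = (1 / 10) ^ i * (1 / 10) ^ i" by (simp add: power_mult_distrib[symmetric])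
    also have "(1 / 10 :: real) ^ i * (1 / 10) ^ i * 2 ^ (n - i) \<le> (1 / 10) ^ i * (1 / 10) ^ (n - i) * 2 ^ (n - i)"
      using i by (intro mult_right_mono mult_left_mono power_decreasing) auto
    also have "\<dots> = (1 / 10) ^ i * (1 / 5) ^ (n - i)" by (simp add: power_mult_distrib[symmetric] mult.assoc)
    finally show "cmod g ^ i * cmod (1 - g) ^ (n - i) \<le> (1 / 10) ^ i * (1 / 5) ^ (n - i)" .
  qed auto
  then show ?thesis by simp
qed

lemma majority_near_one:
  assumes "cmod (1 - g) \<le> 1 / 100"
  shows "cmod (1 - majority n g) \<le> (3 / 10) ^ n"
proof -
  have "cmod (1 - majority n g) \<le> (1 / 5 + 1 / 10) ^ n"
    unfolding majority_compl
  proof (rule norm_binomial_part_le)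
    fix i assume "i \<in> {i. i \<le> n \<and> \<not> n < 2 * i}"
    then have i: "i \<le> n" "i \<le> n - i" by auto
    have "cmod g \<le> 2" using norm_triangle_ineq4[of 1 "1 - g"] assms by simp
    then have "cmod g ^ i * cmod (1 - g) ^ (n - i) \<le> 2 ^ i * (1 / 100) ^ (n - i)"
      using assms by (intro mult_mono power_mono) auto
    also have "(1 / 100 :: real) ^ (n - i) = (1 / 10) ^ (n - i) * (1 / 10) ^ (n - i)" by (simp add: power_mult_distrib[symmetric])
    also have "2 ^ i * ((1 / 10 :: real) ^ (n - i) * (1 / 10) ^ (n - i)) \<le> 2 ^ i * ((1 / 10) ^ i * (1 / 10) ^ (n - i))"
      using i by (intro mult_right_mono mult_left_mono power_decreasing) auto
    also have "\<dots> = (1 / 5) ^ i * (1 / 10) ^ (n - i)" by (simp add: power_mult_distrib[symmetric] mult.assoc[symmetric])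
    finally show "cmod g ^ i * cmod (1 - g) ^ (n - i) \<le> (1 / 5) ^ i * (1 / 10) ^ (n - i)" .
  qed auto
  then show ?thesis by simp
qed

lemma tube_series_majority:
  assumes "a \<ge> 0" "tube_series a G"
  shows "tube_series a (\<lambda>\<xi> \<nu>. majority n (G \<xi> \<nu>))"
  unfolding majority_def
  by (intro tube_series_sum tube_series_mult tube_series_power tube_series_diff tube_series_const assms)

definition cong2pi :: "real^'d \<Rightarrow> real^'d \<Rightarrow> bool" where
  "cong2pi \<omega> \<theta> \<longleftrightarrow> (\<exists>m. \<omega> = \<theta> + (2 * pi) *\<^sub>R real_vec m)"

text \<open>A power of \<open>\<Prod>\<^sub>i (1 + cos (\<xi>\<^sub>i - \<theta>\<^sub>i)) / 2\<close>, which is less than \<open>1\<close> exactly off the lattice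
  translates of \<open>\<theta>\<close>.\<close>
lemma cutoff_exists:
  fixes \<theta> :: "real^'d"
  assumes a: "a \<ge> 0" and fin: "finite \<Lambda>" and \<eta>: "\<eta> > 0"
  shows "\<exists>G. tube_series a G \<and> (\<forall>\<xi>. \<exists>g. G \<xi> 0 = complex_of_real g \<and> 0 \<le> g \<and> g \<le> 1) \<and>
    (\<forall>\<omega>\<in>\<Lambda>. if cong2pi \<omega> \<theta> then G \<omega> 0 = 1 else cmod (G \<omega> 0) \<le> \<eta>)"
proof -
  define H where "H \<xi> \<nu> = (\<Prod>i\<in>(UNIV::'d set). 1 / 2 + (exp (- (\<i> * complex_of_real (\<theta> $ i))) / 4 * tilted_char (axis i 1) \<xi> \<nu>
     + exp (\<i> * complex_of_real (\<theta> $ i)) / 4 * tilted_char (- axis i 1) \<xi> \<nu>))" for \<xi> \<nu>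
  have H: "tube_series a H"
    unfolding H_def[abs_def] by (intro tube_series_prod tube_series_add tube_series_const tube_series_tilted_char a)
  define h where "h \<xi> = (\<Prod>i\<in>UNIV. (1 + cos (\<xi> $ i - \<theta> $ i)) / 2)" for \<xi> :: "real^'d"
  have Hh: "H \<xi> 0 = complex_of_real (h \<xi>)" for \<xi>
  proof -
    have rv: "real_vec (axis i 1) \<bullet> \<xi> = \<xi> $ i" for i
    proof -
      have "real_vec (axis i 1) = axis i 1" by (simp add: real_vec_def axis_def vec_eq_iff)
      then show ?thesis by (simp add: inner_axis')
    qed
    have "exp (- (\<i> * complex_of_real t)) / 4 * exp (Complex 0 s) + exp (\<i> * complex_of_real t) / 4 * exp (Complex 0 (- s))
      = complex_of_real (cos (s - t) / 2)" for s t
    proof -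
      have 1: "exp (- (\<i> * complex_of_real t)) * exp (Complex 0 s) = exp (\<i> * complex_of_real (s - t))"
        unfolding exp_add[symmetric] by (rule arg_cong[where f=exp]) (simp add: complex_eq_iff)
      have 2: "exp (\<i> * complex_of_real t) * exp (Complex 0 (- s)) = exp (- (\<i> * complex_of_real (s - t)))"
        unfolding exp_add[symmetric] by (rule arg_cong[where f=exp]) (simp add: complex_eq_iff)
      have "complex_of_real (cos (s - t)) = (exp (\<i> * complex_of_real (s - t)) + exp (- (\<i> * complex_of_real (s - t)))) / 2"
        by (simp only: cos_of_real[symmetric] cos_exp_eq)
      then show ?thesis using 1 2 by (simp add: add_divide_distrib)
    qed
    then have "1 / 2 + (exp (- (\<i> * complex_of_real (\<theta> $ i))) / 4 * tilted_char (axis i 1) \<xi> 0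
     + exp (\<i> * complex_of_real (\<theta> $ i)) / 4 * tilted_char (- axis i 1) \<xi> 0) = complex_of_real ((1 + cos (\<xi> $ i - \<theta> $ i)) / 2)" for i
      by (simp add: tilted_char_def real_vec_minus rv add_divide_distrib)
    then show ?thesis by (simp add: H_def h_def del: of_real_divide)
  qed
  have f01: "0 \<le> (1 + cos t) / 2" "(1 + cos t) / 2 \<le> 1" for t :: real
  proof -
    have "1 + - 1 \<le> 1 + cos t" by (rule add_left_mono) (rule cos_ge_minus_one)
    then show "0 \<le> (1 + cos t) / 2" by simp
    have "1 + cos t \<le> 1 + 1" by (rule add_left_mono) (rule cos_le_one)
    then show "(1 + cos t) / 2 \<le> 1" by simp
  qed
  have h01: "0 \<le> h \<xi>" "h \<xi> \<le> 1" for \<xi>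
    unfolding h_def by (auto intro!: prod_nonneg prod_le_1 f01)
  have h1: "h \<xi> = 1 \<longleftrightarrow> cong2pi \<xi> \<theta>" for \<xi>
  proof
    assume "cong2pi \<xi> \<theta>"
    then obtain m where m: "\<xi> = \<theta> + (2 * pi) *\<^sub>R real_vec m" by (auto simp: cong2pi_def)
    have "cos (\<xi> $ i - \<theta> $ i) = 1" for i
      unfolding cos_one_2pi_int m by (intro exI[of _ "m $ i"]) (simp add: real_vec_def)
    then show "h \<xi> = 1" by (simp add: h_def)
  next
    assume 1: "h \<xi> = 1"
    have "cos (\<xi> $ i - \<theta> $ i) = 1" for i
    proof -
      have "h \<xi> = (1 + cos (\<xi> $ i - \<theta> $ i)) / 2 * (\<Prod>j\<in>UNIV - {i}. (1 + cos (\<xi> $ j - \<theta> $ j)) / 2)"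
        unfolding h_def by (rule prod.remove) auto
      also have "\<dots> \<le> (1 + cos (\<xi> $ i - \<theta> $ i)) / 2 * 1"
        by (intro mult_left_mono prod_le_1 conjI f01)
      finally show ?thesis using 1 cos_le_one[of "\<xi> $ i - \<theta> $ i"] by simp
    qed
    then have "\<forall>i. \<exists>n::int. \<xi> $ i - \<theta> $ i = n * 2 * pi" unfolding cos_one_2pi_int by blast
    then obtain m where m: "\<And>i. \<xi> $ i - \<theta> $ i = real_of_int (m i) * 2 * pi" by metis
    have "\<xi> = \<theta> + (2 * pi) *\<^sub>R real_vec (\<chi> i. m i)"
      using m by (simp add: vec_eq_iff real_vec_def algebra_simps)
    then show "cong2pi \<xi> \<theta>" unfolding cong2pi_def by blast
  qed
  have "\<exists>N. \<forall>\<omega>\<in>\<Lambda>. \<not> cong2pi \<omega> \<theta> \<longrightarrow> h \<omega> ^ N \<le> \<eta>"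
  proof -
    have "\<exists>N. h \<omega> ^ N \<le> \<eta>" if "\<not> cong2pi \<omega> \<theta>" for \<omega>
    proof -
      have "h \<omega> < 1" using h01[of \<omega>] h1[of \<omega>] that by (metis order_le_less)
      then show ?thesis using real_arch_pow_inv[OF \<eta>] less_imp_le by blast
    qed
    then obtain N where N: "\<And>\<omega>. \<not> cong2pi \<omega> \<theta> \<Longrightarrow> h \<omega> ^ N \<omega> \<le> \<eta>" by metis
    define N0 where "N0 = Max (insert 0 (N ` \<Lambda>))"
    have "h \<omega> ^ N0 \<le> \<eta>" if "\<omega> \<in> \<Lambda>" "\<not> cong2pi \<omega> \<theta>" for \<omega>
    proof -
      have "N \<omega> \<le> N0" unfolding N0_def using fin that by (intro Max_ge) auto
      then have "h \<omega> ^ N0 \<le> h \<omega> ^ N \<omega>" using h01 by (intro power_decreasing) auto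
      then show ?thesis using N[OF that(2)] by simp
    qed
    then show ?thesis by blast
  qed
  then obtain N where N: "\<And>\<omega>. \<omega> \<in> \<Lambda> \<Longrightarrow> \<not> cong2pi \<omega> \<theta> \<Longrightarrow> h \<omega> ^ N \<le> \<eta>" by blast
  show ?thesis
  proof (intro exI[of _ "\<lambda>\<xi> \<nu>. H \<xi> \<nu> ^ N"] conjI)
    show "tube_series a (\<lambda>\<xi> \<nu>. H \<xi> \<nu> ^ N)" by (rule tube_series_power[OF a H])
    show "\<forall>\<xi>. \<exists>g. H \<xi> 0 ^ N = complex_of_real g \<and> 0 \<le> g \<and> g \<le> 1"
      by (intro allI exI[of _ "h _ ^ N"]) (auto simp: Hh h01 power_le_one)
    show "\<forall>\<omega>\<in>\<Lambda>. if cong2pi \<omega> \<theta> then H \<omega> 0 ^ N = 1 else cmod (H \<omega> 0 ^ N) \<le> \<eta>"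
    proof
      fix \<omega> assume w: "\<omega> \<in> \<Lambda>"
      show "if cong2pi \<omega> \<theta> then H \<omega> 0 ^ N = 1 else cmod (H \<omega> 0 ^ N) \<le> \<eta>"
      proof (cases "cong2pi \<omega> \<theta>")
        case True
        then have "h \<omega> = 1" by (simp only: h1)
        then show ?thesis using True by (simp add: Hh)
      next
        case False
        then show ?thesis using N[OF w False] h01[of \<omega>] by (simp add: Hh norm_power)
      qed
    qed
  qed
qed

lemma tube_series_lipschitz:
  assumes a: "a > 0" and T: "tube_series a T"
  shows "\<exists>K>0. \<forall>\<xi> \<xi>' \<nu> \<nu>'. norm \<nu> \<le> a / 2 \<longrightarrow> norm \<nu>' \<le> a / 2 \<longrightarrow>
    cmod (T \<xi> \<nu> - T \<xi>' \<nu>') \<le> K * (norm (\<xi> - \<xi>') + norm (\<nu> - \<nu>'))"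
proof -
  obtain c where c: "weighted a c" "\<And>\<xi> \<nu>. norm \<nu> \<le> a \<Longrightarrow> T \<xi> \<nu> = fourier_tube c \<xi> \<nu>"
    using T unfolding tube_series_def by blast
  show ?thesis
    using fourier_tube_lipschitz[OF a c(1)] c(2) a by (smt (verit) field_sum_of_halves)
qed

text \<open>The points at distance at least \<open>\<delta>\<close> from all peaks form a compact set.\<close>
lemma gap_off_peaks:
  fixes f :: "real^'d \<Rightarrow> complex"
  assumes cont: "continuous_on UNIV f" and le: "\<And>\<xi>. cmod (f \<xi>) \<le> 1" and d: "\<delta> > 0"
    and peaks: "\<Lambda> = {\<omega>\<in>closed_torus. cmod (f \<omega>) = 1}"
  shows "\<exists>q. 0 \<le> q \<and> q < 1 \<and> (\<forall>\<xi>\<in>closed_torus. (\<forall>\<omega>\<in>\<Lambda>. \<delta> \<le> norm (\<xi> - \<omega>)) \<longrightarrow> cmod (f \<xi>) \<le> q)"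
proof -
  define S where "S = closed_torus - (\<Union>\<omega>\<in>\<Lambda>. ball \<omega> \<delta>)"
  have S: "compact S" unfolding S_def by (intro compact_diff compact_closed_torus) auto
  have inS: "\<xi> \<in> S" if "\<xi> \<in> closed_torus" "\<forall>\<omega>\<in>\<Lambda>. \<delta> \<le> norm (\<xi> - \<omega>)" for \<xi>
    using that by (force simp: S_def dist_norm norm_minus_commute)
  show ?thesis
  proof (cases "S = {}")
    case True
    then show ?thesis using inS by (intro exI[of _ 0]) auto
  next
    case False
    have "continuous_on S (\<lambda>\<xi>. cmod (f \<xi>))" by (intro continuous_intros continuous_on_subset[OF cont]) auto
    then obtain z where z: "z \<in> S" "\<And>\<xi>. \<xi> \<in> S \<Longrightarrow> cmod (f \<xi>) \<le> cmod (f z)"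
      using continuous_attains_sup[OF S False] by blast
    have "z \<notin> \<Lambda>" using z(1) d by (auto simp: S_def)
    then have "cmod (f z) \<noteq> 1" using z(1) by (auto simp: peaks S_def)
    then have "cmod (f z) < 1" using le[of z] by simp
    then show ?thesis using z inS by (intro exI[of _ "cmod (f z)"]) auto
  qed
qed

text \<open>Three regions of \<open>\<xi>\<close>. Near a peak in \<open>\<Lambda>1\<close> the multiplier is at most \<open>2\<close> and the local estimate
  \<open>loc\<close> applies. Near any other peak the multiplier decays geometrically, faster than the power of
  \<open>F\<close> can grow for a small tilt. Away from all peaks \<open>F\<close> has a gap below \<open>1\<close>, while the multiplier grows
  at a rate close to \<open>1\<close>.\<close>
lemma pointwise_localized:
  fixes F G :: "real^'d \<Rightarrow> real^'d \<Rightarrow> complex"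
  assumes b: "b > 0"
    and F: "\<And>\<xi> \<xi>' \<nu> \<nu>'. norm \<nu> \<le> b \<Longrightarrow> norm \<nu>' \<le> b \<Longrightarrow> cmod (F \<xi> \<nu> - F \<xi>' \<nu>') \<le> KF * (norm (\<xi> - \<xi>') + norm (\<nu> - \<nu>'))" and KF: "KF > 0"
    and G: "\<And>\<xi> \<xi>' \<nu> \<nu>'. norm \<nu> \<le> b \<Longrightarrow> norm \<nu>' \<le> b \<Longrightarrow> cmod (G \<xi> \<nu> - G \<xi>' \<nu>') \<le> KG * (norm (\<xi> - \<xi>') + norm (\<nu> - \<nu>'))" and KG: "KG > 0"
    and F1: "\<And>\<xi>. cmod (F \<xi> 0) \<le> 1" and peaks: "\<Lambda> = {\<omega>\<in>closed_torus. cmod (F \<omega> 0) = 1}" and fin: "finite \<Lambda>"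
    and Fcont: "continuous_on UNIV (\<lambda>\<xi>. F \<xi> 0)"
    and Gr: "\<And>\<xi>. \<exists>g. G \<xi> 0 = complex_of_real g \<and> 0 \<le> g \<and> g \<le> 1"
    and \<Lambda>1: "\<Lambda>1 \<subseteq> \<Lambda>" and G1: "\<And>\<omega>. \<omega> \<in> \<Lambda>1 \<Longrightarrow> G \<omega> 0 = 1" and G0: "\<And>\<omega>. \<omega> \<in> \<Lambda> - \<Lambda>1 \<Longrightarrow> cmod (G \<omega> 0) \<le> 1 / 200"
    and d0: "\<rho> > 0" and loc: "\<And>\<omega> \<xi> \<nu>. \<omega> \<in> \<Lambda>1 \<Longrightarrow> norm \<xi> \<le> \<rho> \<Longrightarrow> norm \<nu> \<le> \<rho> \<Longrightarrow> cmod (F (\<omega> + \<xi>) \<nu>) \<le> exp (A \<nu> - R \<xi>)"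
  shows "\<exists>\<epsilon>>0. \<exists>\<delta>>0. \<forall>n \<nu> \<xi>. norm \<nu> \<le> \<delta> \<longrightarrow> \<xi> \<in> closed_torus \<longrightarrow>
    cmod (F \<xi> \<nu> ^ n * majority n (G \<xi> \<nu>)) \<le> (\<Sum>\<omega>\<in>\<Lambda>1. 2 * exp (real n * A \<nu>) * exp (- (real n * R (\<xi> - \<omega>)))) + exp (- (\<epsilon> * real n))"
proof -
  define \<delta>1 where "\<delta>1 = min (min b \<rho>) (min (1 / (400 * KG)) (1 / (200 * KF)))"
  have \<delta>1: "\<delta>1 > 0" "\<delta>1 \<le> b" "\<delta>1 \<le> \<rho>" "\<delta>1 \<le> 1 / (400 * KG)" "\<delta>1 \<le> 1 / (200 * KF)"
    using b d0 KG KF by (auto simp: \<delta>1_def)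
  have KG1: "KG * (\<delta>1 + \<delta>1) \<le> 1 / 200" using \<delta>1(4) KG by (simp add: field_simps)
  have KF1: "KF * (\<delta>1 + \<delta>1) \<le> 1 / 100" using \<delta>1(5) KF by (simp add: field_simps)
  obtain q where q: "0 \<le> q" "q < 1" "\<And>\<xi>. \<xi> \<in> closed_torus \<Longrightarrow> (\<forall>\<omega>\<in>\<Lambda>. \<delta>1 \<le> norm (\<xi> - \<omega>)) \<Longrightarrow> cmod (F \<xi> 0) \<le> q"
    using gap_off_peaks[OF Fcont F1 \<delta>1(1) peaks] by blast
  \<comment> \<open>Any number strictly between the gap value \<open>q\<close> and \<open>1\<close>; small tilts keep the product below it.\<close>
  define q' where "q' = (1 + q) / 2"
  have q': "1 / 2 \<le> q'" "q' < 1" using q by (auto simp: q'_def)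
  have "isCont (\<lambda>t. (q + KF * t) * (1 + 2 * KG * t)) 0" by (intro continuous_intros)
  then have "((\<lambda>t. (q + KF * t) * (1 + 2 * KG * t)) \<longlongrightarrow> q) (at_right 0)"
    by (auto simp: isCont_def intro: tendsto_mono[OF at_le])
  then have "\<forall>\<^sub>F t in at_right 0. (q + KF * t) * (1 + 2 * KG * t) < q'"
    by (rule order_tendstoD) (use q in \<open>simp add: q'_def\<close>)
  then obtain e where e: "e > 0" "\<And>t. 0 < t \<Longrightarrow> t < e \<Longrightarrow> (q + KF * t) * (1 + 2 * KG * t) < q'"
    unfolding eventually_at_right_field by auto
  define \<delta> where "\<delta> = min \<delta>1 (e / 2)"
  have \<delta>: "\<delta> > 0" "\<delta> \<le> \<delta>1" "(q + KF * \<delta>) * (1 + 2 * KG * \<delta>) < q'" using \<delta>1 e by (auto simp: \<delta>_def)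
  define \<epsilon> where "\<epsilon> = min (- ln q') (ln 2)"
  have \<epsilon>: "\<epsilon> > 0" using q' by (simp add: \<epsilon>_def)
  have small: "r ^ n \<le> exp (- (\<epsilon> * real n))" if r: "0 \<le> r" "r \<le> exp (- \<epsilon>)" for r n
  proof -
    have "r ^ n \<le> exp (- \<epsilon>) ^ n" using r by (intro power_mono)
    then show ?thesis by (simp add: exp_of_nat_mult[symmetric] mult.commute)
  qed
  have half: "(1/2::real) \<le> exp (- \<epsilon>)"
  proof -
    have "exp (- ln 2) \<le> exp (- \<epsilon>)" by (simp add: \<epsilon>_def)
    then show ?thesis by (simp add: exp_minus)
  qed
  have q'e: "q' \<le> exp (- \<epsilon>)"
  proof -
    have "exp (ln q') \<le> exp (- \<epsilon>)" unfolding exp_le_cancel_iff \<epsilon>_def by linarith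
    then show ?thesis using q' by simp
  qed
  have main: "cmod (F \<xi> \<nu> ^ n * majority n (G \<xi> \<nu>)) \<le> (\<Sum>\<omega>\<in>\<Lambda>1. 2 * exp (real n * A \<nu>) * exp (- (real n * R (\<xi> - \<omega>)))) + exp (- (\<epsilon> * real n))"
    (is "_ \<le> ?S + _")
    if \<nu>: "norm \<nu> \<le> \<delta>" and \<xi>: "\<xi> \<in> closed_torus" for n \<nu> \<xi>
  proof -
    have S0: "?S \<ge> 0" by (intro sum_nonneg) auto
    have \<nu>b: "norm \<nu> \<le> b" "norm \<nu> \<le> \<delta>1" using \<nu> \<delta>(2) \<delta>1 by auto
    have fin1: "finite \<Lambda>1" using \<Lambda>1 fin finite_subset by blast
    consider (1) \<omega> where "\<omega> \<in> \<Lambda>1" "norm (\<xi> - \<omega>) < \<delta>1" | (2) \<omega> where "\<omega> \<in> \<Lambda> - \<Lambda>1" "norm (\<xi> - \<omega>) < \<delta>1"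
      | (3) "\<forall>\<omega>\<in>\<Lambda>. \<delta>1 \<le> norm (\<xi> - \<omega>)" by (meson DiffI linorder_not_le)
    then show ?thesis
    proof cases
      case 1
      have "cmod (1 - G \<xi> \<nu>) \<le> KG * (norm (\<omega> - \<xi>) + norm (0 - \<nu>))"
        using G[of 0 \<nu> \<omega> \<xi>] G1[OF 1(1)] \<nu>b b by simp
      also have "\<dots> \<le> KG * (\<delta>1 + \<delta>1)" using 1(2) \<nu>b KG by (intro mult_left_mono add_mono) (auto simp: norm_minus_commute)
      finally have "cmod (1 - majority n (G \<xi> \<nu>)) \<le> (3 / 10) ^ n" using KG1 by (intro majority_near_one) simp
      also have "(3 / 10 :: real) ^ n \<le> 1" by (intro power_le_one) auto
      finally have M: "cmod (majority n (G \<xi> \<nu>)) \<le> 2" using norm_triangle_ineq4[of 1 "1 - majority n (G \<xi> \<nu>)"] by simp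
      have "cmod (F \<xi> \<nu>) \<le> exp (A \<nu> - R (\<xi> - \<omega>))"
        using loc[OF 1(1), of "\<xi> - \<omega>" \<nu>] 1(2) \<nu>b \<delta>1 by simp
      then have "cmod (F \<xi> \<nu>) ^ n \<le> exp (A \<nu> - R (\<xi> - \<omega>)) ^ n" by (intro power_mono) auto
      also have "\<dots> = exp (real n * A \<nu>) * exp (- (real n * R (\<xi> - \<omega>)))"
        by (simp add: exp_of_nat_mult[symmetric] exp_add[symmetric] algebra_simps)
      finally have "cmod (F \<xi> \<nu> ^ n * majority n (G \<xi> \<nu>)) \<le> (exp (real n * A \<nu>) * exp (- (real n * R (\<xi> - \<omega>)))) * 2"
        unfolding norm_mult norm_power using M by (intro mult_mono) auto
      also have "\<dots> \<le> ?S"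
        using member_le_sum[OF 1(1), of "\<lambda>\<omega>. 2 * exp (real n * A \<nu>) * exp (- (real n * R (\<xi> - \<omega>)))"] fin1 by (simp add: mult_ac)
      finally show ?thesis by (simp add: add_increasing2)
    next
      case 2
      have "cmod (G \<xi> \<nu> - G \<omega> 0) \<le> KG * (norm (\<xi> - \<omega>) + norm (\<nu> - 0))" using G[of \<nu> 0 \<xi> \<omega>] \<nu>b b by simp
      also have "\<dots> \<le> KG * (\<delta>1 + \<delta>1)" using 2(2) \<nu>b KG by (intro mult_left_mono add_mono) auto
      finally have "cmod (G \<xi> \<nu>) \<le> 1 / 100"
        using KG1 G0[OF 2(1)] norm_triangle_ineq2[of "G \<xi> \<nu>" "G \<omega> 0"] by simp
      then have M: "cmod (majority n (G \<xi> \<nu>)) \<le> (3 / 10) ^ n" by (rule majority_small)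
      have "cmod (F \<xi> \<nu> - F \<xi> 0) \<le> KF * (norm (\<xi> - \<xi>) + norm (\<nu> - 0))" using F[of \<nu> 0 \<xi> \<xi>] \<nu>b b by simp
      also have "\<dots> \<le> KF * (\<delta>1 + \<delta>1)" using \<nu>b KF \<delta>1(1) by (intro mult_left_mono add_mono) auto
      finally have "cmod (F \<xi> \<nu>) \<le> 101 / 100"
        using KF1 F1[of \<xi>] norm_triangle_ineq2[of "F \<xi> \<nu>" "F \<xi> 0"] by simp
      then have "cmod (F \<xi> \<nu> ^ n * majority n (G \<xi> \<nu>)) \<le> (101 / 100) ^ n * (3 / 10) ^ n"
        unfolding norm_mult norm_power using M by (intro mult_mono power_mono) auto
      also have "\<dots> = (101 / 100 * (3 / 10)) ^ n" by (rule power_mult_distrib[symmetric])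
      also have "\<dots> \<le> exp (- (\<epsilon> * real n))" using half by (intro small) auto
      finally show ?thesis using S0 by linarith
    next
      case 3
      obtain g where g: "G \<xi> 0 = complex_of_real g" "0 \<le> g" "g \<le> 1" using Gr by blast
      have Fd: "cmod (F \<xi> \<nu> - F \<xi> 0) \<le> KF * \<delta>"
      proof -
        have "cmod (F \<xi> \<nu> - F \<xi> 0) \<le> KF * norm \<nu>" using F[of \<nu> 0 \<xi> \<xi>] \<nu>b b by simp
        also have "\<dots> \<le> KF * \<delta>" using \<nu> KF by (intro mult_left_mono) auto
        finally show ?thesis .
      qed
      have Gd: "cmod (G \<xi> \<nu> - G \<xi> 0) \<le> KG * \<delta>"
      proof -
        have "cmod (G \<xi> \<nu> - G \<xi> 0) \<le> KG * norm \<nu>" using G[of \<nu> 0 \<xi> \<xi>] \<nu>b b by simp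
        also have "\<dots> \<le> KG * \<delta>" using \<nu> KG by (intro mult_left_mono) auto
        finally show ?thesis .
      qed
      have Fq: "cmod (F \<xi> \<nu>) \<le> q + KF * \<delta>"
        using Fd q(3)[OF \<xi> 3] norm_triangle_ineq2[of "F \<xi> \<nu>" "F \<xi> 0"] by simp
      have 1: "cmod (G \<xi> \<nu>) \<le> g + KG * \<delta>"
        using Gd g norm_triangle_ineq2[of "G \<xi> \<nu>" "G \<xi> 0"] by simp
      have "cmod (1 - G \<xi> 0) = 1 - g"
      proof -
        have "1 - G \<xi> 0 = complex_of_real (1 - g)" using g(1) by simp
        then show ?thesis using g(3) by (simp only: norm_of_real; simp)
      qed
      moreover have "cmod (1 - G \<xi> \<nu>) \<le> cmod (1 - G \<xi> 0) + cmod (G \<xi> \<nu> - G \<xi> 0)"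
        using norm_triangle_ineq4[of "1 - G \<xi> 0" "G \<xi> \<nu> - G \<xi> 0"] by simp
      ultimately have "cmod (G \<xi> \<nu>) + cmod (1 - G \<xi> \<nu>) \<le> 1 + 2 * KG * \<delta>" using 1 Gd by linarith
      then have "cmod (majority n (G \<xi> \<nu>)) \<le> (1 + 2 * KG * \<delta>) ^ n"
        by (intro order_trans[OF norm_majority_le] power_mono) auto
      then have "cmod (F \<xi> \<nu> ^ n * majority n (G \<xi> \<nu>)) \<le> (q + KF * \<delta>) ^ n * (1 + 2 * KG * \<delta>) ^ n"
        unfolding norm_mult norm_power using Fq q(1) KF \<delta>(1) by (intro mult_mono power_mono) auto
      also have "\<dots> = ((q + KF * \<delta>) * (1 + 2 * KG * \<delta>)) ^ n" by (rule power_mult_distrib[symmetric])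
      also have "\<dots> \<le> exp (- (\<epsilon> * real n))"
        using \<delta> q'e q(1) KF KG by (intro small) auto
      finally show ?thesis using S0 by linarith
    qed
  qed
  then show ?thesis using \<epsilon> \<delta>(1) by blast
qed

text \<open>Here the tilt is zero. Near a peak exactly one multiplier is close to \<open>1\<close> and the others are close
  to \<open>0\<close>, so the bracket is exponentially small; away from the peaks the power is.\<close>
lemma pointwise_remainder:
  fixes F :: "real^'d \<Rightarrow> real^'d \<Rightarrow> complex" and G :: "nat \<Rightarrow> real^'d \<Rightarrow> real^'d \<Rightarrow> complex"
  assumes b: "b > 0" and fin: "finite I"
    and G: "\<And>k. k \<in> I \<Longrightarrow> KG k > 0 \<and> (\<forall>\<xi> \<xi>' \<nu> \<nu>'. norm \<nu> \<le> b \<longrightarrow> norm \<nu>' \<le> b \<longrightarrow> cmod (G k \<xi> \<nu> - G k \<xi>' \<nu>') \<le> KG k * (norm (\<xi> - \<xi>') + norm (\<nu> - \<nu>')))"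
    and F1: "\<And>\<xi>. cmod (F \<xi> 0) \<le> 1" and peaks: "\<Lambda> = {\<omega>\<in>closed_torus. cmod (F \<omega> 0) = 1}"
    and Fcont: "continuous_on UNIV (\<lambda>\<xi>. F \<xi> 0)"
    and Gr: "\<And>k \<xi>. k \<in> I \<Longrightarrow> \<exists>g. G k \<xi> 0 = complex_of_real g \<and> 0 \<le> g \<and> g \<le> 1"
    and cover: "\<And>\<omega>. \<omega> \<in> \<Lambda> \<Longrightarrow> \<exists>k\<in>I. G k \<omega> 0 = 1 \<and> (\<forall>l\<in>I - {k}. cmod (G l \<omega> 0) \<le> 1 / 200)"
  shows "\<exists>\<epsilon>>0. \<exists>C>0. \<forall>n. \<forall>\<xi>\<in>closed_torus.
    cmod (F \<xi> 0 ^ n * (1 - (\<Sum>k\<in>I. majority n (G k \<xi> 0)))) \<le> C * exp (- (\<epsilon> * real n))"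
proof -
  have "\<exists>\<delta>>0. \<forall>k\<in>I. KG k * \<delta> \<le> 1 / 200"
  proof -
    define m where "m = Max (insert 1 (KG ` I))"
    have m: "m \<ge> 1" "\<And>k. k \<in> I \<Longrightarrow> KG k \<le> m" using fin by (auto simp: m_def)
    have "KG k * (1 / (200 * m)) \<le> 1 / 200" if "k \<in> I" for k
      using m(1) m(2)[OF that] by (simp add: field_simps)
    then show ?thesis using m(1) by (intro exI[of _ "1 / (200 * m)"]) auto
  qed
  then obtain \<delta> where \<delta>: "\<delta> > 0" "\<And>k. k \<in> I \<Longrightarrow> KG k * \<delta> \<le> 1 / 200" by blast
  obtain q where q: "0 \<le> q" "q < 1" "\<And>\<xi>. \<xi> \<in> closed_torus \<Longrightarrow> (\<forall>\<omega>\<in>\<Lambda>. \<delta> \<le> norm (\<xi> - \<omega>)) \<Longrightarrow> cmod (F \<xi> 0) \<le> q"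
    using gap_off_peaks[OF Fcont F1 \<delta>(1) peaks] by blast
  define r where "r = max q (3 / 10)"
  have r: "0 < r" "r < 1" "q \<le> r" "3 / 10 \<le> r" using q by (auto simp: r_def)
  define C where "C = real (card I) + 1"
  have near: "cmod (G k \<xi> 0 - G k \<omega> 0) \<le> 1 / 200" if "k \<in> I" "norm (\<xi> - \<omega>) < \<delta>" for k \<xi> \<omega>
  proof -
    have "cmod (G k \<xi> 0 - G k \<omega> 0) \<le> KG k * norm (\<xi> - \<omega>)" using G[OF that(1)] b by (metis add.right_neutral diff_self less_imp_le norm_zero)
    also have "\<dots> \<le> KG k * \<delta>" using G[OF that(1)] that(2) by (intro mult_left_mono) auto
    finally show ?thesis using \<delta>(2)[OF that(1)] by linarith
  qed
  have "cmod (F \<xi> 0 ^ n * (1 - (\<Sum>k\<in>I. majority n (G k \<xi> 0)))) \<le> C * r ^ n" if \<xi>: "\<xi> \<in> closed_torus" for n \<xi>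
  proof (cases "\<forall>\<omega>\<in>\<Lambda>. \<delta> \<le> norm (\<xi> - \<omega>)")
    case True
    have "cmod (F \<xi> 0) ^ n \<le> r ^ n" using q(3)[OF \<xi> True] r by (intro power_mono) auto
    moreover have "cmod (1 - (\<Sum>k\<in>I. majority n (G k \<xi> 0))) \<le> C"
    proof -
      have "cmod (majority n (G k \<xi> 0)) \<le> 1" if kI: "k \<in> I" for k
      proof -
        obtain g where g: "G k \<xi> 0 = complex_of_real g" "0 \<le> g" "g \<le> 1" using Gr[OF kI] by blast
        have "1 - G k \<xi> 0 = complex_of_real (1 - g)" using g(1) by simp
        then have "cmod (1 - G k \<xi> 0) = 1 - g" using g(3) by (simp only: norm_of_real; simp)
        then show ?thesis using norm_majority_le[of n "G k \<xi> 0"] g by simp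
      qed
      then have "cmod (\<Sum>k\<in>I. majority n (G k \<xi> 0)) \<le> (\<Sum>k\<in>I. 1)" by (intro order_trans[OF norm_sum] sum_mono)
      then show ?thesis using norm_triangle_ineq4[of 1 "\<Sum>k\<in>I. majority n (G k \<xi> 0)"] by (simp add: C_def)
    qed
    ultimately have "cmod (F \<xi> 0) ^ n * cmod (1 - (\<Sum>k\<in>I. majority n (G k \<xi> 0))) \<le> r ^ n * C"
      using r by (intro mult_mono) auto
    then show ?thesis by (simp add: norm_mult norm_power mult.commute)
  next
    case False
    then obtain \<omega> where \<omega>: "\<omega> \<in> \<Lambda>" "norm (\<xi> - \<omega>) < \<delta>" by auto
    obtain k where k: "k \<in> I" "G k \<omega> 0 = 1" "\<And>l. l \<in> I - {k} \<Longrightarrow> cmod (G l \<omega> 0) \<le> 1 / 200"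
      using cover[OF \<omega>(1)] by blast
    have 1: "cmod (1 - majority n (G k \<xi> 0)) \<le> (3 / 10) ^ n"
      using near[OF k(1) \<omega>(2)] k(2) by (intro majority_near_one) (simp add: norm_minus_commute)
    have 2: "cmod (majority n (G l \<xi> 0)) \<le> (3 / 10) ^ n" if "l \<in> I - {k}" for l
      using near[of l, OF _ \<omega>(2)] k(3)[OF that] that norm_triangle_ineq2[of "G l \<xi> 0" "G l \<omega> 0"]
      by (intro majority_small) auto
    have "(\<Sum>l\<in>I. majority n (G l \<xi> 0)) = majority n (G k \<xi> 0) + (\<Sum>l\<in>I - {k}. majority n (G l \<xi> 0))"
      using fin k(1) by (rule sum.remove)
    then have "1 - (\<Sum>l\<in>I. majority n (G l \<xi> 0)) = (1 - majority n (G k \<xi> 0)) - (\<Sum>l\<in>I - {k}. majority n (G l \<xi> 0))"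
      by simp
    also have "cmod \<dots> \<le> (3 / 10) ^ n + (\<Sum>l\<in>I - {k}. (3 / 10) ^ n)"
      by (rule order_trans[OF norm_triangle_ineq4 add_mono[OF 1 order_trans[OF norm_sum sum_mono[OF 2]]]])
    also have "\<dots> = (1 + real (card (I - {k}))) * (3 / 10) ^ n" by (simp add: algebra_simps)
    also have "\<dots> \<le> C * r ^ n"
      using fin r by (intro mult_mono power_mono) (auto simp: C_def intro: card_mono)
    finally have "cmod (1 - (\<Sum>l\<in>I. majority n (G l \<xi> 0))) \<le> C * r ^ n" .
    moreover have "cmod (F \<xi> 0) ^ n \<le> 1" using F1 by (intro power_le_one) auto
    ultimately have "cmod (F \<xi> 0) ^ n * cmod (1 - (\<Sum>l\<in>I. majority n (G l \<xi> 0))) \<le> 1 * (C * r ^ n)"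
      by (intro mult_mono) auto
    then show ?thesis by (simp add: norm_mult norm_power)
  qed
  moreover have "r ^ n = exp (- (- ln r * real n))" for n
    using r by (simp add: exp_of_nat_mult mult.commute)
  moreover have "- ln r > 0" "C > 0" using r by (auto simp: C_def)
  ultimately show ?thesis by metis
qed

section \<open>The contribution of one peak\<close>

lemma has_integral_shift:
  fixes f :: "real^'d \<Rightarrow> real"
  assumes f: "f \<in> borel_measurable borel" "\<And>x. 0 \<le> f x" "(f has_integral I) UNIV"
  shows "((\<lambda>x. f (x - w)) has_integral I) UNIV"
proof -
  have nn: "integral\<^sup>N lborel f = ennreal I" by (rule nn_integral_has_integral_lborel[OF f])
  have I0: "I \<ge> 0" using f(2) has_integral_nonneg[OF f(3)] by auto
  have shift: "(lborel :: (real^'d) measure) = distr lborel borel ((+) (- w))" by (rule lborel_distr_plus[symmetric])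
  have "ennreal I = integral\<^sup>N (distr lborel borel ((+) (- w))) f"
    using nn shift by (simp only:)
  also have "\<dots> = (\<integral>\<^sup>+x. f (- w + x) \<partial>lborel)"
    by (rule nn_integral_distr) (use f(1) in auto)
  finally have nn': "(\<integral>\<^sup>+x. ennreal (f (x - w)) \<partial>lborel) = ennreal I" by simp
  have m: "(\<lambda>x. f (x - w)) \<in> borel_measurable borel"
    by (rule measurable_compose[OF _ f(1)]) simp
  show ?thesis by (rule nn_integral_has_integral[OF m _ nn' I0]) (rule f(2))
qed

lemma has_integral_const_closed_torus:
  "((\<lambda>_. k) has_integral (2 * pi) ^ CARD('d) * k) (closed_torus :: (real^'d) set)" for k :: real
proof -
  have "((\<lambda>_. 1) has_integral complex_of_real ((2 * pi) ^ CARD('d))) (closed_torus :: (real^'d) set)"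
    using has_integral_tilted_char[of "0::int^'d" 0] by (simp add: tilted_char_0)
  then have "((\<lambda>_. Re 1) has_integral Re (complex_of_real ((2 * pi) ^ CARD('d)))) (closed_torus :: (real^'d) set)"
    by (rule has_integral_Re)
  then have "((\<lambda>_. 1) has_integral (2 * pi) ^ CARD('d)) (closed_torus :: (real^'d) set)" by (simp del: of_real_power)
  from has_integral_mult_left[OF this, of k] show ?thesis by simp
qed

text \<open>Trades half of an exponential rate for an arbitrary power of \<open>n\<close>.\<close>
lemma absorb_power:
  assumes e: "\<epsilon> > 0"
  shows "\<exists>A>0. \<forall>n::nat. n \<ge> 1 \<longrightarrow> exp (- (\<epsilon> * real n)) \<le> A * real n powr (- \<mu>) * exp (- (\<epsilon> / 2 * real n))"
proof -
  define \<eta> where "\<eta> = \<epsilon> / (2 * (\<bar>\<mu>\<bar> + 1))"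
  have \<eta>: "\<eta> > 0" using e by (simp add: \<eta>_def)
  define A where "A = exp (\<bar>\<mu>\<bar> * \<bar>ln \<eta>\<bar>)"
  have "exp (- (\<epsilon> * real n)) \<le> A * real n powr (- \<mu>) * exp (- (\<epsilon> / 2 * real n))" if n: "n \<ge> 1" for n :: nat
  proof -
    have n0: "real n > 0" "ln (real n) \<ge> 0" using n by auto
    have "ln (\<eta> * real n) \<le> \<eta> * real n - 1" by (rule ln_le_minus_one) (use \<eta> n0 in simp)
    then have "ln (real n) \<le> \<eta> * real n + \<bar>ln \<eta>\<bar>" using \<eta> n0 by (simp add: ln_mult)
    then have "\<bar>\<mu>\<bar> * ln (real n) \<le> \<bar>\<mu>\<bar> * (\<eta> * real n + \<bar>ln \<eta>\<bar>)" by (intro mult_left_mono) auto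
    moreover have "\<mu> * ln (real n) \<le> \<bar>\<mu>\<bar> * ln (real n)" using n0 by (intro mult_right_mono) auto
    moreover have "\<bar>\<mu>\<bar> * \<eta> \<le> \<epsilon> / 2" using e by (simp add: \<eta>_def field_simps)
    then have "\<bar>\<mu>\<bar> * \<eta> * real n \<le> \<epsilon> / 2 * real n" using n0 by (intro mult_right_mono) auto
    ultimately have "\<mu> * ln (real n) \<le> \<epsilon> / 2 * real n + \<bar>\<mu>\<bar> * \<bar>ln \<eta>\<bar>" by (simp add: algebra_simps)
    then have "- (\<epsilon> * real n) \<le> \<bar>\<mu>\<bar> * \<bar>ln \<eta>\<bar> + (- \<mu>) * ln (real n) + - (\<epsilon> / 2 * real n)" by simp
    then have "exp (- (\<epsilon> * real n)) \<le> exp (\<bar>\<mu>\<bar> * \<bar>ln \<eta>\<bar> + (- \<mu>) * ln (real n) + - (\<epsilon> / 2 * real n))" by simp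
    also have "\<dots> = A * real n powr (- \<mu>) * exp (- (\<epsilon> / 2 * real n))"
      using n0 by (simp only: exp_add A_def powr_def) simp
    finally show ?thesis .
  qed
  moreover have "A > 0" by (simp add: A_def)
  ultimately show ?thesis by blast
qed

text \<open>The last conjunct says that the target also dominates a prescribed exponentially small quantity; it
  is used to absorb the remainder of the localization.\<close>
lemma peak_contribution:
  fixes \<phi> :: "int^'d \<Rightarrow> complex"
  assumes a: "a > 0" and wt: "weighted a \<phi>" and F1: "\<And>\<xi>. cmod (fourier \<phi> \<xi>) \<le> 1"
    and \<Lambda>: "\<Lambda> = {\<omega>\<in>closed_torus. cmod (fourier \<phi> \<omega>) = 1}" and fin: "finite \<Lambda>"
    and unit: "cmod (fourier \<phi> \<theta>) = 1" and ex: "pos_hom_expansion \<phi> \<theta> \<alpha> P"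
    and G: "tube_series a G" and Gr: "\<And>\<xi>. \<exists>g. G \<xi> 0 = complex_of_real g \<and> 0 \<le> g \<and> g \<le> 1"
    and Gcut: "\<And>\<omega>. \<omega> \<in> \<Lambda> \<Longrightarrow> if cong2pi \<omega> \<theta> then G \<omega> 0 = 1 else cmod (G \<omega> 0) \<le> 1 / 200"
    and L: "L > 0" and e0: "\<epsilon>0 > 0"
    and c: "\<And>n. weighted a (c n)" "\<And>n \<xi> \<nu>. norm \<nu> \<le> a \<Longrightarrow> fourier_tube \<phi> \<xi> \<nu> ^ n * majority n (G \<xi> \<nu>) = fourier_tube (c n) \<xi> \<nu>"
  shows "\<exists>C>0. \<exists>M>0. \<forall>n\<ge>1. \<forall>x. norm (real_vec x) \<le> L * real n \<longrightarrow>
    (let b = C / real n powr hom_order P * exp (- real n * M * legendre (\<lambda>\<eta>. Re (P \<eta>)) ((1 / real n) *\<^sub>R (real_vec x - real n *\<^sub>R \<alpha>)))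
     in cmod (c n x) \<le> b \<and> exp (- (\<epsilon>0 * real n)) \<le> b)"
proof -
  have ph: "pos_hom_polynomial P" using ex by (simp add: pos_hom_expansion_def)
  define E where "E = (SOME E. E \<in> Exp P)"
  have "\<exists>E. E \<in> Exp P" using ph by (auto simp: pos_hom_polynomial_def)
  then have E: "E \<in> Exp P" unfolding E_def by (rule someI_ex)
  have ho: "hom_order P = trace E" by (simp add: hom_order_def E_def)
  define R where "R \<xi> = Re (P \<xi>)" for \<xi>
  interpret homogeneous_flow "\<lambda>t. matrix_rpow t E" R "trace E"
    unfolding R_def[abs_def] by (rule pos_hom_flow[OF ph E])
  obtain \<delta>0 Cl where d0: "\<delta>0 > 0" and Cl: "Cl > 0" and loc: "\<And>\<xi> \<nu>. norm \<xi> \<le> \<delta>0 \<Longrightarrow> norm \<nu> \<le> \<delta>0 \<Longrightarrow>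
    cmod (fourier_tube \<phi> (\<theta> + \<xi>) \<nu>) \<le> exp (- (\<alpha> \<bullet> \<nu>) - R \<xi> / 4 + Cl * R \<nu>)"
    using local_estimate[OF a wt unit ex] unfolding R_def by blast
  define A where "A \<nu> = - (\<alpha> \<bullet> \<nu>) + Cl * R \<nu>" for \<nu>
  define \<Lambda>1 where "\<Lambda>1 = {\<omega>\<in>\<Lambda>. cong2pi \<omega> \<theta>}"
  have fin1: "finite \<Lambda>1" using fin by (simp add: \<Lambda>1_def)
  obtain KF where KF: "KF > 0" "\<And>\<xi> \<xi>' \<nu> \<nu>'. norm \<nu> \<le> a / 2 \<Longrightarrow> norm \<nu>' \<le> a / 2 \<Longrightarrow>
    cmod (fourier_tube \<phi> \<xi> \<nu> - fourier_tube \<phi> \<xi>' \<nu>') \<le> KF * (norm (\<xi> - \<xi>') + norm (\<nu> - \<nu>'))"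
    using fourier_tube_lipschitz[OF a wt] by blast
  obtain KG where KG: "KG > 0" "\<And>\<xi> \<xi>' \<nu> \<nu>'. norm \<nu> \<le> a / 2 \<Longrightarrow> norm \<nu>' \<le> a / 2 \<Longrightarrow>
    cmod (G \<xi> \<nu> - G \<xi>' \<nu>') \<le> KG * (norm (\<xi> - \<xi>') + norm (\<nu> - \<nu>'))"
    using tube_series_lipschitz[OF a G] by blast
  have "\<exists>\<epsilon>>0. \<exists>\<delta>>0. \<forall>n \<nu> \<xi>. norm \<nu> \<le> \<delta> \<longrightarrow> \<xi> \<in> closed_torus \<longrightarrow>
    cmod (fourier_tube \<phi> \<xi> \<nu> ^ n * majority n (G \<xi> \<nu>)) \<le> (\<Sum>\<omega>\<in>\<Lambda>1. 2 * exp (real n * A \<nu>) * exp (- (real n * (\<lambda>\<xi>. R \<xi> / 4) (\<xi> - \<omega>)))) + exp (- (\<epsilon> * real n))"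
  proof (rule pointwise_localized[where b="a/2" and KF=KF and KG=KG and \<Lambda>=\<Lambda> and \<rho>=\<delta>0])
    show "continuous_on UNIV (\<lambda>\<xi>. fourier_tube \<phi> \<xi> 0)" by (rule continuous_on_fourier_tube[OF wt]) (use a in simp)
    show "cmod (fourier_tube \<phi> \<xi> 0) \<le> 1" for \<xi> using F1[of \<xi>] by (simp add: fourier_eq_fourier_tube)
    show "\<Lambda> = {\<omega> \<in> closed_torus. cmod (fourier_tube \<phi> \<omega> 0) = 1}" by (simp add: \<Lambda> fourier_eq_fourier_tube)
    show "G \<omega> 0 = 1" if "\<omega> \<in> \<Lambda>1" for \<omega> using Gcut[of \<omega>] that by (simp add: \<Lambda>1_def)
    show "cmod (G \<omega> 0) \<le> 1 / 200" if "\<omega> \<in> \<Lambda> - \<Lambda>1" for \<omega> using Gcut[of \<omega>] that by (auto simp: \<Lambda>1_def)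
    show "cmod (fourier_tube \<phi> (\<omega> + \<xi>) \<nu>) \<le> exp (A \<nu> - R \<xi> / 4)" if w: "\<omega> \<in> \<Lambda>1" and n: "norm \<xi> \<le> \<delta>0" "norm \<nu> \<le> \<delta>0" for \<omega> \<xi> \<nu>
    proof -
      obtain m where "\<omega> = \<theta> + (2 * pi) *\<^sub>R real_vec m" using w by (auto simp: \<Lambda>1_def cong2pi_def)
      then have "\<omega> + \<xi> = (\<theta> + \<xi>) + (2 * pi) *\<^sub>R real_vec m" by simp
      then have "fourier_tube \<phi> (\<omega> + \<xi>) \<nu> = fourier_tube \<phi> (\<theta> + \<xi>) \<nu>" by (simp only: fourier_tube_periodic)
      then show ?thesis using loc[OF n] by (simp add: A_def algebra_simps)
    qed
  qed (use a KF KG fin Gr d0 in \<open>auto simp: \<Lambda>1_def\<close>)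
  then obtain \<epsilon> \<delta> where \<epsilon>: "\<epsilon> > 0" and \<delta>: "\<delta> > 0" and pw: "\<And>n \<nu> \<xi>. norm \<nu> \<le> \<delta> \<Longrightarrow> \<xi> \<in> closed_torus \<Longrightarrow>
    cmod (fourier_tube \<phi> \<xi> \<nu> ^ n * majority n (G \<xi> \<nu>)) \<le> (\<Sum>\<omega>\<in>\<Lambda>1. 2 * exp (real n * A \<nu>) * exp (- (real n * (R (\<xi> - \<omega>) / 4)))) + exp (- (\<epsilon> * real n))"
    by blast
  obtain C1 where C1: "C1 > 0" "\<And>t. t > 0 \<Longrightarrow> \<exists>I. ((\<lambda>\<xi>. exp (- (t * (1 / 4) * R \<xi>))) has_integral I) UNIV \<and> I \<le> C1 * t powr (- trace E)"
    using integral_exp_R[of "1/4"] by auto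
  define V where "V = (2 * pi) ^ CARD('d)"
  have V: "V > 0" by (simp add: V_def)
  define Cc where "Cc = 2 * C1 * real (card \<Lambda>1)"
  have Cc: "Cc \<ge> 0" using C1 by (simp add: Cc_def)
  have coef: "V * cmod (c n x) \<le> Cc * real n powr (- trace E) * exp (real_vec x \<bullet> \<nu> + real n * A \<nu>) + V * exp (real_vec x \<bullet> \<nu> - \<epsilon> * real n)"
    if n: "n \<ge> 1" and \<nu>: "norm \<nu> \<le> \<delta>" "norm \<nu> \<le> a" for n x \<nu>
  proof -
    let ?e = "\<lambda>\<omega> \<xi>. exp (- (real n * (R (\<xi> - \<omega>) / 4)))"
    have n0: "real n > 0" using n by simp
    obtain I where I: "((\<lambda>\<xi>. exp (- (real n * (1 / 4) * R \<xi>))) has_integral I) UNIV" "I \<le> C1 * real n powr (- trace E)"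
      using C1(2)[OF n0] by blast
    have ti: "?e \<omega> integrable_on closed_torus" and tl: "integral closed_torus (?e \<omega>) \<le> C1 * real n powr (- trace E)" for \<omega>
    proof -
      have "continuous_on UNIV (\<lambda>\<xi>. exp (- (real n * (1 / 4) * R \<xi>)))" by (intro continuous_intros R_cont)
      then have m: "(\<lambda>\<xi>. exp (- (real n * (1 / 4) * R \<xi>))) \<in> borel_measurable borel" by (rule borel_measurable_continuous_onI)
      have h: "(?e \<omega> has_integral I) UNIV"
        using has_integral_shift[OF m _ I(1), of \<omega>] by simp
      have cU: "continuous_on UNIV (?e \<omega>)"
        by (intro continuous_intros continuous_on_compose2[OF R_cont]) auto
      show i: "?e \<omega> integrable_on closed_torus"
        unfolding closed_torus_def by (rule integrable_continuous) (rule continuous_on_subset[OF cU subset_UNIV])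
      have "integral closed_torus (?e \<omega>) \<le> integral UNIV (?e \<omega>)"
        by (rule integral_subset_le) (use i h in auto)
      also have "\<dots> = I" using h by (rule integral_unique)
      finally show "integral closed_torus (?e \<omega>) \<le> C1 * real n powr (- trace E)" using I(2) by simp
    qed
    let ?k = "2 * exp (real n * A \<nu>)"
    have gi: "((\<lambda>\<xi>. (\<Sum>\<omega>\<in>\<Lambda>1. ?k * ?e \<omega> \<xi>) + exp (- (\<epsilon> * real n))) has_integral
       (\<Sum>\<omega>\<in>\<Lambda>1. ?k * integral closed_torus (?e \<omega>)) + V * exp (- (\<epsilon> * real n))) closed_torus"
      unfolding V_def by (intro has_integral_add has_integral_sum fin1 has_integral_mult_right integrable_integral ti has_integral_const_closed_torus)
    have "V * cmod (c n x) \<le> exp (real_vec x \<bullet> \<nu>) * ((\<Sum>\<omega>\<in>\<Lambda>1. ?k * integral closed_torus (?e \<omega>)) + V * exp (- (\<epsilon> * real n)))"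
      unfolding V_def
      by (rule coefficient_bound[OF c(1) \<nu>(2) gi[unfolded V_def]]) (use pw[OF \<nu>(1)] c(2)[OF \<nu>(2)] in simp)
    also have "\<dots> \<le> exp (real_vec x \<bullet> \<nu>) * ((\<Sum>\<omega>\<in>\<Lambda>1. ?k * (C1 * real n powr (- trace E))) + V * exp (- (\<epsilon> * real n)))"
      using V by (intro mult_left_mono add_mono sum_mono tl) auto
    also have "\<dots> = Cc * real n powr (- trace E) * (exp (real_vec x \<bullet> \<nu>) * exp (real n * A \<nu>)) + V * (exp (real_vec x \<bullet> \<nu>) * exp (- (\<epsilon> * real n)))"
      by (simp add: Cc_def algebra_simps)
    finally show ?thesis by (simp only: exp_add[symmetric] diff_conv_add_uminus)
  qed
  define L' where "L' = L + norm \<alpha>"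
  have L': "L' > 0" using L by (simp add: L'_def add_pos_nonneg)
  obtain B B' where B: "B > 0" "B' > 0" and leg: "\<And>w. norm w \<le> L' \<Longrightarrow> 0 \<le> legendre R w \<and> legendre R w \<le> B \<and>
     (\<exists>\<zeta>. norm \<zeta> \<le> B' \<and> legendre R w / 2 \<le> w \<bullet> \<zeta> - R \<zeta>)"
    using legendre_bounds[OF L'] by blast
  obtain Ks s1 where Ks: "Ks > 0" "s1 > 0" "\<And>s \<zeta>. \<bar>s\<bar> \<le> s1 \<Longrightarrow> R (s *\<^sub>R \<zeta>) \<le> Ks * s\<^sup>2 * R \<zeta>"
    using R_small_multiple by blast
  \<comment> \<open>The scale \<open>s\<close> is small enough for: the quadratic bound on \<open>R (- s \<zeta>)\<close>; \<open>Cl * R (- s \<zeta>) \<le> s * R \<zeta>\<close>;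
    an admissible tilt; a loss from \<open>exp (x \<bullet> \<nu>)\<close> of at most half the rate \<open>\<epsilon>\<close>.\<close>
  define s where "s = min (min s1 (1 / (Cl * Ks))) (min (min \<delta> a / B') (\<epsilon> / (2 * L * B')))"
  have s: "s > 0" "s \<le> s1" "s \<le> 1 / (Cl * Ks)" "s \<le> min \<delta> a / B'" "s \<le> \<epsilon> / (2 * L * B')"
    using Ks Cl \<delta> a B \<epsilon> L by (auto simp: s_def)
  have sB: "s * B' \<le> \<delta>" "s * B' \<le> a" "L * (s * B') \<le> \<epsilon> / 2" "Cl * Ks * s \<le> 1"
    using s B Cl Ks L by (auto simp: field_simps)
  define \<epsilon>1 where "\<epsilon>1 = min (\<epsilon> / 2) \<epsilon>0"
  have \<epsilon>1: "\<epsilon>1 > 0" "\<epsilon>1 \<le> \<epsilon> / 2" "\<epsilon>1 \<le> \<epsilon>0" using \<epsilon> e0 by (auto simp: \<epsilon>1_def)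
  \<comment> \<open>The second bound lets \<open>exp (- n * M * legendre R w)\<close> dominate the exponentially small errors.\<close>
  define M where "M = min (s / 2) (\<epsilon>1 / (2 * B))"
  have M: "M > 0" "M \<le> s / 2" "M * B \<le> \<epsilon>1 / 2" using s \<epsilon>1 B by (auto simp: M_def min_def field_simps)
  obtain A1 where A1: "A1 > 0" "\<And>n::nat. n \<ge> 1 \<Longrightarrow> exp (- (\<epsilon>1 * real n)) \<le> A1 * real n powr (- trace E) * exp (- (\<epsilon>1 / 2 * real n))"
    using absorb_power[OF \<epsilon>1(1)] by blast
  define C where "C = Cc / V + A1"
  have C: "C > 0" using Cc V A1 by (simp add: C_def add_nonneg_pos)
  have "cmod (c n x) \<le> C * real n powr (- trace E) * exp (- real n * M * legendre R ((1 / real n) *\<^sub>R (real_vec x - real n *\<^sub>R \<alpha>))) \<and>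
        exp (- (\<epsilon>0 * real n)) \<le> C * real n powr (- trace E) * exp (- real n * M * legendre R ((1 / real n) *\<^sub>R (real_vec x - real n *\<^sub>R \<alpha>)))"
    if n: "n \<ge> 1" and x: "norm (real_vec x) \<le> L * real n" for n x
  proof -
    define w where "w = (1 / real n) *\<^sub>R (real_vec x - real n *\<^sub>R \<alpha>)"
    have n0: "real n > 0" using n by simp
    have xw: "real_vec x = real n *\<^sub>R (w + \<alpha>)" using n0 by (simp add: w_def scaleR_right_distrib)
    have "norm w \<le> L'"
    proof -
      have "w = (1 / real n) *\<^sub>R real_vec x - \<alpha>" using n0 by (simp add: w_def scaleR_right_diff_distrib)
      then have "norm w \<le> norm (real_vec x) / real n + norm \<alpha>" using norm_triangle_ineq4[of "(1 / real n) *\<^sub>R real_vec x" \<alpha>] by simp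
      also have "norm (real_vec x) / real n \<le> L" using x n0 by (simp add: field_simps)
      finally show ?thesis by (simp add: L'_def)
    qed
    from leg[OF this] obtain \<zeta> where lg: "0 \<le> legendre R w" "legendre R w \<le> B" and \<zeta>: "norm \<zeta> \<le> B'" "legendre R w / 2 \<le> w \<bullet> \<zeta> - R \<zeta>"
      by blast
    define \<nu> where "\<nu> = (- s) *\<^sub>R \<zeta>"
    have ns: "norm \<nu> \<le> s * B'" using \<zeta> s by (simp add: \<nu>_def)
    then have \<nu>: "norm \<nu> \<le> \<delta>" "norm \<nu> \<le> a" using sB by auto
    have "L * norm \<nu> \<le> L * (s * B')" using ns L by (intro mult_left_mono) auto
    then have \<nu>3: "L * norm \<nu> \<le> \<epsilon> / 2" using sB(3) by linarith
    have expo: "real_vec x \<bullet> \<nu> + real n * A \<nu> \<le> - real n * (s / 2) * legendre R w"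
    proof -
      have "Cl * R \<nu> \<le> Cl * (Ks * s\<^sup>2 * R \<zeta>)"
        using Ks(3)[of "- s" \<zeta>] s Cl by (intro mult_left_mono) (auto simp: \<nu>_def)
      also have "\<dots> = (Cl * Ks * s) * (s * R \<zeta>)" by (simp add: power2_eq_square)
      also have "\<dots> \<le> 1 * (s * R \<zeta>)" using sB(4) s R_nonneg[of \<zeta>] by (intro mult_right_mono) auto
      finally have "w \<bullet> \<nu> + Cl * R \<nu> \<le> - (s * (w \<bullet> \<zeta> - R \<zeta>))" by (simp add: \<nu>_def algebra_simps)
      also have "\<dots> \<le> - (s * (legendre R w / 2))" using \<zeta>(2) s by simp
      finally have "real n * (w \<bullet> \<nu> + Cl * R \<nu>) \<le> real n * - (s * (legendre R w / 2))" by (rule mult_left_mono) simp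
      moreover have "real_vec x \<bullet> \<nu> + real n * A \<nu> = real n * (w \<bullet> \<nu> + Cl * R \<nu>)"
        by (simp add: xw A_def inner_add_left algebra_simps)
      ultimately show ?thesis by simp
    qed
    have xnu: "real_vec x \<bullet> \<nu> \<le> \<epsilon> / 2 * real n"
    proof -
      have "real_vec x \<bullet> \<nu> \<le> norm (real_vec x) * norm \<nu>" by (rule norm_cauchy_schwarz)
      also have "\<dots> \<le> (L * real n) * norm \<nu>" using x by (intro mult_right_mono) auto
      also have "\<dots> = (L * norm \<nu>) * real n" by simp
      also have "\<dots> \<le> \<epsilon> / 2 * real n" using \<nu>3 by (intro mult_right_mono) auto
      finally show ?thesis .
    qed
    let ?p = "real n powr (- trace E)"
    let ?l = "exp (- real n * M * legendre R w)"
    have l1: "exp (real_vec x \<bullet> \<nu> + real n * A \<nu>) \<le> ?l"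
    proof -
      have "real n * (M * legendre R w) \<le> real n * (s / 2 * legendre R w)"
        using M(2) lg n0 by (intro mult_left_mono mult_right_mono) auto
      then show ?thesis using expo by simp
    qed
    have l2: "exp (- (\<epsilon>1 / 2 * real n)) \<le> ?l"
    proof -
      have "M * legendre R w \<le> M * B" using lg M by simp
      then have "real n * (M * legendre R w) \<le> real n * (\<epsilon>1 / 2)" using M(3) n0 by (intro mult_left_mono) auto
      then show ?thesis by (simp add: mult_ac)
    qed
    have e1: "exp (- (\<epsilon>1 * real n)) \<le> A1 * ?p * ?l"
    proof -
      have "A1 * ?p * exp (- (\<epsilon>1 / 2 * real n)) \<le> A1 * ?p * ?l" using l2 A1(1) by (intro mult_left_mono) auto
      then show ?thesis using A1(2)[OF n] by linarith
    qed
    have e2: "exp (real_vec x \<bullet> \<nu> - \<epsilon> * real n) \<le> exp (- (\<epsilon>1 * real n))"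
    proof -
      have "\<epsilon>1 * real n \<le> \<epsilon> / 2 * real n" using \<epsilon>1 by (intro mult_right_mono) auto
      then show ?thesis using xnu by simp
    qed
    have AC: "A1 * ?p * ?l \<le> C * ?p * ?l"
      unfolding C_def using Cc V by (intro mult_right_mono) auto
    have "V * cmod (c n x) \<le> Cc * ?p * ?l + V * (A1 * ?p * ?l)"
      by (rule order_trans[OF coef[OF n \<nu>(1,2)]], intro add_mono mult_left_mono l1 order_trans[OF e2 e1]) (use Cc V in auto)
    also have "\<dots> = V * (C * ?p * ?l)" using V by (simp add: C_def field_simps)
    finally have "cmod (c n x) \<le> C * ?p * ?l" using V by simp
    moreover have "exp (- (\<epsilon>0 * real n)) \<le> C * ?p * ?l"
    proof -
      have "exp (- (\<epsilon>0 * real n)) \<le> exp (- (\<epsilon>1 * real n))" using \<epsilon>1 by (simp add: mult_right_mono)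
      then show ?thesis using e1 AC by linarith
    qed
    ultimately show ?thesis by (simp add: w_def)
  qed
  then show ?thesis
    unfolding Let_def ho R_def[abs_def, symmetric] divide_inverse powr_minus[symmetric]
    using C M(1) by (intro exI[of _ C] exI[of _ M] conjI) (auto simp: R_def[abs_def] inverse_eq_divide)
qed

section \<open>Points far from the origin\<close>

text \<open>With the tilt of length \<open>a\<close> against \<open>x\<close> the bound is \<open>exp (- a * norm x) * A ^ n\<close>. The constant \<open>L\<close>
  is chosen so that half of the first factor beats \<open>A ^ n\<close> and leaves \<open>exp (- a * n)\<close>.\<close>
lemma far_field:
  fixes \<phi> :: "int^'d \<Rightarrow> complex"
  assumes a: "a > 0" and wt: "weighted a \<phi>" and unit: "cmod (fourier \<phi> \<theta>) = 1"
  shows "\<exists>L>0. \<forall>n\<ge>1. \<forall>x. norm (real_vec x) > L * real n \<longrightarrow>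
    cmod (conv_power \<phi> n x) \<le> exp (- (a / 2) * (real n + norm (real_vec x)))"
proof -
  define A where "A = (\<Sum>\<^sub>\<infinity>x. cmod (\<phi> x) * exp (a * norm (real_vec x)))"
  have A: "cmod (fourier_tube \<phi> \<xi> \<nu>) \<le> A" if "norm \<nu> \<le> a" for \<xi> \<nu>
    unfolding A_def by (rule norm_fourier_tube_le[OF wt that])
  have A1: "A \<ge> 1" using A[of 0 \<theta>] unit a by (simp add: fourier_eq_fourier_tube)
  define L where "L = 2 * (ln A + a) / a"
  have lnA: "ln A \<ge> 0" using A1 by simp
  have L: "L > 0" using lnA a by (simp add: L_def)
  have "cmod (conv_power \<phi> n x) \<le> exp (- (a / 2) * (real n + norm (real_vec x)))"
    if n: "n \<ge> 1" and x: "norm (real_vec x) > L * real n" for n x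
  proof -
    let ?r = "norm (real_vec x)"
    have r: "?r > 0" using x L by (meson le_less_trans mult_nonneg_nonneg of_nat_0_le_iff less_imp_le)
    define \<nu> where "\<nu> = (- a / ?r) *\<^sub>R real_vec x"
    have \<nu>: "norm \<nu> \<le> a" using r a by (simp add: \<nu>_def)
    have xn: "real_vec x \<bullet> \<nu> = - (a * ?r)" using r by (simp add: \<nu>_def dot_square_norm power2_eq_square)
    have cw: "weighted a (conv_power \<phi> n)" "\<And>\<xi>. fourier_tube (conv_power \<phi> n) \<xi> \<nu> = fourier_tube \<phi> \<xi> \<nu> ^ n"
      using conv_power_weighted[OF _ wt n] a \<nu> by auto
    have "(2 * pi) ^ CARD('d) * cmod (conv_power \<phi> n x) \<le> exp (real_vec x \<bullet> \<nu>) * ((2 * pi) ^ CARD('d) * A ^ n)"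
      by (rule coefficient_bound[OF cw(1) \<nu> has_integral_const_closed_torus]) (use A[OF \<nu>] in \<open>auto simp: cw(2) norm_power intro: power_mono\<close>)
    then have "cmod (conv_power \<phi> n x) \<le> exp (- (a * ?r)) * A ^ n" by (simp add: xn mult.left_commute)
    also have "A ^ n = exp (real n * ln A)" using A1 by (simp add: exp_of_nat_mult)
    also have "exp (- (a * ?r)) * exp (real n * ln A) = exp (- (a * ?r) + real n * ln A)" by (rule exp_add[symmetric])
    also have "\<dots> \<le> exp (- (a / 2) * (real n + ?r))"
    proof -
      have "a / 2 * ?r \<ge> a / 2 * (L * real n)" using x a by (intro mult_left_mono) auto
      moreover have "a / 2 * (L * real n) = real n * (ln A + a)" using a by (simp add: L_def field_simps)
      moreover have "real n * a \<ge> a / 2 * real n" using a by simp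
      ultimately show ?thesis by (simp add: algebra_simps)
    qed
    finally show ?thesis .
  qed
  then show ?thesis using L by blast
qed

section \<open>Peaks on the torus\<close>

lemma torus_subset_closed_torus: "torus \<subseteq> closed_torus"
  by (auto simp: torus_def closed_torus_def mem_box_cart less_imp_le)

lemma torus_cong2pi_unique:
  assumes "u \<in> torus" "v \<in> torus" "cong2pi u v"
  shows "u = v"
proof -
  obtain m where m: "u = v + (2 * pi) *\<^sub>R real_vec m" using assms(3) by (auto simp: cong2pi_def)
  have "m $ i = 0" for i
  proof -
    have e: "u $ i = v $ i + 2 * pi * real_of_int (m $ i)" using m by (simp add: real_vec_def)
    have "- pi < u $ i" "u $ i \<le> pi" "- pi < v $ i" "v $ i \<le> pi" using assms(1,2) by (auto simp: torus_def)
    then have "2 * pi * real_of_int (m $ i) < 2 * pi * 1" "2 * pi * (- 1) < 2 * pi * real_of_int (m $ i)"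
      using e by linarith+
    then have "real_of_int (m $ i) < 1" "- 1 < real_of_int (m $ i)" by (simp_all only: mult_less_cancel_left_pos pi_gt_zero mult_pos_pos zero_less_numeral)
    then show ?thesis by linarith
  qed
  then have "m = 0" by (simp add: vec_eq_iff)
  then show ?thesis using m by (simp add: real_vec_0)
qed

lemma cong2pi_sym: "cong2pi u v \<Longrightarrow> cong2pi v u"
proof -
  assume "cong2pi u v"
  then obtain m where "u = v + (2 * pi) *\<^sub>R real_vec m" by (auto simp: cong2pi_def)
  then have "v = u + (2 * pi) *\<^sub>R real_vec (- m)" by (simp add: real_vec_minus)
  then show ?thesis unfolding cong2pi_def by blast
qed

lemma cong2pi_trans: "cong2pi u v \<Longrightarrow> cong2pi v w \<Longrightarrow> cong2pi u w"
proof -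
  assume "cong2pi u v" "cong2pi v w"
  then obtain m m' where "u = v + (2 * pi) *\<^sub>R real_vec m" "v = w + (2 * pi) *\<^sub>R real_vec m'" by (auto simp: cong2pi_def)
  then have "u = w + (2 * pi) *\<^sub>R real_vec (m' + m)" by (simp add: real_vec_add scaleR_right_distrib)
  then show ?thesis unfolding cong2pi_def by blast
qed

lemma fourier_cong2pi: "cong2pi u v \<Longrightarrow> fourier \<phi> u = fourier \<phi> v"
  by (auto simp: cong2pi_def fourier_periodic)

lemma torus_representative: "\<exists>v\<in>torus. cong2pi u v"
  using shift_into_torus[of u] cong2pi_sym unfolding cong2pi_def by blast

text \<open>The supremum over the half-open torus is a supremum over all real points by periodicity, and it is
  attained on the closed torus.\<close>
lemma H_star_bound:
  assumes "\<phi> \<in> H_star"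
  shows "cmod (fourier \<phi> \<xi>) \<le> 1" and "Omega \<phi> \<noteq> {}"
proof -
  have H: "\<phi> \<in> H_class" and sup: "(SUP \<xi>\<in>torus. cmod (fourier \<phi> \<xi>)) = 1" using assms by (auto simp: H_star_def)
  have w0: "weighted 0 \<phi>" using H by (simp add: H_class_def weighted_def)
  have bdd: "bdd_above ((\<lambda>\<xi>. cmod (fourier \<phi> \<xi>)) ` torus)"
    using norm_fourier_tube_le[OF w0, of 0] by (auto simp: bdd_above_def fourier_eq_fourier_tube)
  have le1: "cmod (fourier \<phi> \<xi>) \<le> 1" for \<xi>
  proof -
    obtain v where v: "v \<in> torus" "cong2pi \<xi> v" using torus_representative by blast
    have "cmod (fourier \<phi> v) \<le> (SUP \<xi>\<in>torus. cmod (fourier \<phi> \<xi>))" by (rule cSUP_upper[OF v(1) bdd])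
    then show ?thesis using sup fourier_cong2pi[OF v(2)] by simp
  qed
  then show "cmod (fourier \<phi> \<xi>) \<le> 1" .
  have "continuous_on closed_torus (\<lambda>\<xi>. cmod (fourier \<phi> \<xi>))"
    unfolding fourier_eq_fourier_tube by (intro continuous_on_norm continuous_on_fourier_tube[OF w0]) simp
  moreover have "(0 :: real^'a) \<in> closed_torus" by (simp add: closed_torus_def mem_box_cart)
  ultimately obtain z where z: "\<And>\<xi>. \<xi> \<in> closed_torus \<Longrightarrow> cmod (fourier \<phi> \<xi>) \<le> cmod (fourier \<phi> z)"
    using continuous_attains_sup[OF compact_closed_torus, of "\<lambda>\<xi>. cmod (fourier \<phi> \<xi>)"] by blast
  have "(0 :: real^'a) \<in> torus" by (simp add: torus_def)
  then have "1 \<le> cmod (fourier \<phi> z)"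
    unfolding sup[symmetric] using z torus_subset_closed_torus by (intro cSUP_least) auto
  then have z1: "cmod (fourier \<phi> z) = 1" using le1[of z] by simp
  obtain v where v: "v \<in> torus" "cong2pi z v" using torus_representative by blast
  then have "v \<in> Omega \<phi>" using z1 fourier_cong2pi[OF v(2), of \<phi>] by (simp add: Omega_def)
  then show "Omega \<phi> \<noteq> {}" by blast
qed

text \<open>By the local estimate without tilt every peak is isolated, and the set of peaks in the closed torus is
  compact.\<close>
lemma finite_peaks:
  fixes \<phi> :: "int^'d \<Rightarrow> complex"
  assumes a: "a > 0" and wt: "weighted a \<phi>" and type: "\<forall>\<xi>0\<in>Omega \<phi>. pos_hom_type \<phi> \<xi>0"
  shows "finite {\<omega>\<in>closed_torus. cmod (fourier \<phi> \<omega>) = 1}" (is "finite ?\<Lambda>")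
proof (rule ccontr)
  assume inf: "infinite ?\<Lambda>"
  have "continuous_on UNIV (\<lambda>\<xi>. cmod (fourier \<phi> \<xi>))"
    unfolding fourier_eq_fourier_tube by (intro continuous_on_norm continuous_on_fourier_tube[OF wt]) (use a in simp)
  then have "closed ((\<lambda>\<xi>. cmod (fourier \<phi> \<xi>)) -` {1})" by (intro closed_vimage) auto
  then have "compact (closed_torus \<inter> (\<lambda>\<xi>. cmod (fourier \<phi> \<xi>)) -` {1})" by (intro compact_Int_closed compact_closed_torus)
  moreover have "closed_torus \<inter> (\<lambda>\<xi>. cmod (fourier \<phi> \<xi>)) -` {1} = ?\<Lambda>" by auto
  ultimately have "compact ?\<Lambda>" by simp
  then obtain \<omega> where \<omega>: "\<omega> \<in> ?\<Lambda>" "\<omega> islimpt ?\<Lambda>"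
    using inf by (meson Heine_Borel_imp_Bolzano_Weierstrass order_refl)
  obtain v where v: "v \<in> torus" "cong2pi \<omega> v" using torus_representative by blast
  have v1: "cmod (fourier \<phi> v) = 1" using \<omega>(1) fourier_cong2pi[OF v(2), of \<phi>] by simp
  then have "v \<in> Omega \<phi>" using v(1) by (simp add: Omega_def)
  then obtain \<alpha> P where ex: "pos_hom_expansion \<phi> v \<alpha> P" using type by (auto simp: pos_hom_type_def)
  then have ph: "pos_hom_polynomial P" by (simp add: pos_hom_expansion_def)
  obtain \<delta> C where \<delta>: "\<delta> > 0" and loc: "\<And>\<xi> \<nu>. norm \<xi> \<le> \<delta> \<Longrightarrow> norm \<nu> \<le> \<delta> \<Longrightarrow>
    cmod (fourier_tube \<phi> (v + \<xi>) \<nu>) \<le> exp (- (\<alpha> \<bullet> \<nu>) - Re (P \<xi>) / 4 + C * Re (P \<nu>))"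
    using local_estimate[OF a wt v1 ex] by blast
  obtain \<omega>' where \<omega>': "\<omega>' \<in> ?\<Lambda>" "\<omega>' \<noteq> \<omega>" "dist \<omega>' \<omega> < \<delta>"
    using \<omega>(2) \<delta> unfolding islimpt_approachable by blast
  define \<xi> where "\<xi> = \<omega>' - \<omega>"
  have \<xi>: "\<xi> \<noteq> 0" "norm \<xi> \<le> \<delta>" using \<omega>' by (auto simp: \<xi>_def dist_norm)
  obtain E where E: "E \<in> Exp P" using ph by (auto simp: pos_hom_polynomial_def)
  have "P 0 = 0" using Exp_homogeneous[OF E, of 2 0] by simp
  then have "cmod (fourier \<phi> (v + \<xi>)) \<le> exp (- (Re (P \<xi>) / 4))"
    using loc[OF \<xi>(2), of 0] \<delta> by (simp add: fourier_eq_fourier_tube)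
  also have "\<dots> < 1"
  proof -
    have "Re (P \<xi>) \<ge> 0" "Re (P \<xi>) \<noteq> 0" using ph \<xi>(1) by (auto simp: pos_hom_polynomial_def)
    then show ?thesis by simp
  qed
  finally have "cmod (fourier \<phi> (v + \<xi>)) < 1" .
  moreover have "cong2pi \<omega>' (v + \<xi>)"
  proof -
    obtain m where "\<omega> = v + (2 * pi) *\<^sub>R real_vec m" using v(2) by (auto simp: cong2pi_def)
    then have "\<omega>' = (v + \<xi>) + (2 * pi) *\<^sub>R real_vec m" by (simp add: \<xi>_def)
    then show ?thesis unfolding cong2pi_def by blast
  qed
  ultimately show False using \<omega>'(1) fourier_cong2pi[of \<omega>' "v + \<xi>" \<phi>] by simp
qed

section \<open>The global bound\<close>

theorem theorem1p8:
  fixes \<phi> :: "int ^ 'd \<Rightarrow> complex"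
  assumes "\<phi> \<in> H_star"
    and "\<forall>\<xi>0\<in>Omega \<phi>. pos_hom_type \<phi> \<xi>0"
  shows "finite (Omega \<phi>) \<and>
    (\<forall>(K::nat) (\<xi> :: nat \<Rightarrow> real ^ 'd) (\<alpha> :: nat \<Rightarrow> real ^ 'd) (P :: nat \<Rightarrow> real ^ 'd \<Rightarrow> complex).
       bij_betw \<xi> {1..K} (Omega \<phi>) \<longrightarrow>
       (\<forall>k\<in>{1..K}. pos_hom_expansion \<phi> (\<xi> k) (\<alpha> k) (P k)) \<longrightarrow>
       (\<exists>(L::real) (M :: nat \<Rightarrow> real) (C :: nat \<Rightarrow> real).
          L > 0 \<and> (\<forall>k\<in>{0..K}. M k > 0) \<and> (\<forall>k\<in>{1..K}. C k > 0) \<and>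
          (\<forall>n\<ge>1. \<forall>x :: int ^ 'd.
             cmod (conv_power \<phi> n x) \<le>
               (if norm (real_vec x) > L * real n
                then exp (- M 0 * (real n + norm (real_vec x)))
                else (\<Sum>k=1..K. C k / real n powr hom_order (P k) *
                        exp (- real n * M k *
                          legendre (\<lambda>\<eta>. Re (P k \<eta>))
                            ((1 / real n) *\<^sub>R (real_vec x - real n *\<^sub>R \<alpha> k))))))))"
proof -
  have H: "\<phi> \<in> H_class" using assms(1) by (simp add: H_star_def)
  obtain a where a: "a > 0" and wt: "weighted a \<phi>" using H_class_weighted[OF H] by blast
  note F1 = H_star_bound(1)[OF assms(1)]
  define \<Lambda> where "\<Lambda> = {\<omega>\<in>closed_torus. cmod (fourier \<phi> \<omega>) = 1}"
  have fin: "finite \<Lambda>" unfolding \<Lambda>_def by (rule finite_peaks[OF a wt assms(2)])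
  have "Omega \<phi> \<subseteq> \<Lambda>" using torus_subset_closed_torus by (auto simp: Omega_def \<Lambda>_def)
  then have finO: "finite (Omega \<phi>)" using fin finite_subset by blast
  have main: "\<exists>(L::real) (M :: nat \<Rightarrow> real) (C :: nat \<Rightarrow> real).
          L > 0 \<and> (\<forall>k\<in>{0..K}. M k > 0) \<and> (\<forall>k\<in>{1..K}. C k > 0) \<and>
          (\<forall>n\<ge>1. \<forall>x :: int ^ 'd.
             cmod (conv_power \<phi> n x) \<le>
               (if norm (real_vec x) > L * real n
                then exp (- M 0 * (real n + norm (real_vec x)))
                else (\<Sum>k=1..K. C k / real n powr hom_order (P k) *
                        exp (- real n * M k *
                          legendre (\<lambda>\<eta>. Re (P k \<eta>))
                            ((1 / real n) *\<^sub>R (real_vec x - real n *\<^sub>R \<alpha> k))))))"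
    if bij: "bij_betw \<xi> {1..K} (Omega \<phi>)" and exps: "\<forall>k\<in>{1..K}. pos_hom_expansion \<phi> (\<xi> k) (\<alpha> k) (P k)"
    for K :: nat and \<xi> \<alpha> :: "nat \<Rightarrow> real^'d" and P :: "nat \<Rightarrow> real^'d \<Rightarrow> complex"
  proof -
    have K1: "K \<ge> 1"
    proof (rule ccontr)
      assume "\<not> K \<ge> 1"
      then have "{1..K} = {}" by simp
      then have "Omega \<phi> = {}" using bij by (simp add: bij_betw_def)
      then show False using H_star_bound(2)[OF assms(1)] by simp
    qed
    have \<xi>in: "\<xi> k \<in> Omega \<phi>" if "k \<in> {1..K}" for k using bij that by (auto simp: bij_betw_def)
    have \<xi>t: "\<xi> k \<in> torus" "cmod (fourier \<phi> (\<xi> k)) = 1" if "k \<in> {1..K}" for k using \<xi>in[OF that] by (auto simp: Omega_def)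
    have uniq: "k = l" if "k \<in> {1..K}" "l \<in> {1..K}" "cong2pi (\<xi> k) (\<xi> l)" for k l
    proof -
      have "\<xi> k = \<xi> l"
        by (rule torus_cong2pi_unique[OF \<xi>t(1)[OF that(1)] \<xi>t(1)[OF that(2)] that(3)])
      then show ?thesis using inj_onD[OF bij_betw_imp_inj_on[OF bij]] that(1,2) by blast
    qed
    have "\<forall>k. \<exists>G. tube_series a G \<and> (\<forall>\<zeta>. \<exists>g. G \<zeta> 0 = complex_of_real g \<and> 0 \<le> g \<and> g \<le> 1) \<and>
      (\<forall>\<omega>\<in>\<Lambda>. if cong2pi \<omega> (\<xi> k) then G \<omega> 0 = 1 else cmod (G \<omega> 0) \<le> 1 / 200)"
      using cutoff_exists[OF less_imp_le[OF a] fin, of "1 / 200"] by simp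
    from choice[OF this] obtain G where GG: "\<forall>k. tube_series a (G k) \<and> (\<forall>\<zeta>. \<exists>g. G k \<zeta> 0 = complex_of_real g \<and> 0 \<le> g \<and> g \<le> 1) \<and>
      (\<forall>\<omega>\<in>\<Lambda>. if cong2pi \<omega> (\<xi> k) then G k \<omega> 0 = 1 else cmod (G k \<omega> 0) \<le> 1 / 200)" ..
    then have G: "\<And>k. tube_series a (G k)" "\<And>k \<zeta>. \<exists>g. G k \<zeta> 0 = complex_of_real g \<and> 0 \<le> g \<and> g \<le> 1"
      "\<And>k \<omega>. \<omega> \<in> \<Lambda> \<Longrightarrow> if cong2pi \<omega> (\<xi> k) then G k \<omega> 0 = 1 else cmod (G k \<omega> 0) \<le> 1 / 200"
      by blast+
    have "tube_series a (\<lambda>\<zeta> \<nu>. fourier_tube \<phi> \<zeta> \<nu> ^ n * majority n (G k \<zeta> \<nu>))" for n k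
      by (intro tube_series_mult tube_series_power tube_series_fourier_tube tube_series_majority G(1) wt) (use a in auto)
    then have "\<forall>kn. \<exists>c. weighted a c \<and> (\<forall>\<zeta> \<nu>. norm \<nu> \<le> a \<longrightarrow> fourier_tube \<phi> \<zeta> \<nu> ^ snd kn * majority (snd kn) (G (fst kn) \<zeta> \<nu>) = fourier_tube c \<zeta> \<nu>)"
      unfolding tube_series_def by blast
    from choice[OF this] obtain c' where c': "\<forall>kn. weighted a (c' kn) \<and> (\<forall>\<zeta> \<nu>. norm \<nu> \<le> a \<longrightarrow> fourier_tube \<phi> \<zeta> \<nu> ^ snd kn * majority (snd kn) (G (fst kn) \<zeta> \<nu>) = fourier_tube (c' kn) \<zeta> \<nu>)" ..
    define c where "c k n = c' (k, n)" for k n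
    have c: "\<And>k n. weighted a (c k n)" "\<And>k n \<zeta> \<nu>. norm \<nu> \<le> a \<Longrightarrow> fourier_tube \<phi> \<zeta> \<nu> ^ n * majority n (G k \<zeta> \<nu>) = fourier_tube (c k n) \<zeta> \<nu>"
    proof -
      show "weighted a (c k n)" for k n using c' by (simp add: c_def)
      show "fourier_tube \<phi> \<zeta> \<nu> ^ n * majority n (G k \<zeta> \<nu>) = fourier_tube (c k n) \<zeta> \<nu>" if "norm \<nu> \<le> a" for k n \<zeta> \<nu>
        using c'[rule_format, of "(k, n)"] that by (simp add: c_def)
    qed
    define rem where "rem n \<zeta> \<nu> = fourier_tube \<phi> \<zeta> \<nu> ^ n * (1 - (\<Sum>k\<in>{1..K}. majority n (G k \<zeta> \<nu>)))" for n \<zeta> \<nu>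
    have "tube_series a (rem n)" for n
      unfolding rem_def[abs_def]
      by (intro tube_series_mult tube_series_power tube_series_fourier_tube tube_series_diff tube_series_sum tube_series_const tube_series_majority G(1) wt) (use a in auto)
    then have "\<forall>n. \<exists>c. weighted a c \<and> (\<forall>\<zeta> \<nu>. norm \<nu> \<le> a \<longrightarrow> rem n \<zeta> \<nu> = fourier_tube c \<zeta> \<nu>)"
      unfolding tube_series_def by blast
    from choice[OF this] obtain cr where "\<forall>n. weighted a (cr n) \<and> (\<forall>\<zeta> \<nu>. norm \<nu> \<le> a \<longrightarrow> rem n \<zeta> \<nu> = fourier_tube (cr n) \<zeta> \<nu>)" ..
    then have cr: "\<And>n. weighted a (cr n)" "\<And>n \<zeta> \<nu>. norm \<nu> \<le> a \<Longrightarrow> rem n \<zeta> \<nu> = fourier_tube (cr n) \<zeta> \<nu>"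
      by blast+
    have norm0: "norm (0::real^'d) \<le> a" using a by simp
    have decomp: "conv_power \<phi> n x = (\<Sum>k\<in>{1..K}. c k n x) + cr n x" if n: "n \<ge> 1" for n x
    proof -
      let ?V = "of_real ((2 * pi) ^ CARD('d)) :: complex"
      have cp: "weighted a (conv_power \<phi> n)" "\<And>\<zeta>. fourier_tube (conv_power \<phi> n) \<zeta> 0 = fourier_tube \<phi> \<zeta> 0 ^ n"
        using conv_power_weighted[OF _ wt n] a by auto
      have "((\<lambda>\<zeta>. (\<Sum>k\<in>{1..K}. fourier_tube (c k n) \<zeta> 0 * tilted_char (- x) \<zeta> 0) + fourier_tube (cr n) \<zeta> 0 * tilted_char (- x) \<zeta> 0) has_integral
        (\<Sum>k\<in>{1..K}. ?V * c k n x) + ?V * cr n x) closed_torus"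
        by (intro has_integral_add has_integral_sum has_integral_inversion[OF c(1) norm0] has_integral_inversion[OF cr(1) norm0]) auto
      also have "(\<lambda>\<zeta>. (\<Sum>k\<in>{1..K}. fourier_tube (c k n) \<zeta> 0 * tilted_char (- x) \<zeta> 0) + fourier_tube (cr n) \<zeta> 0 * tilted_char (- x) \<zeta> 0)
         = (\<lambda>\<zeta>. fourier_tube (conv_power \<phi> n) \<zeta> 0 * tilted_char (- x) \<zeta> 0)"
        unfolding cp(2) c(2)[OF norm0, symmetric] cr(2)[OF norm0, symmetric] rem_def
        by (simp add: fun_eq_iff sum_distrib_left sum_distrib_right algebra_simps)
      finally have "(\<Sum>k\<in>{1..K}. ?V * c k n x) + ?V * cr n x = ?V * conv_power \<phi> n x"
        using has_integral_inversion[OF cp(1) norm0, of x] has_integral_unique by blast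
      then have "?V * ((\<Sum>k\<in>{1..K}. c k n x) + cr n x) = ?V * conv_power \<phi> n x"
        by (simp only: sum_distrib_left distrib_left)
      then show ?thesis by simp
    qed
    obtain L where L: "L > 0" "\<And>n x. n \<ge> 1 \<Longrightarrow> norm (real_vec x) > L * real n \<Longrightarrow>
       cmod (conv_power \<phi> n x) \<le> exp (- (a / 2) * (real n + norm (real_vec x)))"
      using far_field[OF a wt \<xi>t(2)[of 1]] K1 by auto
    have "\<forall>k. \<exists>KG>0. \<forall>\<zeta> \<zeta>' \<nu> \<nu>'. norm \<nu> \<le> a / 2 \<longrightarrow> norm \<nu>' \<le> a / 2 \<longrightarrow>
       cmod (G k \<zeta> \<nu> - G k \<zeta>' \<nu>') \<le> KG * (norm (\<zeta> - \<zeta>') + norm (\<nu> - \<nu>'))"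
      using tube_series_lipschitz[OF a G(1)] by blast
    from choice[OF this] obtain KG where "\<forall>k. KG k > 0 \<and> (\<forall>\<zeta> \<zeta>' \<nu> \<nu>'. norm \<nu> \<le> a / 2 \<longrightarrow> norm \<nu>' \<le> a / 2 \<longrightarrow>
       cmod (G k \<zeta> \<nu> - G k \<zeta>' \<nu>') \<le> KG k * (norm (\<zeta> - \<zeta>') + norm (\<nu> - \<nu>')))" ..
    then have KG: "\<And>k. KG k > 0 \<and> (\<forall>\<zeta> \<zeta>' \<nu> \<nu>'. norm \<nu> \<le> a / 2 \<longrightarrow> norm \<nu>' \<le> a / 2 \<longrightarrow>
       cmod (G k \<zeta> \<nu> - G k \<zeta>' \<nu>') \<le> KG k * (norm (\<zeta> - \<zeta>') + norm (\<nu> - \<nu>')))"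
      by blast
    have "\<exists>\<epsilon>>0. \<exists>C>0. \<forall>n. \<forall>\<zeta>\<in>closed_torus. cmod (fourier_tube \<phi> \<zeta> 0 ^ n * (1 - (\<Sum>k\<in>{1..K}. majority n (G k \<zeta> 0)))) \<le> C * exp (- (\<epsilon> * real n))"
    proof (rule pointwise_remainder[where b="a/2" and KG=KG and \<Lambda>=\<Lambda>])
      show "continuous_on UNIV (\<lambda>\<zeta>. fourier_tube \<phi> \<zeta> 0)" by (rule continuous_on_fourier_tube[OF wt norm0])
      show "cmod (fourier_tube \<phi> \<zeta> 0) \<le> 1" for \<zeta> using F1[of \<zeta>] by (simp add: fourier_eq_fourier_tube)
      show "\<Lambda> = {\<omega> \<in> closed_torus. cmod (fourier_tube \<phi> \<omega> 0) = 1}" by (simp add: \<Lambda>_def fourier_eq_fourier_tube)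
      show "\<exists>k\<in>{1..K}. G k \<omega> 0 = 1 \<and> (\<forall>l\<in>{1..K} - {k}. cmod (G l \<omega> 0) \<le> 1 / 200)" if \<omega>: "\<omega> \<in> \<Lambda>" for \<omega>
      proof -
        obtain v where v: "v \<in> torus" "cong2pi \<omega> v" using torus_representative by blast
        have "v \<in> Omega \<phi>" using v \<omega> fourier_cong2pi[OF v(2), of \<phi>] by (simp add: Omega_def \<Lambda>_def)
        then have "v \<in> \<xi> ` {1..K}" using bij_betw_imp_surj_on[OF bij] by blast
        then obtain k where k: "k \<in> {1..K}" "v = \<xi> k" by blast
        have "\<not> cong2pi \<omega> (\<xi> l)" if "l \<in> {1..K} - {k}" for l
        proof
          assume "cong2pi \<omega> (\<xi> l)"
          then have "cong2pi (\<xi> k) (\<xi> l)" using cong2pi_trans[OF cong2pi_sym[OF v(2)]] k by blast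
          then show False using uniq[OF k(1), of l] that by blast
        qed
        then have "cmod (G l \<omega> 0) \<le> 1 / 200" if "l \<in> {1..K} - {k}" for l
          using G(3)[OF \<omega>, of l] that by simp
        moreover have "G k \<omega> 0 = 1" using G(3)[OF \<omega>, of k] v(2) k by simp
        ultimately show ?thesis using k(1) by blast
      qed
    qed (use a KG G(2) in auto)
    then obtain \<epsilon>0 C0 where e0: "\<epsilon>0 > 0" and C0: "C0 > 0" and remb: "\<And>n \<zeta>. \<zeta> \<in> closed_torus \<Longrightarrow> cmod (rem n \<zeta> 0) \<le> C0 * exp (- (\<epsilon>0 * real n))"
      unfolding rem_def by blast
    have crb: "cmod (cr n x) \<le> C0 * exp (- (\<epsilon>0 * real n))" for n x
    proof -
      have "(2 * pi) ^ CARD('d) * cmod (cr n x) \<le> exp (real_vec x \<bullet> 0) * ((2 * pi) ^ CARD('d) * (C0 * exp (- (\<epsilon>0 * real n))))"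
        by (rule coefficient_bound[OF cr(1) norm0 has_integral_const_closed_torus]) (use remb cr(2)[OF norm0] in auto)
      then show ?thesis by simp
    qed
    define b where "b k C M n x = C / real n powr hom_order (P k) *
        exp (- real n * M * legendre (\<lambda>\<eta>. Re (P k \<eta>)) ((1 / real n) *\<^sub>R (real_vec x - real n *\<^sub>R \<alpha> k)))"
      for k n :: nat and C M :: real and x :: "int^'d"
    have "\<exists>C>0. \<exists>M>0. \<forall>n\<ge>1. \<forall>x. norm (real_vec x) \<le> L * real n \<longrightarrow>
      cmod (c k n x) \<le> b k C M n x \<and> exp (- (\<epsilon>0 * real n)) \<le> b k C M n x" if k: "k \<in> {1..K}" for k
      using peak_contribution[OF a wt F1 \<Lambda>_def fin \<xi>t(2)[OF k] exps[rule_format, OF k] G(1)[where k=k] G(2)[where k=k] G(3)[where k=k] L(1) e0 c(1)[where k=k] c(2)[where k=k]]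
      unfolding Let_def b_def by blast
    then have prs: "\<exists>CM. fst CM > 0 \<and> snd CM > 0 \<and> (\<forall>n\<ge>1. \<forall>x. norm (real_vec x) \<le> L * real n \<longrightarrow>
      cmod (c k n x) \<le> b k (fst CM) (snd CM) n x \<and> exp (- (\<epsilon>0 * real n)) \<le> b k (fst CM) (snd CM) n x)" if "k \<in> {1..K}" for k
      using that by fastforce
    have "\<exists>CM. \<forall>k\<in>{1..K}. fst (CM k) > 0 \<and> snd (CM k) > 0 \<and> (\<forall>n\<ge>1. \<forall>x. norm (real_vec x) \<le> L * real n \<longrightarrow>
      cmod (c k n x) \<le> b k (fst (CM k)) (snd (CM k)) n x \<and> exp (- (\<epsilon>0 * real n)) \<le> b k (fst (CM k)) (snd (CM k)) n x)"
      by (rule bchoice) (use prs in blast)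
    then obtain CM where CM: "\<And>k. k \<in> {1..K} \<Longrightarrow> fst (CM k) > 0" "\<And>k. k \<in> {1..K} \<Longrightarrow> snd (CM k) > 0"
      "\<And>k n x. k \<in> {1..K} \<Longrightarrow> n \<ge> 1 \<Longrightarrow> norm (real_vec x) \<le> L * real n \<Longrightarrow>
      cmod (c k n x) \<le> b k (fst (CM k)) (snd (CM k)) n x \<and> exp (- (\<epsilon>0 * real n)) \<le> b k (fst (CM k)) (snd (CM k)) n x"
      by blast
    define M where "M k = (if k = 0 then a / 2 else snd (CM k))" for k
    \<comment> \<open>The remainder is absorbed by the first peak; the common factor \<open>1 + C0\<close> keeps the formula uniform.\<close>
    define C where "C k = (1 + C0) * fst (CM k)" for k
    have near: "cmod (conv_power \<phi> n x) \<le> (\<Sum>k=1..K. b k (C k) (M k) n x)"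
      if n: "n \<ge> 1" and x: "norm (real_vec x) \<le> L * real n" for n x
    proof -
      let ?b = "\<lambda>k. b k (fst (CM k)) (snd (CM k)) n x"
      have b0: "?b k \<ge> 0" if "k \<in> {1..K}" for k using CM(3)[OF that n x] norm_ge_zero order_trans by blast
      have "cmod (conv_power \<phi> n x) \<le> (\<Sum>k\<in>{1..K}. cmod (c k n x)) + cmod (cr n x)"
        unfolding decomp[OF n] by (intro order_trans[OF norm_triangle_ineq] add_right_mono norm_sum)
      also have "\<dots> \<le> (\<Sum>k\<in>{1..K}. ?b k) + C0 * ?b 1"
      proof (intro add_mono sum_mono)
        show "cmod (c k n x) \<le> ?b k" if "k \<in> {1..K}" for k using CM(3)[OF that n x] by blast
        have "exp (- (\<epsilon>0 * real n)) \<le> ?b 1" using CM(3)[OF _ n x, of 1] K1 by simp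
        then have "C0 * exp (- (\<epsilon>0 * real n)) \<le> C0 * ?b 1" using C0 by (intro mult_left_mono) auto
        then show "cmod (cr n x) \<le> C0 * ?b 1" using crb[of n x] by linarith
      qed
      also have "\<dots> \<le> (\<Sum>k\<in>{1..K}. ?b k) + C0 * (\<Sum>k\<in>{1..K}. ?b k)"
        using C0 K1 b0 by (intro add_left_mono mult_left_mono member_le_sum) auto
      also have "\<dots> = (\<Sum>k=1..K. (1 + C0) * ?b k)" by (simp add: sum_distrib_left distrib_right sum.distrib)
      also have "\<dots> = (\<Sum>k=1..K. b k (C k) (M k) n x)"
        by (intro sum.cong refl) (auto simp: b_def C_def M_def)
      finally show ?thesis .
    qed
    show ?thesis
    proof (rule exI[of _ L], rule exI[of _ M], rule exI[of _ C], intro conjI allI impI)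
      show "L > 0" by (rule L(1))
      show "\<forall>k\<in>{0..K}. M k > 0" using a CM(2) by (auto simp: M_def)
      show "\<forall>k\<in>{1..K}. C k > 0" using C0 CM(1) by (auto simp: C_def)
      fix n :: nat and x :: "int^'d" assume n: "n \<ge> 1"
      show "cmod (conv_power \<phi> n x) \<le>
               (if norm (real_vec x) > L * real n
                then exp (- M 0 * (real n + norm (real_vec x)))
                else (\<Sum>k=1..K. C k / real n powr hom_order (P k) *
                        exp (- real n * M k *
                          legendre (\<lambda>\<eta>. Re (P k \<eta>))
                            ((1 / real n) *\<^sub>R (real_vec x - real n *\<^sub>R \<alpha> k)))))"
      proof (cases "norm (real_vec x) > L * real n")
        case True
        then show ?thesis using L(2)[OF n True] by (simp add: M_def)
      next
        case False
        then show ?thesis using near[OF n, of x] by (simp add: b_def)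
      qed
    qed
  qed
  show ?thesis using finO main by blast
qed

end
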